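(* Let $\mathbb K$ be a field and $L$ an oriented linear graph satisfying property $D(2)$ but not $D(1)$. Let $A_{k_1},\dots,A_{k_h}$ be the connected components of $\mathrm{Red}\,L$, ordered by their minimal-index vertex. Then: (1) if there exists $j\in\{1,\dots,h-1\}$ with $k_j\equiv 0\pmod 3$, then $\mathrm{H}^*_\mu(L;\mathbb K)=0$; (2) otherwise \[\mathrm{H}^{*+h-1}_\mu(L;\mathbb K)\cong \mathrm{H}^*_\mu(A_{3\lfloor k_1/3\rfloor};\mathbb K)\otimes\cdots\otimes \mathrm{H}^*_\mu(A_{3\lfloor k_{h-1}/3\rfloor};\mathbb K)\otimes \mathrm{H}^*_\mu(A_{k_h};\mathbb K),\] where $\otimes$ is the graded tensor product over $\mathbb K$.
   Context: An oriented linear graph $L$ is a digraph with vertices $v_0,\dots,v_{n-1}$ such that for each $i=1,\dots,n-1$ exactly one of $(v_i,v_{i-1})$, $(v_{i-1},v_i)$ is an edge, and there are no other edges. $A_k$ denotes the alternating linear graph on $k+1$ vertices (consecutive edges oppositely oriented). A vertex is unstable if it is both the source of some edge and the target of some edge, and stable otherwise. For vertices $v,w$, $d(v,w)$ is the length of the (unique) directed simple path from one to the other if it exists, and $-\infty$ otherwise. $L$ satisfies $D(k)$ if $d(v,w)\le k$ for all stable vertices $v,w$. The reduction $\mathrm{Red}\,L$ is the spanning subgraph obtained as follows: for each maximal directed simple path in $L$, with vertex set $\{v_j,\dots,v_{j+m}\}$ ordered by index, delete all its edges except the one between $v_{j+m-1}$ and $v_{j+m}$; each connected component of $\mathrm{Red}\,L$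 is isomorphic to some $A_k$. A multipath of a digraph is a spanning subgraph each of whose connected components is a single vertex or a simple directed path. Multipath cohomology $\mathrm{H}^*_\mu(G;\mathbb K)$ is the cohomology of the complex whose degree $n$ part has basis $b_H$ for multipaths $H$ with $n$ edges, with $d b_H=\sum_e(-1)^{\epsilon(H,H\cup e)}b_{H\cup e}$ over edges $e\notin H$ with $H\cup e$ a multipath, $\epsilon(H,H\cup e)$ = number of edges of $H$ preceding $e$ in a fixed total order of $E(G)$. *)

theory Defs
  imports
    "Graph_Theory.Graph_Theory"
    "Jordan_Normal_Form.VS_Connect"
    "HOL-Algebra.AbelCoset"
    "HOL-Library.Extended"
begin

section \<open>Digraphs, components and multipaths\<close>

text \<open>Connectedness ignores the direction of the edges: the library's \<^const>\<open>Digraph_Component.connected\<close>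
  refers to the symmetric closure.\<close>

definition weak_components :: "('a, 'b) pre_digraph \<Rightarrow> ('a, 'b) pre_digraph set" where
  "weak_components G =
     {C. induced_subgraph C G \<and> Digraph_Component.connected C \<and>
         \<not> (\<exists>D. induced_subgraph D G \<and> Digraph_Component.connected D \<and> verts C \<subset> verts D)}"

definition is_single_vertex :: "('a, 'b) pre_digraph \<Rightarrow> bool" where
  "is_single_vertex C \<longleftrightarrow> (\<exists>x. verts C = {x}) \<and> arcs C = {}"

definition is_directed_path :: "('a, 'b) pre_digraph \<Rightarrow> bool" where
  "is_directed_path C \<longleftrightarrow>
     (\<exists>u p w. p \<noteq> [] \<and> pre_digraph.apath C u p w \<and>
        verts C = set (pre_digraph.awalk_verts C u p) \<and> arcs C = set p)"

definition multipath :: "'v pair_pre_digraph \<Rightarrow> 'v pair_pre_digraph \<Rightarrow> bool" where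
  "multipath G H \<longleftrightarrow>
     spanning H G \<and> (\<forall>C \<in> weak_components H. is_single_vertex C \<or> is_directed_path C)"

abbreviation insert_edge :: "'v \<times> 'v \<Rightarrow> 'v pair_pre_digraph \<Rightarrow> 'v pair_pre_digraph" where
  "insert_edge e H \<equiv> H\<lparr>parcs := insert e (parcs H)\<rparr>"


section \<open>Oriented linear graphs\<close>

definition oriented_linear_graph :: "(nat \<Rightarrow> 'v) \<Rightarrow> nat \<Rightarrow> 'v pair_pre_digraph \<Rightarrow> bool" where
  "oriented_linear_graph v n L \<longleftrightarrow>
     inj_on v {..<n} \<and> pverts L = v ` {..<n} \<and>
     (\<forall>i \<in> {1..<n}. ((v i, v (i - 1)) \<in> parcs L) \<noteq> ((v (i - 1), v i) \<in> parcs L)) \<and>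
     parcs L \<subseteq> (\<Union>i \<in> {1..<n}. {(v i, v (i - 1)), (v (i - 1), v i)})"

text \<open>There are two alternating orientations of the linear graph on \<open>k + 1\<close> vertices, exchanged by
  reversing all edges (and not isomorphic for even \<open>k > 0\<close>). The flag \<open>b\<close> selects one of them:
  \<open>b\<close> holds iff the edge between \<open>0\<close> and \<open>1\<close> starts at \<open>0\<close>.\<close>

definition alternating_graph :: "bool \<Rightarrow> nat \<Rightarrow> nat pair_pre_digraph" where
  "alternating_graph b k =
     \<lparr> pverts = {0..k}, parcs = (\<lambda>i. if even i = b then (i, i + 1) else (i + 1, i)) ` {..<k} \<rparr>"

definition unstable :: "'v pair_pre_digraph \<Rightarrow> 'v \<Rightarrow> bool" where
  "unstable G x \<longleftrightarrow> (\<exists>e \<in> parcs G. fst e = x) \<and> (\<exists>e \<in> parcs G. snd e = x)"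

definition stable :: "'v pair_pre_digraph \<Rightarrow> 'v \<Rightarrow> bool" where
  "stable G x \<longleftrightarrow> x \<in> pverts G \<and> \<not> unstable G x"

text \<open>In an oriented linear graph there is at most one directed simple path connecting two
  given vertices, in whichever direction, so the definite description is well defined.\<close>

definition path_dist :: "'v pair_pre_digraph \<Rightarrow> 'v \<Rightarrow> 'v \<Rightarrow> nat extended" where
  "path_dist G x y =
     (if \<exists>p. pre_digraph.apath G x p y \<or> pre_digraph.apath G y p x
      then Fin (length (THE p. pre_digraph.apath G x p y \<or> pre_digraph.apath G y p x))
      else -\<infinity>)"

definition property_D :: "nat \<Rightarrow> 'v pair_pre_digraph \<Rightarrow> bool" where
  "property_D k G \<longleftrightarrow> (\<forall>x y. stable G x \<and> stable G y \<longrightarrow> path_dist G x y \<le> Fin k)"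

definition maximal_apath :: "'v pair_pre_digraph \<Rightarrow> 'v \<Rightarrow> ('v \<times> 'v) list \<Rightarrow> 'v \<Rightarrow> bool" where
  "maximal_apath G u p w \<longleftrightarrow>
     pre_digraph.apath G u p w \<and>
     (\<forall>u' p' w'. pre_digraph.apath G u' p' w' \<and>
        set (pre_digraph.awalk_verts G u p) \<subseteq> set (pre_digraph.awalk_verts G u' p') \<and>
        set p \<subseteq> set p' \<longrightarrow> set p' = set p)"

text \<open>Which edge of a maximal path survives depends on the enumeration \<open>v\<close> only, not on the
  direction in which the path is traversed.\<close>

definition reduction :: "(nat \<Rightarrow> 'v) \<Rightarrow> nat \<Rightarrow> 'v pair_pre_digraph \<Rightarrow> 'v pair_pre_digraph" where
  "reduction v n L =
     L\<lparr>parcs := parcs L -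
        {e. \<exists>u p w j m. maximal_apath L u p w \<and> j + m < n \<and>
              set (pre_digraph.awalk_verts L u p) = v ` {j..j + m} \<and>
              e \<in> set p \<and> {fst e, snd e} \<noteq> {v (j + m - 1), v (j + m)}}\<rparr>"

definition min_index :: "(nat \<Rightarrow> 'v) \<Rightarrow> nat \<Rightarrow> ('v, 'e) pre_digraph \<Rightarrow> nat" where
  "min_index v n C = Min {i. i < n \<and> v i \<in> verts C}"


section \<open>Vector spaces\<close>

text \<open>The ground field is a type \<^typ>\<open>'k::field\<close>, viewed as the record \<^term>\<open>class_ring :: 'k::field ring\<close>;
  vector spaces are module records over it, whose fields \<^const>\<open>mult\<close> and \<^const>\<open>one\<close> are
  irrelevant.\<close>

definition free_space :: "'b set \<Rightarrow> ('k::field, 'b \<Rightarrow> 'k) module" where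
  "free_space B =
     \<lparr> carrier = {f. finite {x. f x \<noteq> 0} \<and> {x. f x \<noteq> 0} \<subseteq> B},
       mult = undefined, one = undefined,
       zero = (\<lambda>_. 0), add = (\<lambda>f g x. f x + g x), smult = (\<lambda>a f x. a * f x) \<rparr>"

definition basis_elt :: "'b \<Rightarrow> 'b \<Rightarrow> 'k::field" where
  "basis_elt b = (\<lambda>x. if x = b then 1 else 0)"

definition quotient_space :: "('k::field, 'a) module \<Rightarrow> 'a set \<Rightarrow> ('k, 'a set) module" where
  "quotient_space V W =
     \<lparr> carrier = a_rcosets\<^bsub>V\<^esub> W,
       mult = undefined, one = undefined,
       zero = W, add = (\<lambda>X Y. X <+>\<^bsub>V\<^esub> Y),
       smult = (\<lambda>a X. \<Union>x \<in> X. W +>\<^bsub>V\<^esub> (a \<odot>\<^bsub>V\<^esub> x)) \<rparr>"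

definition direct_sum_space :: "'i set \<Rightarrow> ('i \<Rightarrow> ('k::field, 'a) module) \<Rightarrow> ('k, 'i \<Rightarrow> 'a) module" where
  "direct_sum_space I V =
     \<lparr> carrier = {f \<in> (\<Pi>\<^sub>E i \<in> I. carrier (V i)). finite {i \<in> I. f i \<noteq> \<zero>\<^bsub>V i\<^esub>}},
       mult = undefined, one = undefined,
       zero = (\<lambda>i \<in> I. \<zero>\<^bsub>V i\<^esub>), add = (\<lambda>f g. \<lambda>i \<in> I. f i \<oplus>\<^bsub>V i\<^esub> g i),
       smult = (\<lambda>a f. \<lambda>i \<in> I. a \<odot>\<^bsub>V i\<^esub> f i) \<rparr>"

definition space_iso :: "('k::field, 'a) module \<Rightarrow> ('k, 'b) module \<Rightarrow> bool" where
  "space_iso V W \<longleftrightarrow>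
     (\<exists>T. linear_map (class_ring :: 'k ring) V W T \<and> bij_betw T (carrier V) (carrier W))"

text \<open>The tensor product of a list of vector spaces: the free space on the tuples
  \<open>(x\<^sub>1, \<dots>, x\<^sub>h)\<close> modulo additivity and homogeneity in each argument.\<close>

definition tensor_relations :: "('k::field, 'a) module list \<Rightarrow> ('a list \<Rightarrow> 'k) set" where
  "tensor_relations Vs =
     {\<lambda>t. basis_elt (xs[i := x \<oplus>\<^bsub>Vs ! i\<^esub> y]) t - basis_elt (xs[i := x]) t - basis_elt (xs[i := y]) t
        | xs i x y. xs \<in> listset (map carrier Vs) \<and> i < length Vs \<and>
                    x \<in> carrier (Vs ! i) \<and> y \<in> carrier (Vs ! i)} \<union>
     {\<lambda>t. basis_elt (xs[i := a \<odot>\<^bsub>Vs ! i\<^esub> x]) t - a * basis_elt (xs[i := x]) t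
        | xs i a x. xs \<in> listset (map carrier Vs) \<and> i < length Vs \<and> x \<in> carrier (Vs ! i)}"

definition tensor_space :: "('k::field, 'a) module list \<Rightarrow> ('k, ('a list \<Rightarrow> 'k) set) module" where
  "tensor_space Vs =
     (let F = free_space (listset (map carrier Vs)) :: ('k, 'a list \<Rightarrow> 'k) module
      in quotient_space F (LinearCombinations.module.span (class_ring :: 'k ring) F (tensor_relations Vs)))"

text \<open>A graded space is given by its homogeneous parts, indexed by all integers. In degree \<open>n\<close>,
  the graded tensor product is the direct sum, over all \<open>(d\<^sub>1, \<dots>, d\<^sub>h)\<close> with
  \<open>d\<^sub>1 + \<dots> + d\<^sub>h = n\<close>, of the tensor products of the parts of degree \<open>d\<^sub>1, \<dots>, d\<^sub>h\<close>.\<close>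

definition graded_tensor ::
  "(int \<Rightarrow> ('k::field, 'a) module) list \<Rightarrow> int \<Rightarrow> ('k, int list \<Rightarrow> ('a list \<Rightarrow> 'k) set) module" where
  "graded_tensor Vs n =
     direct_sum_space {ds. length ds = length Vs \<and> sum_list ds = n}
       (\<lambda>ds. tensor_space (map2 (\<lambda>V d. V d) Vs ds))"


section \<open>Multipath cohomology\<close>

text \<open>\<open>r\<close> is the chosen (reflexive) total order on the edges of \<open>G\<close>, and \<open>G\<close> is meant to be finite.
  Degrees are integers; the cochain space is zero in negative degrees, as no multipath has a
  negative number of edges.\<close>

definition cochain_space :: "'v pair_pre_digraph \<Rightarrow> int \<Rightarrow> ('k::field, 'v pair_pre_digraph \<Rightarrow> 'k) module" where
  "cochain_space G n = free_space {H. multipath G H \<and> int (card (parcs H)) = n}"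

definition edges_before :: "('v \<times> 'v) rel \<Rightarrow> 'v pair_pre_digraph \<Rightarrow> 'v \<times> 'v \<Rightarrow> nat" where
  "edges_before r H e = card {f \<in> parcs H. f \<noteq> e \<and> (f, e) \<in> r}"

definition differential ::
  "('v \<times> 'v) rel \<Rightarrow> 'v pair_pre_digraph \<Rightarrow> ('v pair_pre_digraph \<Rightarrow> 'k::field) \<Rightarrow> 'v pair_pre_digraph \<Rightarrow> 'k" where
  "differential r G c = (\<lambda>X.
     \<Sum>H | multipath G H. c H *
       (\<Sum>e | e \<in> parcs G \<and> e \<notin> parcs H \<and> multipath G (insert_edge e H).
          (-1) ^ edges_before r H e * basis_elt (insert_edge e H) X))"

text \<open>The first argument only fixes the ground field \<^typ>\<open>'k::field\<close>.\<close>

definition multipath_cohomology ::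
  "'k::field itself \<Rightarrow> ('v \<times> 'v) rel \<Rightarrow> 'v pair_pre_digraph \<Rightarrow> int \<Rightarrow>
     ('k, ('v pair_pre_digraph \<Rightarrow> 'k) set) module" where
  "multipath_cohomology K r G n =
     (let C = cochain_space G :: int \<Rightarrow> ('k, 'v pair_pre_digraph \<Rightarrow> 'k) module;
          Z = {c \<in> carrier (C n). differential r G c = \<zero>\<^bsub>C (n + 1)\<^esub>};
          B = differential r G ` carrier (C (n - 1))
      in quotient_space ((C n)\<lparr>carrier := Z\<rparr>) B)"

end

(*
  A set of edges of L is a multipath iff no two consecutive edges in it meet at a stable vertex.
  Hence the cochain complex is that of an independence complex of a disjoint union of paths,
  obtained by cutting L at its unstable vertices. If a is a leaf with neighbour b, then deleting b
  leaves a cone with apex a, so the cohomology equals that of the link of b, shifted by one. Peeling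
  off a path with m edges in this way removes three edges at a time, so it contributes a
  one-dimensional factor of degree (m + 1) div 3, unless m mod 3 = 1, when the complex is acyclic. By D(2)
  unstable vertices are never adjacent, so the reduction deletes exactly the edge before each unstable
  vertex; the paths therefore have k_1 + 1, ..., k_(h-1) + 1 and k_h edges. All cohomology spaces
  have dimension at most one, so the isomorphism is a comparison of degrees.
*)

theory Submission
  imports Defs
begin


section \<open>Independence complexes of paths\<close>


text \<open>The disjoint union of paths is kept as one interval of edge indices, with
  \<open>t i\<close> recording that the edges \<open>i\<close> and \<open>Suc i\<close> may occur
  together. Induction from the right end then crosses the cuts by itself, and no join or Kuenneth
  theorem is required for L; a tensor product is evaluated only for the factors, all of dimension at
  most one. Incidence signs are axiomatic because the induction passes to links: the link of b
  inherits the sign of e in X with b added, which differs from the sign given by the order on the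
  remaining edges by a factor -1 whenever b precedes e. The axioms survive, and they suffice for d d
  = 0 and for contracting a cone. The shift by h - 1 and the truncation to 3 (k div 3) come from one
  computation. A block other than the last accounts for k + 1 edges. If 3 divides k, then k + 1
  leaves remainder 1 and everything is acyclic; otherwise its degree is (k + 2) div 3 = k div 3 + 1,
  whereas the alternating graph with 3 (k div 3) edges has degree k div 3.\<close>

definition simplicial :: "'e set set \<Rightarrow> bool" where
  "simplicial D \<longleftrightarrow> (\<forall>X\<in>D. finite X \<and> (\<forall>Y. Y \<subseteq> X \<longrightarrow> Y \<in> D))"

text \<open>\<open>s X i\<close> is the incidence number of X in X with i added. The first axiom
  makes it its own inverse; the second makes the two ways of adding i and j cancel.\<close>

definition incidence_signs :: "'e set set \<Rightarrow> ('e set \<Rightarrow> 'e \<Rightarrow> 'k::field) \<Rightarrow> bool" where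
  "incidence_signs D s \<longleftrightarrow>
     (\<forall>X i. i \<notin> X \<longrightarrow> insert i X \<in> D \<longrightarrow> s X i * s X i = 1) \<and>
     (\<forall>X i j. i \<notin> X \<longrightarrow> j \<notin> X \<longrightarrow> i \<noteq> j \<longrightarrow> insert i (insert j X) \<in> D \<longrightarrow>
        s X i * s (insert i X) j = - (s X j * s (insert j X) i))"

text \<open>The grading is by cardinality, so the empty face has degree 0: this is the augmented
  complex, shifted by one, as for multipaths graded by their number of edges.\<close>

definition cochains :: "'e set set \<Rightarrow> int \<Rightarrow> ('e set \<Rightarrow> 'k::field) set" where
  "cochains D n = {f. \<forall>X. f X \<noteq> 0 \<longrightarrow> X \<in> D \<and> int (card X) = n}"

text \<open>The value is collected at the larger face X; it is cut off outside D, so that the result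
  is again supported on D.\<close>

definition coboundary :: "'e set set \<Rightarrow> ('e set \<Rightarrow> 'e \<Rightarrow> 'k::field) \<Rightarrow> ('e set \<Rightarrow> 'k) \<Rightarrow> 'e set \<Rightarrow> 'k" where
  "coboundary D s f X = (if X \<in> D then \<Sum>e\<in>X. s (X - {e}) e * f (X - {e}) else 0)"

text \<open>Dimension 1 if d and 0 otherwise, expressed without a quotient: the class of
  \<open>z\<close> spans the cohomology, and it vanishes exactly when d fails.\<close>

definition cohomology_dim :: "bool \<Rightarrow> 'e set set \<Rightarrow> ('e set \<Rightarrow> 'e \<Rightarrow> 'k::field) \<Rightarrow> int \<Rightarrow> bool" where
  "cohomology_dim d D s n \<longleftrightarrow>
     (\<exists>z \<in> cochains D n. coboundary D s z = (\<lambda>_. 0) \<and>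
        (z \<in> coboundary D s ` cochains D (n - 1) \<longleftrightarrow> \<not> d) \<and>
        (\<forall>c \<in> cochains D n. coboundary D s c = (\<lambda>_. 0) \<longrightarrow>
           (\<exists>a. \<exists>g \<in> cochains D (n - 1). c = (\<lambda>X. a * z X + coboundary D s g X))))"

lemma incidence_signs_swap:
  assumes "incidence_signs D s" "i \<notin> X" "j \<notin> X" "i \<noteq> j" "insert i (insert j X) \<in> D"
  shows "s X i * s (insert i X) j = - (s X j * s (insert j X) i)"
  using assms(1)[unfolded incidence_signs_def, THEN conjunct2, rule_format, OF assms(2-5)] .

lemma coboundary_add:
  "coboundary D s (\<lambda>X. f X + g X) = (\<lambda>X. coboundary D s f X + coboundary D s g X)"
  by (auto simp: coboundary_def fun_eq_iff algebra_simps sum.distrib)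

lemma coboundary_scale:
  "coboundary D s (\<lambda>X. a * f X) = (\<lambda>X. a * coboundary D s f X)"
  by (auto simp: coboundary_def fun_eq_iff sum_distrib_left algebra_simps)

lemma coboundary_zero: "coboundary D s (\<lambda>_. 0) = (\<lambda>_. 0)"
  by (auto simp: coboundary_def)

lemma cochains_iff: "f \<in> cochains D n \<longleftrightarrow> (\<forall>X. \<not> (X \<in> D \<and> int (card X) = n) \<longrightarrow> f X = 0)"
  unfolding cochains_def by blast

lemma cochains_zero: "(\<lambda>_. 0) \<in> cochains D n"
  and cochains_add: "f \<in> cochains D n \<Longrightarrow> g \<in> cochains D n \<Longrightarrow> (\<lambda>X. f X + g X) \<in> cochains D n"
  and cochains_diff: "f \<in> cochains D n \<Longrightarrow> g \<in> cochains D n \<Longrightarrow> (\<lambda>X. f X - g X) \<in> cochains D n"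
  and cochains_scale: "f \<in> cochains D n \<Longrightarrow> (\<lambda>X. a * f X) \<in> cochains D n"
  by (simp_all add: cochains_iff)

lemma cochains_mono: "D \<subseteq> D' \<Longrightarrow> f \<in> cochains D n \<Longrightarrow> f \<in> cochains D' n"
  by (auto simp: cochains_def)

lemma coboundary_in_cochains:
  assumes "simplicial D" "f \<in> cochains D (n - 1)"
  shows "coboundary D s f \<in> cochains D n"
proof -
  have "X \<in> D \<and> int (card X) = n" if "coboundary D s f X \<noteq> 0" for X
  proof -
    from that have X: "X \<in> D" and ne: "(\<Sum>e\<in>X. s (X - {e}) e * f (X - {e})) \<noteq> 0"
      by (auto simp: coboundary_def split: if_splits)
    then obtain e where e: "e \<in> X" "f (X - {e}) \<noteq> 0"
      by (metis (no_types, lifting) mult_zero_right sum.neutral)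
    with assms have "int (card (X - {e})) = n - 1" by (auto simp: cochains_def)
    moreover have "finite X" using assms(1) X by (auto simp: simplicial_def)
    ultimately show ?thesis using X e(1) card_Suc_Diff1[of X e] by auto
  qed
  then show ?thesis by (auto simp: cochains_def)
qed

text \<open>The terms for (e, f) and (f, e) cancel in pairs. Swapping the two sums would only show
  that the sum is its own negative, which says nothing in characteristic 2; hence the
  induction.\<close>

lemma sum_antisymmetric:
  fixes h :: "'e \<Rightarrow> 'e \<Rightarrow> 'k::field"
  assumes "finite A" "\<And>e f. e \<in> A \<Longrightarrow> f \<in> A \<Longrightarrow> e \<noteq> f \<Longrightarrow> h e f = - h f e"
  shows "(\<Sum>e\<in>A. \<Sum>f\<in>A - {e}. h e f) = 0"
  using assms
proof (induction A rule: finite_induct)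
  case (insert x A)
  have "(\<Sum>e\<in>insert x A. \<Sum>f\<in>insert x A - {e}. h e f)
        = (\<Sum>f\<in>A. h x f) + (\<Sum>e\<in>A. h e x + (\<Sum>f\<in>A - {e}. h e f))"
  proof -
    have "insert x A - {e} = insert x (A - {e})" if "e \<in> A" for e using that insert.hyps by auto
    moreover have "insert x A - {x} = A" using insert.hyps by auto
    ultimately show ?thesis using insert.hyps by (auto intro!: sum.cong)
  qed
  also have "\<dots> = (\<Sum>f\<in>A. h x f + h f x) + (\<Sum>e\<in>A. \<Sum>f\<in>A - {e}. h e f)"
    by (simp add: sum.distrib algebra_simps)
  also have "(\<Sum>f\<in>A. h x f + h f x) = 0"
  proof (rule sum.neutral, rule ballI)
    fix f assume "f \<in> A"
    then have "h x f = - h f x" using insert.prems[of x f] insert.hyps by auto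
    then show "h x f + h f x = 0" by simp
  qed
  also have "(\<Sum>e\<in>A. \<Sum>f\<in>A - {e}. h e f) = 0"
    by (rule insert.IH) (rule insert.prems, auto)
  finally show ?case by simp
qed auto

lemma coboundary_coboundary:
  assumes "simplicial D" "incidence_signs D s"
  shows "coboundary D s (coboundary D s f) = (\<lambda>_. 0)"
proof
  fix X
  show "coboundary D s (coboundary D s f) X = 0"
  proof (cases "X \<in> D")
    case True
    then have sub: "\<And>Y. Y \<subseteq> X \<Longrightarrow> Y \<in> D" and fin: "finite X"
      using assms(1) by (auto simp: simplicial_def)
    define h where "h e g = s (X - {e}) e * (s (X - {e} - {g}) g * f (X - {e} - {g}))" for e g
    have "coboundary D s (coboundary D s f) X = (\<Sum>e\<in>X. \<Sum>g\<in>X - {e}. h e g)"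
      using True sub by (auto simp: coboundary_def h_def sum_distrib_left intro!: sum.cong)
    also have "\<dots> = 0"
    proof (rule sum_antisymmetric[OF fin])
      fix e g assume eg: "e \<in> X" "g \<in> X" "e \<noteq> g"
      \<comment> \<open>Both terms of the pair end at the same face Y, reached by removing e and g
        in either order.\<close>
      define Y where "Y = X - {e} - {g}"
      have Y: "Y = X - {g} - {e}" "X - {e} = insert g Y" "X - {g} = insert e Y"
        "insert e (insert g Y) = X" "e \<notin> Y" "g \<notin> Y"
        using eg by (auto simp: Y_def)
      have "s Y e * s (insert e Y) g = - (s Y g * s (insert g Y) e)"
        using assms(2) Y eg True unfolding incidence_signs_def by metis
      then have "s (insert g Y) e * s Y g = - (s (insert e Y) g * s Y e)" by (simp add: mult.commute)
      then have "(s (insert g Y) e * s Y g) * f Y = - (s (insert e Y) g * s Y e) * f Y" by simp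
      then show "h e g = - h g e"
        unfolding h_def Y_def[symmetric] Y(1)[symmetric] unfolding Y(2,3) by (simp only: mult.assoc mult_minus_left)
    qed
    finally show ?thesis .
  qed (simp add: coboundary_def)
qed

text \<open>A primitive is \<open>g\<close>: evaluate f on the face with the apex added, up to sign.
  At a face containing a only the term of a survives in its coboundary; at any other face X the
  cocycle equation of f at \<open>insert a X\<close> gives the value.\<close>

lemma cone_acyclic:
  assumes D: "simplicial D" and s: "incidence_signs D s"
    and apex: "\<And>X. X \<in> D \<Longrightarrow> insert a X \<in> D"
    and f: "f \<in> cochains D n" "coboundary D s f = (\<lambda>_. 0)"
  shows "f \<in> coboundary D s ` cochains D (n - 1)"
proof -
  define g where "g Y = (if a \<notin> Y \<and> Y \<in> D then s Y a * f (insert a Y) else 0)" for Y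
  have fin: "finite X" if "X \<in> D" for X using D that by (auto simp: simplicial_def)
  have down: "Y \<in> D" if "X \<in> D" "Y \<subseteq> X" for X Y using D that by (auto simp: simplicial_def)
  have "g \<in> cochains D (n - 1)"
    using f(1) fin by (auto simp: cochains_def g_def)
  moreover have "coboundary D s g X = f X" for X
  proof (cases "X \<in> D")
    case X: True
    show ?thesis
    proof (cases "a \<in> X")
      case True
      have "coboundary D s g X = (\<Sum>e\<in>X. s (X - {e}) e * g (X - {e}))"
        using X by (simp add: coboundary_def)
      \<comment> \<open>\<open>g\<close> vanishes on faces that contain a, which kills every term
        but e = a.\<close>
      also have "\<dots> = (\<Sum>e\<in>X. if e = a then s (X - {a}) a * g (X - {a}) else 0)"
        using True by (intro sum.cong) (auto simp: g_def)
      also have "\<dots> = s (X - {a}) a * (s (X - {a}) a * f (insert a (X - {a})))"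
        using True fin[OF X] down[OF X] by (auto simp: g_def)
      also have "\<dots> = (s (X - {a}) a * s (X - {a}) a) * f X"
        using True by (simp add: mult.assoc insert_absorb)
      also have "s (X - {a}) a * s (X - {a}) a = 1"
        using s X True unfolding incidence_signs_def by (metis Diff_iff insertI1 insert_Diff)
      finally show ?thesis by simp
    next
      case False
      have sq: "s X a * s X a = 1" using s apex[OF X] False unfolding incidence_signs_def by blast
      \<comment> \<open>The term of a in this equation is f X up to sign; anticommutation turns the
        others into the coboundary of \<open>g\<close>.\<close>
      have "0 = coboundary D s f (insert a X)" using f(2) by simp
      also have "\<dots> = (\<Sum>e\<in>insert a X. s (insert a X - {e}) e * f (insert a X - {e}))"
        using apex[OF X] by (simp add: coboundary_def)
      also have "\<dots> = s X a * f X + (\<Sum>e\<in>X. s (insert a X - {e}) e * f (insert a X - {e}))"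
        using False fin[OF X] by simp
      also have "(\<Sum>e\<in>X. s (insert a X - {e}) e * f (insert a X - {e}))
          = (\<Sum>e\<in>X. - s X a * (s (X - {e}) e * g (X - {e})))"
      proof (rule sum.cong[OF refl])
        fix e assume e: "e \<in> X"
        define Y where "Y = X - {e}"
        have Y: "insert a X - {e} = insert a Y" "X = insert e Y" "e \<notin> Y" "a \<notin> Y" "a \<noteq> e"
          using e False by (auto simp: Y_def)
        have "insert a (insert e Y) \<in> D" using apex[OF X] Y by simp
        then have 1: "s Y a * s (insert a Y) e = - (s Y e * s (insert e Y) a)"
          using s Y unfolding incidence_signs_def by blast
        have "insert a Y \<in> D" using apex[OF down[OF X]] Y by auto
        then have 2: "s Y a * s Y a = 1" using s Y unfolding incidence_signs_def by blast
        \<comment> \<open>Inserting the square of \<open>s Y a\<close>, which is 1, makes the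
          anticommutation rule applicable.\<close>
        have "s (insert a Y) e = s Y a * (s Y a * s (insert a Y) e)"
          using 2 by (simp add: mult.assoc[symmetric])
        also have "\<dots> = - s X a * (s Y e * s Y a)" using 1 Y by simp
        finally show "s (insert a X - {e}) e * f (insert a X - {e}) = - s X a * (s (X - {e}) e * g (X - {e}))"
          unfolding Y_def[symmetric] Y(1) using Y down[OF X, of Y] by (auto simp: g_def)
      qed
      also have "\<dots> = - s X a * coboundary D s g X"
        using X by (simp add: coboundary_def sum_distrib_left)
      finally have "s X a * f X = s X a * coboundary D s g X" by simp
      moreover have "s X a \<noteq> 0" using sq by auto
      ultimately show ?thesis by simp
    qed
  next
    case False
    then show ?thesis using f(1) by (auto simp: cochains_def coboundary_def)
  qed
  ultimately show ?thesis by (metis ext image_eqI)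
qed

text \<open>If the spanning class vanishes, its multiples are absorbed into the coboundary, so
  dimension 0 takes the usual form of exactness.\<close>

lemma cohomology_dim_False_iff:
  assumes "simplicial D" "incidence_signs D s"
  shows "cohomology_dim False D s n \<longleftrightarrow>
    (\<forall>c \<in> cochains D n. coboundary D s c = (\<lambda>_. 0) \<longrightarrow> c \<in> coboundary D s ` cochains D (n - 1))"
    (is "_ \<longleftrightarrow> ?R")
proof
  assume "cohomology_dim False D s n"
  then obtain w where w: "w \<in> cochains D (n - 1)"
    "\<And>c. c \<in> cochains D n \<Longrightarrow> coboundary D s c = (\<lambda>_. 0) \<Longrightarrow>
           (\<exists>a. \<exists>g \<in> cochains D (n - 1). c = (\<lambda>X. a * coboundary D s w X + coboundary D s g X))"
    unfolding cohomology_dim_def by auto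
  show ?R
  proof (intro ballI impI)
    fix c :: "'a set \<Rightarrow> 'b" assume "c \<in> cochains D n" "coboundary D s c = (\<lambda>_. 0)"
    then obtain a g where g: "g \<in> cochains D (n - 1)"
      "c = (\<lambda>X. a * coboundary D s w X + coboundary D s g X)" using w(2) by blast
    then have "c = coboundary D s (\<lambda>X. a * w X + g X)"
      by (simp add: coboundary_add coboundary_scale)
    then show "c \<in> coboundary D s ` cochains D (n - 1)"
      using g(1) w(1) by (auto intro!: cochains_add cochains_scale)
  qed
next
  assume R: ?R
  show "cohomology_dim False D s n"
    unfolding cohomology_dim_def
  proof (intro bexI[of _ "\<lambda>_. 0"] conjI ballI impI)
    fix c :: "'a set \<Rightarrow> 'b" assume "c \<in> cochains D n" "coboundary D s c = (\<lambda>_. 0)"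
    then show "\<exists>a. \<exists>g\<in>cochains D (n - 1). c = (\<lambda>X. a * 0 + coboundary D s g X)"
      using R by auto
  next
    show "((\<lambda>_. 0) \<in> coboundary D s ` cochains D (n - 1)) = (\<not> False)"
      using cochains_zero[of D "n-1"] coboundary_zero[of D s] by (metis image_eqI)
  qed (auto simp: coboundary_zero cochains_zero)
qed

section \<open>Deletion and link of a vertex\<close>

definition deletion :: "'e set set \<Rightarrow> 'e \<Rightarrow> 'e set set" where
  "deletion D b = {X \<in> D. b \<notin> X}"

definition link :: "'e set set \<Rightarrow> 'e \<Rightarrow> 'e set set" where
  "link D b = {X. b \<notin> X \<and> insert b X \<in> D}"

text \<open>With this choice \<open>extend\<close> commutes with the coboundaries without a further
  sign.\<close>

definition link_signs :: "('e set \<Rightarrow> 'e \<Rightarrow> 'k) \<Rightarrow> 'e \<Rightarrow> 'e set \<Rightarrow> 'e \<Rightarrow> 'k" where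
  "link_signs s b X e = s (insert b X) e"

text \<open>The injection in the short exact sequence from the link (shifted by one) through D to
  the deletion; its image consists of the cochains that vanish on faces avoiding b.\<close>

definition extend :: "'e \<Rightarrow> ('e set \<Rightarrow> 'k::field) \<Rightarrow> 'e set \<Rightarrow> 'k" where
  "extend b f X = (if b \<in> X then f (X - {b}) else 0)"

context
  fixes D :: "'e set set" and s :: "'e set \<Rightarrow> 'e \<Rightarrow> 'k::field" and b :: 'e
  assumes D: "simplicial D" and s: "incidence_signs D s"
begin

lemma simplicial_deletion: "simplicial (deletion D b)"
  using D by (fastforce simp: simplicial_def deletion_def)

lemma incidence_signs_deletion: "incidence_signs (deletion D b) s"
  using s by (auto simp: incidence_signs_def deletion_def)

lemma simplicial_link: "simplicial (link D b)"
proof -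
  have "finite X \<and> (\<forall>Y\<subseteq>X. b \<notin> Y \<and> insert b Y \<in> D)" if "b \<notin> X" "insert b X \<in> D" for X
    using D that unfolding simplicial_def
    by (metis finite_insert insert_mono subsetD)
  then show ?thesis unfolding simplicial_def link_def by blast
qed

lemma incidence_signs_link: "incidence_signs (link D b) (link_signs s b)"
  unfolding incidence_signs_def
proof (intro conjI allI impI)
  fix X i assume "i \<notin> X" "insert i X \<in> link D b"
  then have "i \<notin> insert b X" "insert i (insert b X) \<in> D" by (auto simp: link_def insert_commute)
  then show "link_signs s b X i * link_signs s b X i = 1"
    using s unfolding incidence_signs_def link_signs_def by blast
next
  fix X i j assume "i \<notin> X" "j \<notin> X" "i \<noteq> j" "insert i (insert j X) \<in> link D b"
  then have "i \<notin> insert b X" "j \<notin> insert b X" "i \<noteq> j" "insert i (insert j (insert b X)) \<in> D"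
    by (auto simp: link_def insert_commute)
  then have "s (insert b X) i * s (insert i (insert b X)) j = - (s (insert b X) j * s (insert j (insert b X)) i)"
    by (rule incidence_signs_swap[OF s])
  then show "link_signs s b X i * link_signs s b (insert i X) j = - (link_signs s b X j * link_signs s b (insert j X) i)"
    unfolding link_signs_def insert_commute[of b] .
qed

lemma extend_cochains: "f \<in> cochains (link D b) (n - 1) \<Longrightarrow> extend b f \<in> cochains D n"
proof -
  assume f: "f \<in> cochains (link D b) (n - 1)"
  have "X \<in> D \<and> int (card X) = n" if "extend b f X \<noteq> 0" for X
  proof -
    have b: "b \<in> X" "f (X - {b}) \<noteq> 0" using that by (auto simp: extend_def split: if_splits)
    with f have "X - {b} \<in> link D b" "int (card (X - {b})) = n - 1" by (auto simp: cochains_def)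
    moreover from this(1) b(1) have "X \<in> D" by (simp add: link_def insert_absorb)
    moreover from this have "finite X" using D by (auto simp: simplicial_def)
    ultimately show ?thesis using b(1) card_Suc_Diff1[of X b] by auto
  qed
  then show ?thesis by (auto simp: cochains_def)
qed

text \<open>The facet X - {b} of X contributes nothing, since an extended cochain vanishes where b
  is missing.\<close>

lemma extend_coboundary: "coboundary D s (extend b f) = extend b (coboundary (link D b) (link_signs s b) f)"
proof
  fix X
  show "coboundary D s (extend b f) X = extend b (coboundary (link D b) (link_signs s b) f) X"
  proof (cases "b \<in> X")
    case False
    then show ?thesis by (auto simp: coboundary_def extend_def intro!: sum.neutral)
  next
    case b: True
    show ?thesis
    proof (cases "X \<in> D")
      case True
      then have "finite X" using D by (auto simp: simplicial_def)
      then have "coboundary D s (extend b f) X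
          = s (X - {b}) b * extend b f (X - {b}) + (\<Sum>e\<in>X - {b}. s (X - {e}) e * extend b f (X - {e}))"
        using True b by (simp add: coboundary_def sum.remove)
      also have "\<dots> = (\<Sum>e\<in>X - {b}. link_signs s b (X - {b} - {e}) e * f (X - {b} - {e}))"
      proof -
        have "s (X - {e}) e * extend b f (X - {e}) = link_signs s b (X - {b} - {e}) e * f (X - {b} - {e})"
          if "e \<in> X - {b}" for e
        proof -
          have "insert b (X - {b} - {e}) = X - {e}" "X - {e} - {b} = X - {b} - {e}" "b \<in> X - {e}"
            using that b by auto
          then show ?thesis by (simp add: link_signs_def extend_def)
        qed
        then show ?thesis by (simp add: extend_def)
      qed
      also have "\<dots> = extend b (coboundary (link D b) (link_signs s b) f) X"
        using True b by (simp add: extend_def coboundary_def link_def insert_absorb)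
      finally show ?thesis .
    qed (use b in \<open>auto simp: coboundary_def extend_def link_def insert_absorb\<close>)
  qed
qed

lemma extend_add: "extend b (\<lambda>X. f X + g X) = (\<lambda>X. extend b f X + extend b g X)"
  and extend_scale: "extend b (\<lambda>X. a * f X) = (\<lambda>X. a * extend b f X)"
  by (auto simp: extend_def)

lemma extend_inj:
  assumes "f \<in> cochains (link D b) m" "g \<in> cochains (link D b) m'" "extend b f = extend b g"
  shows "f = g"
proof
  fix X
  show "f X = g X"
  proof (cases "b \<in> X")
    case True
    then have "X \<notin> (link D b)" by (auto simp: link_def)
    then show ?thesis using assms(1,2) by (simp add: cochains_iff)
  next
    case False
    then show ?thesis using fun_cong[OF assms(3), of "insert b X"] by (simp add: extend_def)
  qed
qed

lemma extend_surj:
  assumes "f \<in> cochains D n" "\<And>X. b \<notin> X \<Longrightarrow> f X = 0"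
  obtains u where "u \<in> cochains (link D b) (n - 1)" "f = extend b u"
proof
  define u where "u X = (if b \<in> X then 0 else f (insert b X))" for X
  have "X \<in> link D b \<and> int (card X) = n - 1" if "u X \<noteq> 0" for X
  proof -
    have 1: "b \<notin> X" "insert b X \<in> D" "int (card (insert b X)) = n"
      using that assms(1) by (auto simp: u_def cochains_def split: if_splits)
    then have "finite X" using D by (auto simp: simplicial_def)
    then show ?thesis using 1 by (auto simp: link_def)
  qed
  then show "u \<in> cochains (link D b) (n - 1)" by (auto simp: cochains_def)
  show "f = extend b u" using assms(2) by (auto simp: extend_def u_def insert_absorb)
qed

text \<open>Facets of a face avoiding b avoid b as well, so restriction to the deletion is a cochain
  map.\<close>

lemma coboundary_deletion: "b \<notin> X \<Longrightarrow> coboundary D s f X = coboundary (deletion D b) s (\<lambda>Y. if b \<in> Y then 0 else f Y) X"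
  by (auto simp: coboundary_def deletion_def intro!: sum.cong)

text \<open>The restriction of c is a cocycle of the acyclic deletion; subtracting the coboundary of
  a primitive, extended by zero, leaves a cochain supported on faces through b. The coboundary of c
  is required to vanish only away from b, so that the lemma also applies to a primitive of an
  extended cocycle.\<close>

lemma deletion_reduce:
  assumes acyc: "\<And>m. cohomology_dim False (deletion D b) s m"
    and c: "c \<in> cochains D n" "\<And>X. b \<notin> X \<Longrightarrow> coboundary D s c X = 0"
  obtains g u where "g \<in> cochains D (n - 1)" "u \<in> cochains (link D b) (n - 1)"
    "c = (\<lambda>X. coboundary D s g X + extend b u X)"
proof -
  define c' where "c' Y = (if b \<in> Y then 0 else c Y)" for Y
  have c': "c' \<in> cochains (deletion D b) n" using c(1) by (auto simp: cochains_def c'_def deletion_def)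
  have "coboundary (deletion D b) s c' X = 0" for X
  proof (cases "b \<in> X")
    case False
    then show ?thesis using coboundary_deletion[OF False, of c] c(2)[OF False] by (simp add: c'_def[abs_def])
  qed (simp add: coboundary_def deletion_def)
  then obtain g where g: "g \<in> cochains (deletion D b) (n - 1)" "c' = coboundary (deletion D b) s g"
    using acyc[of n] c' cohomology_dim_False_iff[OF simplicial_deletion incidence_signs_deletion] by blast
  have gD: "g \<in> cochains D (n - 1)" using g(1) by (rule cochains_mono[rotated]) (auto simp: deletion_def)
  define f where "f = (\<lambda>X. c X - coboundary D s g X)"
  have fD: "f \<in> cochains D n"
    unfolding f_def using c(1) coboundary_in_cochains[OF D gD] by (rule cochains_diff)
  have "f X = 0" if b: "b \<notin> X" for X
  proof -
    have "(\<lambda>Y. if b \<in> Y then 0 else g Y) = g" using g(1) by (auto simp: cochains_iff deletion_def)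
    then show ?thesis using coboundary_deletion[OF b, of g] fun_cong[OF g(2), of X] b by (simp add: f_def c'_def)
  qed
  then obtain u where "u \<in> cochains (link D b) (n - 1)" "f = extend b u" by (rule extend_surj[OF fD]) auto
  then show thesis using that[OF gD] by (metis (no_types, lifting) add.commute diff_add_cancel HOL.ext f_def)
qed

text \<open>This is the isomorphism in the long exact sequence of deletion and link, carried out on
  representatives: \<open>extend b z\<close> spans, and both its triviality and the spanning
  property are pulled back to the link by \<open>deletion_reduce\<close>.\<close>

lemma cohomology_dim_link:
  assumes acyc: "\<And>m. cohomology_dim False (deletion D b) s m"
    and H: "cohomology_dim d (link D b) (link_signs s b) (n - 1)"
  shows "cohomology_dim d D s n"
proof -
  from H obtain z where z: "z \<in> cochains (link D b) (n - 1)" "coboundary (link D b) (link_signs s b) z = (\<lambda>_. 0)"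
    "z \<in> coboundary (link D b) (link_signs s b) ` cochains (link D b) (n - 1 - 1) \<longleftrightarrow> \<not> d"
    "\<And>c. c \<in> cochains (link D b) (n - 1) \<Longrightarrow> coboundary (link D b) (link_signs s b) c = (\<lambda>_. 0) \<Longrightarrow>
       (\<exists>a. \<exists>g \<in> cochains (link D b) (n - 1 - 1). c = (\<lambda>X. a * z X + coboundary (link D b) (link_signs s b) g X))"
    unfolding cohomology_dim_def by blast
  have ext0: "extend b (\<lambda>_. 0) = (\<lambda>_. 0)" by (auto simp: extend_def)
  show ?thesis
    unfolding cohomology_dim_def
  proof (intro bexI[of _ "extend b z"] conjI ballI impI)
    show "extend b z \<in> cochains D n" by (rule extend_cochains[OF z(1)])
    show "coboundary D s (extend b z) = (\<lambda>_. 0)" by (simp add: extend_coboundary z(2) ext0)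
    show "extend b z \<in> coboundary D s ` cochains D (n - 1) \<longleftrightarrow> \<not> d"
    proof
      assume "\<not> d"
      then obtain w where w: "w \<in> cochains (link D b) (n - 1 - 1)" "z = coboundary (link D b) (link_signs s b) w" using z(3) by blast
      then show "extend b z \<in> coboundary D s ` cochains D (n - 1)"
        using extend_cochains[OF w(1)] by (simp add: extend_coboundary[symmetric])
    next
      assume "extend b z \<in> coboundary D s ` cochains D (n - 1)"
      then obtain g where g: "g \<in> cochains D (n - 1)" "extend b z = coboundary D s g" by blast
      \<comment> \<open>\<open>g\<close> need not be a cocycle, but its coboundary is supported on
        faces through b.\<close>
      have "coboundary D s g X = 0" if "b \<notin> X" for X
        unfolding g(2)[symmetric] using that by (simp add: extend_def)
      then obtain w u where wu: "u \<in> cochains (link D b) (n - 1 - 1)" "g = (\<lambda>X. coboundary D s w X + extend b u X)"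
        using deletion_reduce[OF acyc g(1)] by metis
      have "extend b z = extend b (coboundary (link D b) (link_signs s b) u)"
        unfolding g(2) wu(2) by (simp add: coboundary_add coboundary_coboundary[OF D s] extend_coboundary)
      then have "z = coboundary (link D b) (link_signs s b) u"
        by (rule extend_inj[OF z(1) coboundary_in_cochains[OF simplicial_link wu(1)]])
      then show "\<not> d" using z(3) wu(1) by blast
    qed
  next
    fix c :: "'e set \<Rightarrow> 'k" assume c: "c \<in> cochains D n" "coboundary D s c = (\<lambda>_. 0)"
    then obtain g u where gu: "g \<in> cochains D (n - 1)" "u \<in> cochains (link D b) (n - 1)"
      "c = (\<lambda>X. coboundary D s g X + extend b u X)" using deletion_reduce[OF acyc c(1)] by metis
    \<comment> \<open>The coboundary of c is that of its extended part alone, so u is a cocycle of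
      the link.\<close>
    have "extend b (coboundary (link D b) (link_signs s b) u) = extend b (\<lambda>_. 0)"
      using c(2) unfolding gu(3) by (simp add: coboundary_add coboundary_coboundary[OF D s] extend_coboundary ext0)
    moreover have "coboundary (link D b) (link_signs s b) u \<in> cochains (link D b) n"
      using coboundary_in_cochains[OF simplicial_link gu(2)] .
    ultimately have "coboundary (link D b) (link_signs s b) u = (\<lambda>_. 0)"
      using extend_inj[OF _ cochains_zero] by blast
    then obtain a w where w: "w \<in> cochains (link D b) (n - 1 - 1)" "u = (\<lambda>X. a * z X + coboundary (link D b) (link_signs s b) w X)"
      using z(4) gu(2) by blast
    have "c = (\<lambda>X. a * extend b z X + coboundary D s (\<lambda>X. g X + extend b w X) X)"
      unfolding gu(3) w(2) by (simp add: extend_add extend_scale coboundary_add extend_coboundary algebra_simps)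
    moreover have "(\<lambda>X. g X + extend b w X) \<in> cochains D (n - 1)"
      using gu(1) extend_cochains[OF w(1)] by (rule cochains_add)
    ultimately show "\<exists>a. \<exists>g\<in>cochains D (n - 1). c = (\<lambda>X. a * extend b z X + coboundary D s g X)" by blast
  qed
qed

end

section \<open>Index sets with forbidden adjacencies\<close>

definition sparse_sets :: "(nat \<Rightarrow> bool) \<Rightarrow> nat \<Rightarrow> nat set set" where
  "sparse_sets t N = {X. X \<subseteq> {1..N} \<and> (\<forall>i. i \<in> X \<and> Suc i \<in> X \<longrightarrow> t i)}"

text \<open>\<open>None\<close> means acyclic. In the last equation \<open>Suc (Suc N)\<close> is an
  apex if it may occur next to \<open>Suc N\<close>; otherwise it is a leaf, and the link of
  \<open>Suc N\<close> loses both of them, and also \<open>N\<close> unless \<open>t N\<close>. For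
  N = 0 both branches give 0 by truncated subtraction.\<close>

fun cohomology_degree :: "(nat \<Rightarrow> bool) \<Rightarrow> nat \<Rightarrow> nat option" where
  "cohomology_degree t 0 = Some 0"
| "cohomology_degree t (Suc 0) = None"
| "cohomology_degree t (Suc (Suc N)) =
     (if t (Suc N) then None else map_option Suc (cohomology_degree t (if t N then N else N - 1)))"

lemma simplicial_sparse_sets: "simplicial (sparse_sets t N)"
  unfolding simplicial_def sparse_sets_def
proof (intro ballI conjI allI impI)
  fix X assume "X \<in> {X. X \<subseteq> {1..N} \<and> (\<forall>i. i \<in> X \<and> Suc i \<in> X \<longrightarrow> t i)}"
  then show "finite X" using finite_subset[of X "{1..N}"] by simp
qed blast

text \<open>The induction follows the recursion of \<open>cohomology_degree\<close>; s and n are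
  generalized because the hypothesis is applied to the link with its own signs, one degree
  lower.\<close>

lemma sparse_sets_cohomology:
  fixes s :: "nat set \<Rightarrow> nat \<Rightarrow> 'k::field"
  assumes "incidence_signs (sparse_sets t N) s"
  shows "cohomology_dim (map_option int (cohomology_degree t N) = Some n) (sparse_sets t N) s n"
  using assms
proof (induction t N arbitrary: s n rule: cohomology_degree.induct)
  case (1 t)
  \<comment> \<open>Only the empty face remains, and its indicator spans degree 0.\<close>
  have D: "sparse_sets t 0 = {{}}" by (auto simp: sparse_sets_def)
  have cob: "coboundary {{}} s f = (\<lambda>_. 0)" for f by (auto simp: coboundary_def)
  show ?case
  proof (cases "n = 0")
    case True
    define z :: "nat set \<Rightarrow> 'k" where "z X = (if X = {} then 1 else 0)" for X
    show ?thesis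
      unfolding cohomology_dim_def D
    proof (intro bexI[of _ z] conjI ballI impI)
      show "(z \<in> coboundary {{}} s ` cochains {{}} (n - 1)) =
          (\<not> map_option int (cohomology_degree t 0) = Some n)"
        using True by (auto simp: cob z_def dest: fun_cong[of _ _ "{}"])
    next
      fix c :: "nat set \<Rightarrow> 'k" assume "c \<in> cochains {{}} n"
      then have "c = (\<lambda>X. c {} * z X + coboundary {{}} s (\<lambda>_. 0) X)"
        by (auto simp: cob cochains_iff z_def fun_eq_iff)
      then show "\<exists>a. \<exists>g\<in>cochains {{}} (n - 1). c = (\<lambda>X. a * z X + coboundary {{}} s g X)"
        using cochains_zero by blast
    qed (use True in \<open>auto simp: cob cochains_def z_def\<close>)
  next
    case False
    have "cohomology_dim False (sparse_sets t 0) s n"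
    proof (subst cohomology_dim_False_iff[OF simplicial_sparse_sets 1], intro ballI impI)
      fix c :: "nat set \<Rightarrow> 'k" assume "c \<in> cochains (sparse_sets t 0) n"
      then have "c = (\<lambda>_. 0)" using False unfolding D by (auto simp: cochains_iff fun_eq_iff)
      then have "c = coboundary (sparse_sets t 0) s (\<lambda>_. 0)" by (simp add: coboundary_zero)
      then show "c \<in> coboundary (sparse_sets t 0) s ` cochains (sparse_sets t 0) (n - 1)"
        using cochains_zero by blast
    qed
    then show ?thesis using False by simp
  qed
next
  case (2 t)
  \<comment> \<open>A single vertex is a cone with itself as apex.\<close>
  have "cohomology_dim False (sparse_sets t (Suc 0)) s n"
    by (subst cohomology_dim_False_iff[OF simplicial_sparse_sets 2], intro ballI impI,
        rule cone_acyclic[OF simplicial_sparse_sets 2, of "Suc 0"])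
       (auto simp: sparse_sets_def)
  then show ?case by simp
next
  case (3 t N)
  let ?D = "sparse_sets t (Suc (Suc N))"
  show ?case
  proof (cases "t (Suc N)")
    case True
    \<comment> \<open>With the last adjacency permitted, \<open>Suc (Suc N)\<close> conflicts with
      nothing and can be added to every face.\<close>
    have "cohomology_dim False ?D s n"
    proof (subst cohomology_dim_False_iff[OF simplicial_sparse_sets "3.prems"], intro ballI impI,
        rule cone_acyclic[OF simplicial_sparse_sets "3.prems", of "Suc (Suc N)"])
      fix X assume "X \<in> ?D"
      then show "insert (Suc (Suc N)) X \<in> ?D" using True by (auto simp: sparse_sets_def)
    qed
    then show ?thesis using True by simp
  next
    case False
    let ?M = "if t N then N else N - 1"
    note D = simplicial_sparse_sets[of t "Suc (Suc N)"]
    \<comment> \<open>Faces compatible with \<open>Suc N\<close> avoid \<open>Suc (Suc N)\<close>,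
      and avoid \<open>N\<close> unless \<open>t N\<close>; what is left is again an initial
      interval.\<close>
    have link: "link ?D (Suc N) = sparse_sets t ?M" (is "?l = ?r")
    proof (intro equalityI subsetI)
      fix X assume X: "X \<in> ?l"
      then have 1: "insert (Suc N) X \<subseteq> {1..Suc (Suc N)}" "Suc N \<notin> X"
        "\<And>i. i \<in> insert (Suc N) X \<Longrightarrow> Suc i \<in> insert (Suc N) X \<Longrightarrow> t i"
        by (auto simp: link_def sparse_sets_def)
      have "Suc (Suc N) \<notin> X" using 1(3)[of "Suc N"] False by auto
      moreover have "N \<notin> X" if "\<not> t N" using 1(3)[of N] that by auto
      moreover have "x \<in> {1..Suc (Suc N)}" if "x \<in> X" for x using 1(1) that by auto
      ultimately have *: "x \<noteq> Suc (Suc N)" "x \<noteq> Suc N" "x = N \<Longrightarrow> t N" "1 \<le> x" "x \<le> Suc (Suc N)"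
        if "x \<in> X" for x
        using that 1(2) by auto
      have "X \<subseteq> {1..?M}"
      proof
        fix x assume "x \<in> X"
        note * = *[OF this]
        show "x \<in> {1..?M}"
        proof (cases "t N")
          case True then show ?thesis using * by simp
        next
          case False
          then have "x \<noteq> N" using *(3) by auto
          then show ?thesis using * False by simp
        qed
      qed
      then show "X \<in> ?r" using 1(3) unfolding sparse_sets_def by blast
    next
      fix X assume "X \<in> ?r"
      then have 1: "X \<subseteq> {1..?M}" "\<And>i. i \<in> X \<Longrightarrow> Suc i \<in> X \<Longrightarrow> t i"
        by (auto simp: sparse_sets_def)
      have "?M \<le> N" by auto
      then have "X \<subseteq> {1..N}" using 1(1) by auto
      moreover have "t N" if "N \<in> X"
      proof (rule ccontr)
        assume "\<not> t N"
        then have "N \<in> {1..N - 1}" using 1(1) that by auto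
        then show False by auto
      qed
      ultimately have "Suc N \<notin> X" "Suc (Suc N) \<notin> X" "insert (Suc N) X \<subseteq> {1..Suc (Suc N)}" "N \<in> X \<Longrightarrow> t N"
        by auto
      moreover from this have "t i" if "i \<in> insert (Suc N) X" "Suc i \<in> insert (Suc N) X" for i
        using that 1(2)[of i] by auto
      ultimately show "X \<in> ?l" unfolding link_def sparse_sets_def by blast
    qed
    have "cohomology_dim (map_option int (cohomology_degree t ?M) = Some (n - 1))
        (link ?D (Suc N)) (link_signs s (Suc N)) (n - 1)"
      unfolding link
      using "3.IH"[OF False] incidence_signs_link[OF D "3.prems", of "Suc N"] unfolding link by blast
    \<comment> \<open>Once \<open>Suc N\<close> is deleted, the leaf \<open>Suc (Suc N)\<close> has
      lost its only conflict and becomes an apex.\<close>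
    moreover have "cohomology_dim False (deletion ?D (Suc N)) s m" for m
    proof (subst cohomology_dim_False_iff[OF simplicial_deletion[OF D "3.prems"] incidence_signs_deletion[OF D "3.prems"]],
       intro ballI impI,
        rule cone_acyclic[OF simplicial_deletion[OF D "3.prems"] incidence_signs_deletion[OF D "3.prems"], where a="Suc (Suc N)"])
      fix X assume "X \<in> deletion ?D (Suc N)"
      then show "insert (Suc (Suc N)) X \<in> deletion ?D (Suc N)"
        by (auto simp: deletion_def sparse_sets_def)
    qed
    ultimately have "cohomology_dim (map_option int (cohomology_degree t ?M) = Some (n - 1)) ?D s n"
      using cohomology_dim_link[OF D "3.prems"] by blast
    moreover have "map_option int (cohomology_degree t ?M) = Some (n - 1) \<longleftrightarrow>
        map_option int (cohomology_degree t (Suc (Suc N))) = Some n"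
      using False by auto
    ultimately show ?thesis by simp
  qed
qed


section \<open>Spaces of dimension at most one\<close>


definition fun_subspace :: "('b \<Rightarrow> 'k::field) set \<Rightarrow> bool" where
  "fun_subspace S \<longleftrightarrow> (\<lambda>_. 0) \<in> S \<and> (\<forall>f\<in>S. \<forall>g\<in>S. (\<lambda>x. f x + g x) \<in> S) \<and> (\<forall>a. \<forall>f\<in>S. (\<lambda>x. a * f x) \<in> S)"

lemma fun_subspaceD:
  assumes "fun_subspace S"
  shows "(\<lambda>_. 0) \<in> S" "f \<in> S \<Longrightarrow> g \<in> S \<Longrightarrow> (\<lambda>x. f x + g x) \<in> S" "f \<in> S \<Longrightarrow> (\<lambda>x. a * f x) \<in> S"
    "f \<in> S \<Longrightarrow> g \<in> S \<Longrightarrow> (\<lambda>x. f x - g x) \<in> S"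
proof -
  show *: "(\<lambda>_. 0) \<in> S" "\<And>f g. f \<in> S \<Longrightarrow> g \<in> S \<Longrightarrow> (\<lambda>x. f x + g x) \<in> S"
    "\<And>f a. f \<in> S \<Longrightarrow> (\<lambda>x. a * f x) \<in> S"
    using assms by (auto simp: fun_subspace_def)
  assume "f \<in> S" "g \<in> S"
  then have "(\<lambda>x. f x + (- 1) * g x) \<in> S" using *(2)[of f "\<lambda>x. (- 1) * g x"] *(3)[of g "- 1"] by simp
  then show "(\<lambda>x. f x - g x) \<in> S" by simp
qed

text \<open>Free spaces, cochain spaces and cocycle spaces have this form; their subspaces are then
  plain sets of functions, tested by \<open>fun_subspace\<close>.\<close>

definition fun_module :: "('k::field, 'b \<Rightarrow> 'k) module \<Rightarrow> bool" where
  "fun_module V \<longleftrightarrow> fun_subspace (carrier V) \<and> \<zero>\<^bsub>V\<^esub> = (\<lambda>_. 0) \<and>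
     add V = (\<lambda>f g x. f x + g x) \<and> smult V = (\<lambda>a f x. a * f x)"

lemma carrier_free_space:
  "f \<in> carrier (free_space B) \<longleftrightarrow> finite {x. f x \<noteq> 0} \<and> (\<forall>x. x \<notin> B \<longrightarrow> f x = 0)"
  unfolding free_space_def by auto

lemma fun_module_free_space: "fun_module (free_space B :: ('k::field, 'b \<Rightarrow> 'k) module)"
proof -
  have "finite {x. f x + g x \<noteq> 0}" if "finite {x. f x \<noteq> 0}" "finite {x. g x \<noteq> 0}" for f g :: "'b \<Rightarrow> 'k"
    by (rule finite_subset[OF _ finite_UnI[OF that]]) auto
  moreover have "finite {x. a * f x \<noteq> 0}" if "finite {x. f x \<noteq> 0}" for a and f :: "'b \<Rightarrow> 'k"
    by (rule finite_subset[OF _ that]) auto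
  ultimately have fin: "\<And>f g :: 'b \<Rightarrow> 'k. finite {x. f x \<noteq> 0} \<Longrightarrow> finite {x. g x \<noteq> 0} \<Longrightarrow> finite {x. f x + g x \<noteq> 0}"
      "\<And>a (f :: 'b \<Rightarrow> 'k). finite {x. f x \<noteq> 0} \<Longrightarrow> finite {x. a * f x \<noteq> 0}" by blast+
  show ?thesis
    unfolding fun_module_def fun_subspace_def
  proof (intro conjI ballI allI)
    fix f g :: "'b \<Rightarrow> 'k"
    assume "f \<in> carrier (free_space B)" "g \<in> carrier (free_space B)"
    then show "(\<lambda>x. f x + g x) \<in> carrier (free_space B)"
      using fin(1)[of f g] by (simp add: carrier_free_space)
  next
    fix a :: 'k and f :: "'b \<Rightarrow> 'k"
    assume "f \<in> carrier (free_space B)"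
    then show "(\<lambda>x. a * f x) \<in> carrier (free_space B)"
      using fin(2)[of f a] by (simp add: carrier_free_space)
  qed (simp_all add: free_space_def)
qed

lemma module_fun_module:
  fixes V :: "('k::field, 'b \<Rightarrow> 'k) module"
  assumes "fun_module V"
  shows "Module.module (class_ring :: 'k ring) V"
proof (rule module_criteria)
  note V = assms[unfolded fun_module_def]
  note S = fun_subspaceD[OF V[THEN conjunct1]]
  show "cring (class_ring :: 'k ring)" using class_field by (auto simp: field_def domain_def)
  show "\<zero>\<^bsub>V\<^esub> \<in> carrier V" using V S(1) by simp
  show "\<forall>v\<in>carrier V. \<exists>neg_v\<in>carrier V. v \<oplus>\<^bsub>V\<^esub> neg_v = \<zero>\<^bsub>V\<^esub>"
  proof
    fix v assume "v \<in> carrier V"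
    then have "(\<lambda>x. (- 1) * v x) \<in> carrier V" by (rule S(3))
    then show "\<exists>neg_v\<in>carrier V. v \<oplus>\<^bsub>V\<^esub> neg_v = \<zero>\<^bsub>V\<^esub>"
      using V by (intro bexI) auto
  qed
qed (use assms fun_subspaceD[of "carrier V"] in \<open>auto simp: fun_module_def algebra_simps\<close>)

text \<open>T is a coordinate: onto the field if d, onto {0} otherwise. Besides it only closure is
  required, since the vector space axioms can be pulled back along the injective T.\<close>

definition zero_or_line :: "bool \<Rightarrow> ('k::field, 'a) module \<Rightarrow> bool" where
  "zero_or_line d V \<longleftrightarrow> \<zero>\<^bsub>V\<^esub> \<in> carrier V \<and>
     (\<forall>x\<in>carrier V. \<forall>y\<in>carrier V. x \<oplus>\<^bsub>V\<^esub> y \<in> carrier V) \<and>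
     (\<forall>a. \<forall>x\<in>carrier V. a \<odot>\<^bsub>V\<^esub> x \<in> carrier V) \<and>
     (\<exists>T. bij_betw T (carrier V) {a. d \<or> a = 0} \<and> T \<zero>\<^bsub>V\<^esub> = 0 \<and>
        (\<forall>x\<in>carrier V. \<forall>y\<in>carrier V. T (x \<oplus>\<^bsub>V\<^esub> y) = T x + T y) \<and>
        (\<forall>a. \<forall>x\<in>carrier V. T (a \<odot>\<^bsub>V\<^esub> x) = a * T x))"

lemma zero_or_line_False:
  fixes V :: "('k::field, 'a) module"
  assumes V: "zero_or_line False V"
  shows "carrier V = {\<zero>\<^bsub>V\<^esub>}"
proof -
  obtain T where "bij_betw T (carrier V) {0::'k}" using V unfolding zero_or_line_def by auto
  then have "is_singleton (carrier V)"
    by (metis bij_betw_same_card card_1_singletonE is_singletonI is_singleton_altdef)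
  then show ?thesis using V by (auto simp: zero_or_line_def is_singleton_def)
qed

lemma vectorspace_zero_or_line:
  fixes V :: "('k::field, 'a) module"
  assumes "zero_or_line d V"
  shows "vectorspace (class_ring :: 'k ring) V"
proof -
  from assms obtain T where T: "bij_betw T (carrier V) {a. d \<or> a = 0}" "T \<zero>\<^bsub>V\<^esub> = 0"
      "\<And>x y. x \<in> carrier V \<Longrightarrow> y \<in> carrier V \<Longrightarrow> T (x \<oplus>\<^bsub>V\<^esub> y) = T x + T y"
      "\<And>a x. x \<in> carrier V \<Longrightarrow> T (a \<odot>\<^bsub>V\<^esub> x) = a * T x"
    and cl: "\<zero>\<^bsub>V\<^esub> \<in> carrier V" "\<And>x y. x \<in> carrier V \<Longrightarrow> y \<in> carrier V \<Longrightarrow> x \<oplus>\<^bsub>V\<^esub> y \<in> carrier V"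
      "\<And>a x. x \<in> carrier V \<Longrightarrow> a \<odot>\<^bsub>V\<^esub> x \<in> carrier V"
    unfolding zero_or_line_def by blast
  have inj: "x = y" if "x \<in> carrier V" "y \<in> carrier V" "T x = T y" for x y
    using T(1) that by (auto simp: bij_betw_def inj_on_def)
  have "Module.module (class_ring :: 'k ring) V"
  proof (rule module_criteria)
    show "cring (class_ring :: 'k ring)" using class_field by (auto simp: field_def domain_def)
    show "\<forall>v\<in>carrier V. \<exists>neg_v\<in>carrier V. v \<oplus>\<^bsub>V\<^esub> neg_v = \<zero>\<^bsub>V\<^esub>"
    proof
      fix v assume v: "v \<in> carrier V"
      have "v \<oplus>\<^bsub>V\<^esub> ((- 1) \<odot>\<^bsub>V\<^esub> v) = \<zero>\<^bsub>V\<^esub>" by (rule inj) (use v cl T in auto)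
      then show "\<exists>neg_v\<in>carrier V. v \<oplus>\<^bsub>V\<^esub> neg_v = \<zero>\<^bsub>V\<^esub>" using cl(3)[OF v] by blast
    qed
  qed (use cl in \<open>auto intro!: inj simp: T algebra_simps\<close>)
  then show ?thesis using class_field by (simp add: vectorspace_def)
qed

text \<open>The map is the coordinate of V followed by the inverse coordinate of W. Hence no cochain
  map between the complexes has to be constructed.\<close>

lemma space_iso_zero_or_line:
  fixes V :: "('k::field, 'a) module" and W :: "('k, 'b) module"
  assumes V: "zero_or_line d V" and W: "zero_or_line d W"
  shows "space_iso V W"
proof -
  from V obtain T where T: "bij_betw T (carrier V) {a. d \<or> a = 0}"
      "\<And>x y. x \<in> carrier V \<Longrightarrow> y \<in> carrier V \<Longrightarrow> T (x \<oplus>\<^bsub>V\<^esub> y) = T x + T y"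
      "\<And>a x. x \<in> carrier V \<Longrightarrow> T (a \<odot>\<^bsub>V\<^esub> x) = a * T x"
    and clV: "\<And>x y. x \<in> carrier V \<Longrightarrow> y \<in> carrier V \<Longrightarrow> x \<oplus>\<^bsub>V\<^esub> y \<in> carrier V"
      "\<And>a x. x \<in> carrier V \<Longrightarrow> a \<odot>\<^bsub>V\<^esub> x \<in> carrier V"
    unfolding zero_or_line_def by blast
  from W obtain U where U: "bij_betw U (carrier W) {a. d \<or> a = 0}"
      "\<And>x y. x \<in> carrier W \<Longrightarrow> y \<in> carrier W \<Longrightarrow> U (x \<oplus>\<^bsub>W\<^esub> y) = U x + U y"
      "\<And>a x. x \<in> carrier W \<Longrightarrow> U (a \<odot>\<^bsub>W\<^esub> x) = a * U x"
    and clW: "\<And>x y. x \<in> carrier W \<Longrightarrow> y \<in> carrier W \<Longrightarrow> x \<oplus>\<^bsub>W\<^esub> y \<in> carrier W"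
      "\<And>a x. x \<in> carrier W \<Longrightarrow> a \<odot>\<^bsub>W\<^esub> x \<in> carrier W"
    unfolding zero_or_line_def by blast
  define I where "I = inv_into (carrier W) U"
  have I: "bij_betw I {a. d \<or> a = 0} (carrier W)" unfolding I_def by (rule bij_betw_inv_into[OF U(1)])
  have UI: "U (I a) = a" "I a \<in> carrier W" if "d \<or> a = 0" for a
    using that U(1) I bij_betw_inv_into_right[OF U(1)] bij_betwE[OF I] by (auto simp: I_def)
  have IU: "I (U y) = y" if "y \<in> carrier W" for y
    using that U(1) by (simp add: I_def bij_betw_inv_into_left)
  have TV: "d \<or> T x = 0" if "x \<in> carrier V" for x using bij_betwE[OF T(1)] that by auto
  have "I \<circ> T \<in> module_hom (class_ring :: 'k ring) V W"
    unfolding module_hom_def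
  proof (intro CollectI conjI allI impI, goal_cases)
    case 1 then show ?case using TV UI by auto
  next
    case (2 x y)
    then have "I (T (x \<oplus>\<^bsub>V\<^esub> y)) = I (U (I (T x) \<oplus>\<^bsub>W\<^esub> I (T y)))"
      using T U UI TV by auto
    then show ?case using 2 IU clW UI TV by auto
  next
    case (3 a x)
    then have "I (T (a \<odot>\<^bsub>V\<^esub> x)) = I (U (a \<odot>\<^bsub>W\<^esub> I (T x)))"
      using T U UI TV by auto
    then show ?case using 3 IU clW UI TV by auto
  qed
  then have "linear_map (class_ring :: 'k ring) V W (I \<circ> T)"
    using vectorspace_zero_or_line[OF V] vectorspace_zero_or_line[OF W]
    by (simp add: linear_map_def mod_hom_def mod_hom_axioms_def vectorspace_def)
  then show ?thesis unfolding space_iso_def using bij_betw_trans[OF T(1) I] by blast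
qed

text \<open>The isomorphism theorem for a functional \<phi> with kernel W: the cosets of W are the
  fibres of \<phi>, and \<phi> descends to a coordinate with the range prescribed by d.\<close>

lemma zero_or_line_quotient_space:
  fixes V :: "('k::field, 'b \<Rightarrow> 'k) module" and \<phi> :: "('b \<Rightarrow> 'k) \<Rightarrow> 'k"
  assumes V: "fun_module V"
    and add: "\<And>f g. f \<in> carrier V \<Longrightarrow> g \<in> carrier V \<Longrightarrow> \<phi> (\<lambda>x. f x + g x) = \<phi> f + \<phi> g"
    and scale: "\<And>a f. f \<in> carrier V \<Longrightarrow> \<phi> (\<lambda>x. a * f x) = a * \<phi> f"
    and W: "W = {f \<in> carrier V. \<phi> f = 0}" and im: "\<phi> ` carrier V = {a. d \<or> a = 0}"
  shows "zero_or_line d (quotient_space V W)"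
proof -
  let ?Q = "quotient_space V W"
  have V': "\<zero>\<^bsub>V\<^esub> = (\<lambda>_. 0)" "add V = (\<lambda>f g x. f x + g x)" "smult V = (\<lambda>a f x. a * f x)"
    and S: "fun_subspace (carrier V)" using V by (auto simp: fun_module_def)
  note cl = fun_subspaceD[OF S]
  have diff: "\<phi> (\<lambda>x. f x - g x) = \<phi> f - \<phi> g" if "f \<in> carrier V" "g \<in> carrier V" for f g
    using add[of f "\<lambda>x. (- 1) * g x"] scale[of g "- 1"] cl(3)[of g "- 1"] that by simp
  define F where "F a = {f \<in> carrier V. \<phi> f = a}" for a
  have F_ne: "\<exists>f. f \<in> F a" if "d \<or> a = 0" for a
  proof -
    have "a \<in> \<phi> ` carrier V" unfolding im using that by simp
    then show ?thesis by (auto simp: F_def)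
  qed
  have \<phi>V: "d \<or> \<phi> f = 0" if "f \<in> carrier V" for f using im that by auto
  have coset: "W +>\<^bsub>V\<^esub> f = F (\<phi> f)" if f: "f \<in> carrier V" for f
  proof
    show "W +>\<^bsub>V\<^esub> f \<subseteq> F (\<phi> f)"
      using f by (auto simp: a_r_coset_def' W V' F_def add cl)
    show "F (\<phi> f) \<subseteq> W +>\<^bsub>V\<^esub> f"
    proof
      fix g assume "g \<in> F (\<phi> f)"
      then have "(\<lambda>x. g x - f x) \<in> W" using f by (auto simp: W F_def cl diff)
      moreover have "g = (\<lambda>x. (g x - f x) + f x)" by simp
      ultimately show "g \<in> W +>\<^bsub>V\<^esub> f" unfolding a_r_coset_def' V' by blast
    qed
  qed
  have carrier: "carrier ?Q = F ` {a. d \<or> a = 0}"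
  proof -
    have "carrier ?Q = (\<lambda>f. W +>\<^bsub>V\<^esub> f) ` carrier V"
      by (auto simp: quotient_space_def A_RCOSETS_def' )
    also have "\<dots> = F ` \<phi> ` carrier V" using coset by (simp add: image_image)
    finally show ?thesis by (simp add: im)
  qed
  have zero: "\<zero>\<^bsub>?Q\<^esub> = F 0" by (simp add: quotient_space_def W F_def)
  \<comment> \<open>Here and for \<open>mult\<close> the fibres must be non-empty: otherwise the sum
    of sets would be too small, and the union that defines scalar multiplication would be
    empty.\<close>
  have plus: "F a \<oplus>\<^bsub>?Q\<^esub> F b = F (a + b)" if "d \<or> a = 0" "d \<or> b = 0" for a b
  proof
    show "F a \<oplus>\<^bsub>?Q\<^esub> F b \<subseteq> F (a + b)"
      by (auto simp: quotient_space_def set_add_def' F_def V' add cl)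
    show "F (a + b) \<subseteq> F a \<oplus>\<^bsub>?Q\<^esub> F b"
    proof
      fix f assume f: "f \<in> F (a + b)"
      obtain g where g: "g \<in> F a" using F_ne[of a] \<open>d \<or> a = 0\<close> by blast
      have "f \<in> carrier V" "g \<in> carrier V" "\<phi> f = a + b" "\<phi> g = a" using f g by (simp_all add: F_def)
      then have "(\<lambda>x. f x - g x) \<in> F b" unfolding F_def by (simp add: cl(4) diff)
      then have "\<exists>h\<in>F a. \<exists>k\<in>F b. f = (\<lambda>x. h x + k x)"
        by (intro bexI[OF _ g] bexI[of _ "\<lambda>x. f x - g x"]) simp_all
      then show "f \<in> F a \<oplus>\<^bsub>?Q\<^esub> F b"
        by (simp add: quotient_space_def set_add_def' V')
    qed
  qed
  have mult: "c \<odot>\<^bsub>?Q\<^esub> F a = F (c * a)" if "d \<or> a = 0" for c a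
  proof -
    have "c \<odot>\<^bsub>?Q\<^esub> F a = (\<Union>f\<in>F a. F (c * a))"
      unfolding quotient_space_def by (auto simp: V' F_def coset cl scale)
    then show ?thesis using F_ne[OF that] by auto
  qed
  \<comment> \<open>Any representative will do, as \<phi> is constant on a fibre.\<close>
  define T where "T X = \<phi> (SOME f. f \<in> X)" for X
  have TF: "T (F a) = a" if "d \<or> a = 0" for a
  proof -
    have "(SOME f. f \<in> F a) \<in> F a" by (rule someI_ex[OF F_ne[OF that]])
    then show ?thesis by (simp add: T_def F_def)
  qed
  have "bij_betw T (carrier ?Q) {a. d \<or> a = 0}"
    unfolding carrier by (rule bij_betw_byWitness[where f' = F]) (auto simp: TF)
  then show ?thesis unfolding zero_or_line_def carrier zero
    by (intro conjI exI[of _ T]) (auto simp: plus mult TF)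
qed

text \<open>For a spanning vector z instead of a functional. If z is not in W, the functional is
  recovered as the unique a with c - a z in W; otherwise W is the whole space and the zero
  functional serves.\<close>

lemma zero_or_line_quotient_spaceI:
  fixes V :: "('k::field, 'b \<Rightarrow> 'k) module"
  assumes V: "fun_module V" and W: "fun_subspace W" "W \<subseteq> carrier V"
    and z: "z \<in> carrier V" "z \<in> W \<longleftrightarrow> \<not> d"
    and span: "\<And>c. c \<in> carrier V \<Longrightarrow> \<exists>a. (\<lambda>x. c x - a * z x) \<in> W"
  shows "zero_or_line d (quotient_space V W)"
proof -
  note S = fun_subspaceD[OF V[unfolded fun_module_def, THEN conjunct1]]
  note Wc = fun_subspaceD[OF W(1)]
  show ?thesis
  proof (cases d)
    case False
    have "carrier V \<subseteq> W"
    proof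
      fix c assume "c \<in> carrier V"
      then obtain a where "(\<lambda>x. c x - a * z x) \<in> W" using span by blast
      moreover have "(\<lambda>x. a * z x) \<in> W" using z False Wc by blast
      ultimately show "c \<in> W" using Wc(2)[of "\<lambda>x. c x - a * z x" "\<lambda>x. a * z x"] by simp
    qed
    then show ?thesis using False W S(1)
      by (intro zero_or_line_quotient_space[OF V, where \<phi> = "\<lambda>_. 0"]) auto
  next
    case True
    have uniq: "a = b" if "(\<lambda>x. c x - a * z x) \<in> W" "(\<lambda>x. c x - b * z x) \<in> W" for a b c
    proof (rule ccontr)
      assume ne: "a \<noteq> b"
      \<comment> \<open>The difference of the two vectors is (b - a) z, so dividing by b - a puts z
        into W.\<close>
      have "(\<lambda>x. inverse (b - a) * ((c x - a * z x) - (c x - b * z x))) \<in> W"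
        by (rule Wc(3)[OF Wc(4)[OF that]])
      moreover have "(\<lambda>x. inverse (b - a) * ((c x - a * z x) - (c x - b * z x))) = z"
      proof
        fix x
        have "(c x - a * z x) - (c x - b * z x) = (b - a) * z x" by (simp add: algebra_simps)
        then show "inverse (b - a) * ((c x - a * z x) - (c x - b * z x)) = z x" using ne by simp
      qed
      ultimately show False using z(2) True by simp
    qed
    define \<phi> where "\<phi> c = (THE a. (\<lambda>x. c x - a * z x) \<in> W)" for c
    have \<phi>I: "\<phi> c = a" if "(\<lambda>x. c x - a * z x) \<in> W" for c a
      unfolding \<phi>_def using that uniq by blast
    have \<phi>: "(\<lambda>x. c x - \<phi> c * z x) \<in> W" if "c \<in> carrier V" for c
      using span[OF that] \<phi>I by blast
    show ?thesis
    proof (rule zero_or_line_quotient_space[OF V, where \<phi> = \<phi>])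
      fix f g assume fg: "f \<in> carrier V" "g \<in> carrier V"
      have "(\<lambda>x. f x + g x - (\<phi> f + \<phi> g) * z x) = (\<lambda>x. (f x - \<phi> f * z x) + (g x - \<phi> g * z x))"
        by (simp add: algebra_simps)
      then show "\<phi> (\<lambda>x. f x + g x) = \<phi> f + \<phi> g" using Wc(2)[OF \<phi>[OF fg(1)] \<phi>[OF fg(2)]] by (intro \<phi>I) simp
    next
      fix a f assume f: "f \<in> carrier V"
      have "(\<lambda>x. a * f x - a * \<phi> f * z x) = (\<lambda>x. a * (f x - \<phi> f * z x))"
        by (simp add: algebra_simps)
      then show "\<phi> (\<lambda>x. a * f x) = a * \<phi> f" using Wc(3)[OF \<phi>[OF f], of a] by (intro \<phi>I) simp
    next
      have "f \<in> W \<longleftrightarrow> \<phi> f = 0" if "f \<in> carrier V" for f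
        using \<phi>[OF that] \<phi>I[of f 0] by auto
      then show "W = {f \<in> carrier V. \<phi> f = 0}" using W(2) by auto
    next
      have "a \<in> \<phi> ` carrier V" for a
      proof
        show "a = \<phi> (\<lambda>x. a * z x)" using Wc(1) by (intro \<phi>I[symmetric]) simp
        show "(\<lambda>x. a * z x) \<in> carrier V" by (rule S(3)[OF z(1)])
      qed
      then show "\<phi> ` carrier V = {a. d \<or> a = 0}" using True by auto
    qed
  qed
qed


section \<open>Tensor products and direct sums\<close>


lemma listset_iff:
  "xs \<in> listset As \<longleftrightarrow> length xs = length As \<and> (\<forall>i<length As. xs ! i \<in> As ! i)"
proof (induction As arbitrary: xs)
  case (Cons A As)
  show ?case
    by (cases xs) (auto simp: set_Cons_def Cons.IH nth_Cons split: nat.splits)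
qed simp

lemma fun_subspace_sum:
  assumes "fun_subspace S" "finite A" "\<And>i. i \<in> A \<Longrightarrow> f i \<in> S"
  shows "(\<lambda>x. \<Sum>i\<in>A. f i x) \<in> S"
  using assms(2,3)
proof (induction A rule: finite_induct)
  case empty
  then show ?case using fun_subspaceD(1)[OF assms(1)] by simp
next
  case (insert i A)
  then show ?case using fun_subspaceD(2)[OF assms(1), of "f i" "\<lambda>x. \<Sum>i\<in>A. f i x"] by simp
qed

lemma submodule_fun_module:
  fixes V :: "('k::field, 'b \<Rightarrow> 'k) module"
  assumes "fun_module V" "W \<subseteq> carrier V"
  shows "LinearCombinations.submodule (class_ring :: 'k ring) W V \<longleftrightarrow> fun_subspace W"
  using assms module_fun_module[OF assms(1)]
  by (auto simp: LinearCombinations.submodule_def fun_subspace_def fun_module_def)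

lemma span_fun_module:
  fixes V :: "('k::field, 'b \<Rightarrow> 'k) module"
  assumes V: "fun_module V" and R: "R \<subseteq> carrier V"
  defines "W \<equiv> LinearCombinations.module.span (class_ring :: 'k ring) V R"
  shows "fun_subspace W" "R \<subseteq> W" "W \<subseteq> carrier V"
    "\<And>U. fun_subspace U \<Longrightarrow> U \<subseteq> carrier V \<Longrightarrow> R \<subseteq> U \<Longrightarrow> W \<subseteq> U"
proof -
  interpret Module.module "class_ring :: 'k ring" V by (rule module_fun_module[OF V])
  show *: "W \<subseteq> carrier V" unfolding W_def by (rule span_is_subset2[OF R])
  show "R \<subseteq> W" unfolding W_def by (rule in_own_span[OF R])
  show "fun_subspace W" using span_is_submodule[OF R] submodule_fun_module[OF V *] by (simp add: W_def)
  fix U assume "fun_subspace U" "U \<subseteq> carrier V" "R \<subseteq> U"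
  then show "W \<subseteq> U" unfolding W_def using span_is_subset submodule_fun_module[OF V] by blast
qed

lemma basis_elt_in_free_space: "t \<in> B \<Longrightarrow> basis_elt t \<in> carrier (free_space B)"
  by (simp add: carrier_free_space basis_elt_def)

text \<open>Multiplying the coordinates of the entries gives a functional on the free space that
  kills the relations. Conversely, modulo the relations each tuple is a multiple of one fixed tuple
  e, so the relations span the whole kernel.\<close>

lemma zero_or_line_tensor_space:
  fixes Vs :: "('k::field, 'a) module list"
  assumes "\<And>i. i < length Vs \<Longrightarrow> zero_or_line (d i) (Vs ! i)"
  shows "zero_or_line (\<forall>i<length Vs. d i) (tensor_space Vs)"
proof -
  let ?N = "length Vs"
  define L where "L = listset (map carrier Vs)"
  define F where "F = (free_space L :: ('k, 'a list \<Rightarrow> 'k) module)"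
  define R where "R = tensor_relations Vs"
  define W where "W = LinearCombinations.module.span (class_ring :: 'k ring) F R"
  have L: "t \<in> L \<longleftrightarrow> length t = ?N \<and> (\<forall>i<?N. t ! i \<in> carrier (Vs ! i))" for t
    by (auto simp: L_def listset_iff)
  have "\<exists>T. i < ?N \<longrightarrow> bij_betw T (carrier (Vs ! i)) {a. d i \<or> a = 0} \<and>
        (\<forall>x\<in>carrier (Vs ! i). \<forall>y\<in>carrier (Vs ! i). T (x \<oplus>\<^bsub>Vs ! i\<^esub> y) = T x + T y) \<and>
        (\<forall>a. \<forall>x\<in>carrier (Vs ! i). T (a \<odot>\<^bsub>Vs ! i\<^esub> x) = a * T x)" for i
    using assms[of i] unfolding zero_or_line_def by blast
  then obtain T where T': "i < ?N \<longrightarrow> bij_betw (T i) (carrier (Vs ! i)) {a. d i \<or> a = 0} \<and>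
        (\<forall>x\<in>carrier (Vs ! i). \<forall>y\<in>carrier (Vs ! i). T i (x \<oplus>\<^bsub>Vs ! i\<^esub> y) = T i x + T i y) \<and>
        (\<forall>a. \<forall>x\<in>carrier (Vs ! i). T i (a \<odot>\<^bsub>Vs ! i\<^esub> x) = a * T i x)" for i
    using choice[of "\<lambda>i T. i < ?N \<longrightarrow> bij_betw T (carrier (Vs ! i)) {a. d i \<or> a = 0} \<and>
        (\<forall>x\<in>carrier (Vs ! i). \<forall>y\<in>carrier (Vs ! i). T (x \<oplus>\<^bsub>Vs ! i\<^esub> y) = T x + T y) \<and>
        (\<forall>a. \<forall>x\<in>carrier (Vs ! i). T (a \<odot>\<^bsub>Vs ! i\<^esub> x) = a * T x)"] by blast
  have T: "\<And>i. i < ?N \<Longrightarrow> bij_betw (T i) (carrier (Vs ! i)) {a. d i \<or> a = 0}"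
      "\<And>i x y. i < ?N \<Longrightarrow> x \<in> carrier (Vs ! i) \<Longrightarrow> y \<in> carrier (Vs ! i) \<Longrightarrow> T i (x \<oplus>\<^bsub>Vs ! i\<^esub> y) = T i x + T i y"
      "\<And>i a x. i < ?N \<Longrightarrow> x \<in> carrier (Vs ! i) \<Longrightarrow> T i (a \<odot>\<^bsub>Vs ! i\<^esub> x) = a * T i x"
    using T' by simp_all
  have cl: "x \<oplus>\<^bsub>Vs ! i\<^esub> y \<in> carrier (Vs ! i)" "a \<odot>\<^bsub>Vs ! i\<^esub> x \<in> carrier (Vs ! i)"
    if "i < ?N" "x \<in> carrier (Vs ! i)" "y \<in> carrier (Vs ! i)" for i x y a
    using assms[OF that(1)] that unfolding zero_or_line_def by auto
  have upd: "t[i := x] \<in> L" if "t \<in> L" "x \<in> carrier (Vs ! i)" for t i x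
    using that by (cases "i < ?N") (auto simp: L nth_list_update)
  \<comment> \<open>The multilinear form on tuples; \<phi> below is its linear extension to the free
    space.\<close>
  define m where "m t = (\<Prod>i<?N. T i (t ! i))" for t
  have m_upd: "m (t[i := x]) = T i x * (\<Prod>j\<in>{..<?N} - {i}. T j (t ! j))" if "t \<in> L" "i < ?N" for t i x
  proof -
    have "m (t[i := x]) = T i (t[i := x] ! i) * (\<Prod>j\<in>{..<?N} - {i}. T j (t[i := x] ! j))"
      unfolding m_def by (rule prod.remove) (use that in auto)
    also have "(\<Prod>j\<in>{..<?N} - {i}. T j (t[i := x] ! j)) = (\<Prod>j\<in>{..<?N} - {i}. T j (t ! j))"
      by (rule prod.cong) auto
    finally show ?thesis using that by (simp add: L)
  qed
  define \<phi> where "\<phi> f = (\<Sum>t | f t \<noteq> 0. f t * m t)" for f :: "'a list \<Rightarrow> 'k"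
  have \<phi>: "\<phi> f = (\<Sum>t\<in>A. f t * m t)" if "finite A" "\<And>t. t \<notin> A \<Longrightarrow> f t = 0" for f A
    unfolding \<phi>_def by (rule sum.mono_neutral_left) (use that in auto)
  have FV: "fun_module F" unfolding F_def by (rule fun_module_free_space)
  have Fc: "f \<in> carrier F \<longleftrightarrow> finite {x. f x \<noteq> 0} \<and> (\<forall>x. x \<notin> L \<longrightarrow> f x = 0)" for f
    unfolding F_def by (rule carrier_free_space)
  note Fs = fun_subspaceD[OF FV[unfolded fun_module_def, THEN conjunct1]]
  have \<phi>_add: "\<phi> (\<lambda>x. f x + g x) = \<phi> f + \<phi> g" if "f \<in> carrier F" "g \<in> carrier F" for f g
  proof -
    let ?A = "{x. f x \<noteq> 0} \<union> {x. g x \<noteq> 0}"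
    have A: "finite ?A" using that by (auto simp: Fc)
    show ?thesis
      using \<phi>[OF A, of f] \<phi>[OF A, of g] \<phi>[OF A, of "\<lambda>x. f x + g x"]
      by (simp add: sum.distrib algebra_simps)
  qed
  have \<phi>_scale: "\<phi> (\<lambda>x. a * f x) = a * \<phi> f" if "f \<in> carrier F" for f a
  proof -
    have A: "finite {x. f x \<noteq> 0}" using that by (auto simp: Fc)
    show ?thesis
      using \<phi>[OF A, of f] \<phi>[OF A, of "\<lambda>x. a * f x"]
      by (simp add: sum_distrib_left algebra_simps)
  qed
  have \<phi>_diff: "\<phi> (\<lambda>x. f x - g x) = \<phi> f - \<phi> g" if "f \<in> carrier F" "g \<in> carrier F" for f g
    using \<phi>_add[OF that(1) Fs(3)[OF that(2)], of "- 1"] \<phi>_scale[OF that(2), of "- 1"] by simp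
  have \<phi>_basis: "\<phi> (basis_elt t) = m t" for t
    using \<phi>[of "{t}" "basis_elt t"] by (simp add: basis_elt_def)
  have basis: "basis_elt t \<in> carrier F" if "t \<in> L" for t
    unfolding F_def using that by (rule basis_elt_in_free_space)
  define U where "U = {f \<in> carrier F. \<phi> f = 0}"
  have U: "fun_subspace U"
    unfolding fun_subspace_def U_def
    using Fs \<phi>_add \<phi>_scale by (auto simp: \<phi>_def)
  have "R \<subseteq> U"
  proof
    fix f assume "f \<in> R"
    then consider
        (add) xs i x y where "xs \<in> L" "i < ?N" "x \<in> carrier (Vs ! i)" "y \<in> carrier (Vs ! i)"
          "f = (\<lambda>t. basis_elt (xs[i := x \<oplus>\<^bsub>Vs ! i\<^esub> y]) t - basis_elt (xs[i := x]) t - basis_elt (xs[i := y]) t)"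
      | (scale) xs i a x where "xs \<in> L" "i < ?N" "x \<in> carrier (Vs ! i)"
          "f = (\<lambda>t. basis_elt (xs[i := a \<odot>\<^bsub>Vs ! i\<^esub> x]) t - a * basis_elt (xs[i := x]) t)"
      unfolding R_def tensor_relations_def L_def by blast
    then show "f \<in> U"
    proof cases
      case add
      then have L': "xs[i := x \<oplus>\<^bsub>Vs ! i\<^esub> y] \<in> L" "xs[i := x] \<in> L" "xs[i := y] \<in> L"
        by (auto intro!: upd cl)
      have "\<phi> f = 0"
        unfolding add(5) using add(1-4) L'
        by (simp add: \<phi>_diff basis Fs(4) \<phi>_basis m_upd T distrib_right)
      then show ?thesis unfolding U_def using add(5) L' by (auto intro!: Fs(4) basis)
    next
      case scale
      then have L': "xs[i := a \<odot>\<^bsub>Vs ! i\<^esub> x] \<in> L" "xs[i := x] \<in> L"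
        by (auto intro!: upd cl)
      have "\<phi> f = 0"
        unfolding scale(4) using scale(1-3) L'
        by (simp add: \<phi>_diff \<phi>_scale basis Fs(3) \<phi>_basis m_upd T)
      then show ?thesis unfolding U_def using scale(4) L' by (auto intro!: Fs(3,4) basis)
    qed
  qed
  moreover have "U \<subseteq> carrier F" by (auto simp: U_def)
  ultimately have "R \<subseteq> carrier F" by blast
  note W = span_fun_module[OF FV this, folded W_def]
  note Ws = fun_subspaceD[OF W(1)]
  have WU: "W \<subseteq> U" using W(4)[OF U] \<open>U \<subseteq> carrier F\<close> \<open>R \<subseteq> U\<close> by blast
  \<comment> \<open>The unit vector of each factor, or its only vector if the factor is
    zero.\<close>
  have "\<exists>e. i < ?N \<longrightarrow> e \<in> carrier (Vs ! i) \<and> T i e = (if d i then 1 else 0)" for i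
    using T(1)[of i] by (auto simp: bij_betw_def image_iff set_eq_iff) metis
  then obtain g where g: "\<And>i. i < ?N \<Longrightarrow> g i \<in> carrier (Vs ! i)" "\<And>i. i < ?N \<Longrightarrow> T i (g i) = (if d i then 1 else 0)"
    by metis
  define e where "e = map g [0..<?N]"
  have e: "e \<in> L" "length e = ?N" "\<And>i. i < ?N \<Longrightarrow> e ! i = g i" using g by (auto simp: L e_def)
  have multiple: "T i x \<odot>\<^bsub>Vs ! i\<^esub> g i = x" if "i < ?N" "x \<in> carrier (Vs ! i)" for i x
  proof -
    have "d i \<or> T i x = 0" using bij_betwE[OF T(1)[OF that(1)]] that(2) by auto
    then have "T i (T i x \<odot>\<^bsub>Vs ! i\<^esub> g i) = T i x" using T(3)[OF that(1) g(1)[OF that(1)]] g(2)[OF that(1)] by auto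
    moreover have "T i x \<odot>\<^bsub>Vs ! i\<^esub> g i \<in> carrier (Vs ! i)" using cl(2)[OF that(1)] g(1) that(1) by blast
    ultimately show ?thesis using T(1)[OF that(1)] that(2) unfolding bij_betw_def inj_on_def by blast
  qed
  have reduce: "(\<lambda>x. basis_elt t x - m t * basis_elt e x) \<in> W" if t: "t \<in> L" for t
  proof -
    have lt: "length t = ?N" using t by (simp add: L)
    \<comment> \<open>The tuple is changed into e one entry at a time; each change costs one
      homogeneity relation and a factor \<open>T j (t ! j)\<close>.\<close>
    have "(\<lambda>x. basis_elt t x - (\<Prod>i<j. T i (t ! i)) * basis_elt (take j e @ drop j t) x) \<in> W" if "j \<le> ?N" for j
      using that
    proof (induction j)
      case 0
      then show ?case using Ws(1) by simp
    next
      case (Suc j)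
      define s where "s = take j e @ drop j t"
      have j: "j < ?N" using Suc.prems by simp
      have tj: "t ! j \<in> carrier (Vs ! j)" using t j by (simp add: L)
      have sL: "s \<in> L"
        unfolding L s_def using e t lt j by (auto simp: L nth_append g)
      have s1: "s[j := t ! j] = s" using lt e(2) j by (simp add: s_def list_eq_iff_nth_eq nth_list_update nth_append)
      have "s = take j e @ t ! j # drop (Suc j) t"
        using lt j by (simp add: s_def Cons_nth_drop_Suc)
      then have s2: "s[j := g j] = take (Suc j) e @ drop (Suc j) t"
        using list_update_length[of "take j e" "t ! j" "drop (Suc j) t" "g j"] e j
        by (simp add: take_Suc_conv_app_nth)
      have "(\<lambda>x. basis_elt (s[j := T j (t ! j) \<odot>\<^bsub>Vs ! j\<^esub> g j]) x - T j (t ! j) * basis_elt (s[j := g j]) x) \<in> R"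
        unfolding R_def tensor_relations_def using sL[unfolded L_def] j g(1)[OF j] by blast
      then have "(\<lambda>x. basis_elt s x - T j (t ! j) * basis_elt (take (Suc j) e @ drop (Suc j) t) x) \<in> W"
        using W(2) by (auto simp: multiple[OF j tj] s1 s2)
      from Ws(2)[OF Suc.IH[OF less_imp_le[OF j]] Ws(3)[OF this, of "\<Prod>i<j. T i (t ! i)"]]
      show ?case by (simp add: s_def algebra_simps)
    qed
    from this[of ?N] show ?thesis using lt e(2) by (simp add: m_def)
  qed
  have UW: "U \<subseteq> W"
  proof
    fix f assume f: "f \<in> U"
    let ?A = "{t. f t \<noteq> 0}"
    have A: "finite ?A" "?A \<subseteq> L" using f by (auto simp: U_def Fc)
    \<comment> \<open>Replacing every t by its multiple of e changes f by an element of W and leaves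
      \<open>\<phi> f\<close> times e, which is 0.\<close>
    have "(\<lambda>x. \<Sum>t\<in>?A. f t * (basis_elt t x - m t * basis_elt e x)) \<in> W"
      by (rule fun_subspace_sum[OF W(1) A(1)]) (use A(2) in \<open>auto intro!: Ws(3) reduce\<close>)
    also have "(\<lambda>x. \<Sum>t\<in>?A. f t * (basis_elt t x - m t * basis_elt e x)) = f"
    proof
      fix x
      have "(\<Sum>t\<in>?A. f t * (basis_elt t x - m t * basis_elt e x))
          = (\<Sum>t\<in>?A. f t * basis_elt t x) - \<phi> f * basis_elt e x"
        by (simp add: \<phi>_def sum_subtractf sum_distrib_right right_diff_distrib mult.assoc)
      also have "\<phi> f = 0" using f by (simp add: U_def)
      also have "(\<Sum>t\<in>?A. f t * basis_elt t x) = (\<Sum>t\<in>?A. if t = x then f x else 0)"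
        by (rule sum.cong) (auto simp: basis_elt_def)
      also have "\<dots> = f x" using A(1) by auto
      finally show "(\<Sum>t\<in>?A. f t * (basis_elt t x - m t * basis_elt e x)) = f x" by simp
    qed
    finally show "f \<in> W" .
  qed
  have "zero_or_line (\<forall>i<?N. d i) (quotient_space F W)"
  proof (rule zero_or_line_quotient_space[OF FV, where \<phi> = \<phi>])
    show "W = {f \<in> carrier F. \<phi> f = 0}" using UW WU by (simp add: U_def)
    show "\<phi> ` carrier F = {a. (\<forall>i<?N. d i) \<or> a = 0}"
    proof (cases "\<forall>i<?N. d i")
      case True
      have "m e = 1" unfolding m_def using True g e by simp
      then have "a = \<phi> (\<lambda>x. a * basis_elt e x)" for a by (simp add: \<phi>_scale basis e \<phi>_basis)
      then show ?thesis using True Fs(3)[OF basis[OF e(1)]] by blast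
    next
      case False
      then obtain i where i: "i < ?N" "\<not> d i" by blast
      \<comment> \<open>The zero factor puts a 0 into the product for every tuple.\<close>
      have "m t = 0" if "t \<in> L" for t
      proof -
        have "t ! i \<in> carrier (Vs ! i)" using that i by (simp add: L)
        then have "T i (t ! i) = 0" using bij_betwE[OF T(1)[OF i(1)]] i(2) by auto
        then show ?thesis unfolding m_def using i(1) by (intro prod_zero) auto
      qed
      then have "\<phi> f = 0" if "f \<in> carrier F" for f
        unfolding \<phi>_def using that by (intro sum.neutral) (auto simp: Fc)
      then show ?thesis using False Fs(1) by auto
    qed
  qed (use \<phi>_add \<phi>_scale in auto)
  then show ?thesis unfolding tensor_space_def Let_def W_def F_def R_def L_def .
qed

text \<open>At most one summand is non-zero, so its coordinate serves for the sum. The index set may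
  be infinite, but supports are then automatically finite.\<close>

lemma zero_or_line_direct_sum_space:
  fixes V :: "'i \<Rightarrow> ('k::field, 'a) module"
  assumes V: "\<And>i. i \<in> I \<Longrightarrow> zero_or_line (d i) (V i)"
    and uniq: "\<And>i j. i \<in> I \<Longrightarrow> j \<in> I \<Longrightarrow> d i \<Longrightarrow> d j \<Longrightarrow> i = j"
  shows "zero_or_line (\<exists>i\<in>I. d i) (direct_sum_space I V)"
proof -
  let ?S = "direct_sum_space I V"
  have cl: "\<zero>\<^bsub>V i\<^esub> \<in> carrier (V i)" "x \<in> carrier (V i) \<Longrightarrow> y \<in> carrier (V i) \<Longrightarrow> x \<oplus>\<^bsub>V i\<^esub> y \<in> carrier (V i)"
    "x \<in> carrier (V i) \<Longrightarrow> a \<odot>\<^bsub>V i\<^esub> x \<in> carrier (V i)" if "i \<in> I" for i x y a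
    using V[OF that] unfolding zero_or_line_def by auto
  have triv: "x = \<zero>\<^bsub>V i\<^esub>" if "i \<in> I" "\<not> d i" "x \<in> carrier (V i)" for i x
    using V[OF that(1)] that(2,3) zero_or_line_False[of "V i"] by simp
  have fin: "finite {i \<in> I. f i \<noteq> \<zero>\<^bsub>V i\<^esub>}" if "\<And>i. i \<in> I \<Longrightarrow> f i \<in> carrier (V i)" for f
  proof (cases "\<exists>i\<in>I. d i")
    case True
    then obtain i where i: "i \<in> I" "d i" by blast
    have "{j \<in> I. f j \<noteq> \<zero>\<^bsub>V j\<^esub>} \<subseteq> {i}"
    proof
      fix j assume "j \<in> {j \<in> I. f j \<noteq> \<zero>\<^bsub>V j\<^esub>}"
      then have "d j" "j \<in> I" using triv that by blast+
      then show "j \<in> {i}" using uniq i by blast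
    qed
    then show ?thesis by (rule finite_subset) simp
  next
    case False
    then have "{j \<in> I. f j \<noteq> \<zero>\<^bsub>V j\<^esub>} = {}" using triv that by blast
    then show ?thesis by (metis finite.emptyI)
  qed
  have carrier: "carrier ?S = (\<Pi>\<^sub>E i\<in>I. carrier (V i))"
    unfolding direct_sum_space_def using fin by auto
  have ops: "\<zero>\<^bsub>?S\<^esub> = (\<lambda>i\<in>I. \<zero>\<^bsub>V i\<^esub>)" "f \<oplus>\<^bsub>?S\<^esub> g = (\<lambda>i\<in>I. f i \<oplus>\<^bsub>V i\<^esub> g i)"
    "a \<odot>\<^bsub>?S\<^esub> f = (\<lambda>i\<in>I. a \<odot>\<^bsub>V i\<^esub> f i)" for f g a
    by (simp_all add: direct_sum_space_def)
  have closed: "\<zero>\<^bsub>?S\<^esub> \<in> carrier ?S" "f \<in> carrier ?S \<Longrightarrow> g \<in> carrier ?S \<Longrightarrow> f \<oplus>\<^bsub>?S\<^esub> g \<in> carrier ?S"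
    "f \<in> carrier ?S \<Longrightarrow> a \<odot>\<^bsub>?S\<^esub> f \<in> carrier ?S" for f g a
    unfolding carrier ops by (auto simp: cl PiE_iff)
  show ?thesis
  proof (cases "\<exists>i\<in>I. d i")
    case True
    then obtain i where i: "i \<in> I" "d i" by blast
    from V[OF i(1)] i(2) obtain T where T: "bij_betw T (carrier (V i)) (UNIV :: 'k set)" "T \<zero>\<^bsub>V i\<^esub> = 0"
      "\<And>x y. x \<in> carrier (V i) \<Longrightarrow> y \<in> carrier (V i) \<Longrightarrow> T (x \<oplus>\<^bsub>V i\<^esub> y) = T x + T y"
      "\<And>a x. x \<in> carrier (V i) \<Longrightarrow> T (a \<odot>\<^bsub>V i\<^esub> x) = a * T x"
      unfolding zero_or_line_def by auto
    have mem: "f i \<in> carrier (V i)" if "f \<in> carrier ?S" for f using that i(1) by (auto simp: carrier)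
    have "bij_betw (\<lambda>f. T (f i)) (carrier ?S) UNIV"
      unfolding bij_betw_def
    proof
      show "inj_on (\<lambda>f. T (f i)) (carrier ?S)"
      proof
        fix f g assume fg: "f \<in> carrier ?S" "g \<in> carrier ?S" "T (f i) = T (g i)"
        have "f j = g j" for j
        proof (cases "j \<in> I")
          case j: True
          show ?thesis
          proof (cases "j = i")
            case True
            then show ?thesis using T(1) fg mem by (auto simp: bij_betw_def inj_on_def)
          next
            case False
            then have "\<not> d j" using uniq i j by blast
            then show ?thesis using triv[OF j] fg(1,2) j by (metis PiE_mem carrier)
          qed
        next
          case False
          then show ?thesis using fg(1,2) by (metis PiE_arb carrier)
        qed
        then show "f = g" by blast
      qed
      have "\<exists>f\<in>carrier ?S. T (f i) = a" for a
      proof -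
        obtain x where x: "x \<in> carrier (V i)" "T x = a" using T(1) by (metis UNIV_I bij_betw_def imageE)
        have "(\<lambda>j\<in>I. if j = i then x else \<zero>\<^bsub>V j\<^esub>) \<in> carrier ?S" using x cl by (auto simp: carrier)
        then show ?thesis using x(2) i(1) by (intro bexI) auto
      qed
      then show "(\<lambda>f. T (f i)) ` carrier ?S = UNIV" by (auto simp: image_iff) metis
    qed
    then show ?thesis
      unfolding zero_or_line_def using True closed i(1) mem T
      by (intro conjI exI[of _ "\<lambda>f. T (f i)"]) (auto simp: ops)
  next
    case False
    have "carrier ?S = {\<zero>\<^bsub>?S\<^esub>}"
    proof
      show "carrier ?S \<subseteq> {\<zero>\<^bsub>?S\<^esub>}"
      proof
        fix f assume f: "f \<in> carrier ?S"
        have "f = (\<lambda>i\<in>I. \<zero>\<^bsub>V i\<^esub>)"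
        proof
          fix i show "f i = (\<lambda>i\<in>I. \<zero>\<^bsub>V i\<^esub>) i"
            using f False triv[of i "f i"] by (cases "i \<in> I") (auto simp: carrier)
        qed
        then show "f \<in> {\<zero>\<^bsub>?S\<^esub>}" by (simp add: ops)
      qed
    qed (use closed in simp)
    then show ?thesis
      unfolding zero_or_line_def using False closed
      by (intro conjI exI[of _ "\<lambda>_. 0"]) (auto simp: bij_betw_def)
  qed
qed


section \<open>Weak components in oriented lines\<close>


definition up_path :: "(nat \<Rightarrow> 'v) \<Rightarrow> nat \<Rightarrow> nat \<Rightarrow> ('v \<times> 'v) list" where
  "up_path v a b = map (\<lambda>i. (v i, v (Suc i))) [a..<b]"

definition down_path :: "(nat \<Rightarrow> 'v) \<Rightarrow> nat \<Rightarrow> nat \<Rightarrow> ('v \<times> 'v) list" where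
  "down_path v a b = map (\<lambda>i. (v (Suc i), v i)) (rev [a..<b])"

lemma up_path_Cons: "a < b \<Longrightarrow> up_path v a b = (v a, v (Suc a)) # up_path v (Suc a) b"
  by (simp add: up_path_def upt_conv_Cons)

lemma down_path_Cons: "a \<le> b \<Longrightarrow> down_path v a (Suc b) = (v (Suc b), v b) # down_path v a b"
  by (simp add: down_path_def)

lemma up_path_walk:
  "a \<le> b \<Longrightarrow> pcas (v a) (up_path v a b) (v b) \<and> pawalk_verts (v a) (up_path v a b) = map v [a..<Suc b]"
proof (induction "b - a" arbitrary: a)
  case 0
  then show ?case by (simp add: up_path_def)
next
  case (Suc k)
  then have "a < b" "k = b - Suc a" "Suc a \<le> b" by auto
  then show ?case using Suc.hyps(1)[of "Suc a"] by (simp add: up_path_Cons upt_conv_Cons)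
qed

lemma down_path_walk:
  "a \<le> b \<Longrightarrow> pcas (v b) (down_path v a b) (v a) \<and> pawalk_verts (v b) (down_path v a b) = map v (rev [a..<Suc b])"
proof (induction b rule: dec_induct)
  case base
  then show ?case by (simp add: down_path_def)
next
  case (step b)
  then show ?case by (simp add: down_path_Cons)
qed

lemma with_proj_collapse:
  "tail C = fst \<Longrightarrow> head C = snd \<Longrightarrow> with_proj \<lparr>pverts = verts C, parcs = arcs C\<rparr> = C"
  by (cases C) (simp add: with_proj_def)

lemma pair_wf_digraph_iff: "wf_digraph (with_proj G) \<longleftrightarrow> parcs G \<subseteq> pverts G \<times> pverts G"
  by (auto simp: wf_digraph_def)

lemma awalk_with_proj:
  "pre_digraph.awalk (with_proj G) u p w \<longleftrightarrow> u \<in> pverts G \<and> set p \<subseteq> parcs G \<and> pcas u p w"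
  by (simp add: pre_digraph.awalk_def cas_with_proj_eq)

lemma apath_with_proj:
  "pre_digraph.apath (with_proj G) u p w \<longleftrightarrow>
     u \<in> pverts G \<and> set p \<subseteq> parcs G \<and> pcas u p w \<and> distinct (pawalk_verts u p)"
  by (simp add: pre_digraph.apath_def awalk_with_proj awalk_verts_with_proj_eq)

lemma pawalk_verts_fst: "pcas u p w \<Longrightarrow> pawalk_verts u p = map fst p @ [w]"
  by (induction p arbitrary: u) auto

lemma pawalk_verts_snd: "pcas u p w \<Longrightarrow> pawalk_verts u p = u # map snd p"
proof (induction p arbitrary: u)
  case (Cons e p)
  then show ?case using Cons.IH[of "snd e"] by simp
qed simp

section \<open>Edge indices on an oriented line\<close>

locale oriented_line =
  fixes v :: "nat \<Rightarrow> 'v" and n :: nat and L :: "'v pair_pre_digraph"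
  assumes L: "oriented_linear_graph v n L"
begin

text \<open>Edges are numbered by their larger end point: the indices are 1 to n - 1, and the vertex
  \<open>v i\<close> lies between the edges \<open>i\<close> and \<open>Suc i\<close>. This is what
  makes instability of \<open>v i\<close> the marker \<open>t i\<close> of
  \<open>sparse_sets\<close>.\<close>

definition up :: "nat \<Rightarrow> bool" where
  "up i \<longleftrightarrow> (v (i - 1), v i) \<in> parcs L"

definition edge :: "nat \<Rightarrow> 'v \<times> 'v" where
  "edge i = (if up i then (v (i - 1), v i) else (v i, v (i - 1)))"

definition sub :: "nat set \<Rightarrow> 'v pair_pre_digraph" where
  "sub X = \<lparr>pverts = v ` {..<n}, parcs = edge ` X\<rparr>"

definition comp :: "nat \<Rightarrow> nat \<Rightarrow> 'v pair_pre_digraph" where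
  "comp a b = \<lparr>pverts = v ` {a..b}, parcs = edge ` {Suc a..b}\<rparr>"

text \<open>A maximal interval of edge indices in X. For X inside \<open>{1..<n}\<close> neither 0
  nor n lies in X, so the ends of the line are no special case; a = b is an isolated vertex.\<close>

definition block :: "nat set \<Rightarrow> nat \<Rightarrow> nat \<Rightarrow> bool" where
  "block X a b \<longleftrightarrow> a \<le> b \<and> b < n \<and> {Suc a..b} \<subseteq> X \<and> a \<notin> X \<and> Suc b \<notin> X"

lemma v_eq: "i < n \<Longrightarrow> j < n \<Longrightarrow> v i = v j \<longleftrightarrow> i = j"
  using L by (auto simp: oriented_linear_graph_def inj_on_def)

lemma verts_L: "pverts L = v ` {..<n}"
  using L by (simp add: oriented_linear_graph_def)

lemma v_in: "i < n \<Longrightarrow> v i \<in> pverts L" by (auto simp: verts_L)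

lemma edge_in: "i \<in> {1..<n} \<Longrightarrow> edge i \<in> parcs L"
  using L unfolding oriented_linear_graph_def edge_def up_def by (metis (no_types))

lemma parcs_L: "parcs L = edge ` {1..<n}"
proof
  show "edge ` {1..<n} \<subseteq> parcs L" using edge_in by blast
  show "parcs L \<subseteq> edge ` {1..<n}"
  proof
    fix e assume e: "e \<in> parcs L"
    then obtain i where i: "i \<in> {1..<n}" "e = (v i, v (i - 1)) \<or> e = (v (i - 1), v i)"
      using L unfolding oriented_linear_graph_def by blast
    moreover have "((v i, v (i - 1)) \<in> parcs L) \<noteq> ((v (i - 1), v i) \<in> parcs L)"
      using L i(1) unfolding oriented_linear_graph_def by blast
    ultimately have "e = edge i" using e by (auto simp: edge_def up_def)
    then show "e \<in> edge ` {1..<n}" using i(1) by blast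
  qed
qed

lemma edge_verts: "{fst (edge i), snd (edge i)} = {v (i - 1), v i}"
  by (auto simp: edge_def)

text \<open>Stated for unordered end points, because \<open>reduction\<close> compares edges in this
  way.\<close>

lemma edge_inj:
  assumes "i \<in> {1..<n}" "j \<in> {1..<n}" "{fst (edge i), snd (edge i)} = {fst (edge j), snd (edge j)}"
  shows "i = j"
proof -
  have "{v (i - 1), v i} = {v (j - 1), v j}" using assms(3) by (simp only: edge_verts)
  then have "v i = v j \<or> (v i = v (j - 1) \<and> v (i - 1) = v j)" by (auto simp: doubleton_eq_iff)
  moreover have "i < n" "j < n" "i - 1 < n" "j - 1 < n" using assms by auto
  ultimately have "i = j \<or> (i = j - 1 \<and> i - 1 = j)" by (simp add: v_eq)
  then show ?thesis using assms by auto
qed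

lemma inj_on_edge: "inj_on edge {1..<n}"
  by (rule inj_onI) (use edge_inj in auto)

lemma edge_in_image_iff: "X \<subseteq> {1..<n} \<Longrightarrow> i \<in> {1..<n} \<Longrightarrow> edge i \<in> edge ` X \<longleftrightarrow> i \<in> X"
  by (rule inj_on_image_mem_iff[OF inj_on_edge])

lemma sub_simps [simp]: "pverts (sub X) = pverts L" "parcs (sub X) = edge ` X"
  by (simp_all add: sub_def verts_L)

lemma comp_simps [simp]: "pverts (comp a b) = v ` {a..b}" "parcs (comp a b) = edge ` {Suc a..b}"
  by (simp_all add: comp_def)

lemma sub_full: "sub {1..<n} = L"
  by (rule pair_pre_digraph.equality) (simp_all add: parcs_L)

lemma edge_end_verts: "fst (edge i) \<in> A \<and> snd (edge i) \<in> A \<longleftrightarrow> v (i - 1) \<in> A \<and> v i \<in> A"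
  by (auto simp: edge_def)

lemma wf_sub:
  assumes "X \<subseteq> {1..<n}"
  shows "wf_digraph (with_proj (sub X))"
  unfolding pair_wf_digraph_iff
proof
  fix e assume "e \<in> parcs (sub X)"
  then obtain i where i: "i \<in> X" "e = edge i" by auto
  then have "i \<in> {1..<n}" using assms by blast
  then have "i - 1 < n" "i < n" by auto
  then have "v (i - 1) \<in> pverts L \<and> v i \<in> pverts L" using v_in by blast
  then show "e \<in> pverts (sub X) \<times> pverts (sub X)"
    using edge_end_verts[of i "pverts L"] i(2) by (simp add: mem_Times_iff)
qed

lemma unstable_iff: "i < n \<Longrightarrow> unstable L (v i) \<longleftrightarrow> 0 < i \<and> Suc i < n \<and> up i = up (Suc i)"
proof -
  assume i: "i < n"
  have f: "(\<exists>e\<in>parcs L. fst e = v i) \<longleftrightarrow> (0 < i \<and> \<not> up i) \<or> (Suc i < n \<and> up (Suc i))"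
  proof
    assume "\<exists>e\<in>parcs L. fst e = v i"
    then obtain j where j: "j \<in> {1..<n}" "fst (edge j) = v i" unfolding parcs_L by blast
    then have "(up j \<and> j - 1 = i) \<or> (\<not> up j \<and> j = i)" using i by (auto simp: edge_def v_eq split: if_splits)
    then show "(0 < i \<and> \<not> up i) \<or> (Suc i < n \<and> up (Suc i))" using j(1) by auto
  next
    assume "(0 < i \<and> \<not> up i) \<or> (Suc i < n \<and> up (Suc i))"
    then have "edge i \<in> parcs L \<and> fst (edge i) = v i \<or> edge (Suc i) \<in> parcs L \<and> fst (edge (Suc i)) = v i"
      using i edge_in[of i] edge_in[of "Suc i"] by (auto simp: edge_def)
    then show "\<exists>e\<in>parcs L. fst e = v i" by blast
  qed
  have s: "(\<exists>e\<in>parcs L. snd e = v i) \<longleftrightarrow> (0 < i \<and> up i) \<or> (Suc i < n \<and> \<not> up (Suc i))"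
  proof
    assume "\<exists>e\<in>parcs L. snd e = v i"
    then obtain j where j: "j \<in> {1..<n}" "snd (edge j) = v i" unfolding parcs_L by blast
    then have "(\<not> up j \<and> j - 1 = i) \<or> (up j \<and> j = i)" using i by (auto simp: edge_def v_eq split: if_splits)
    then show "(0 < i \<and> up i) \<or> (Suc i < n \<and> \<not> up (Suc i))" using j(1) by auto
  next
    assume "(0 < i \<and> up i) \<or> (Suc i < n \<and> \<not> up (Suc i))"
    then have "edge i \<in> parcs L \<and> snd (edge i) = v i \<or> edge (Suc i) \<in> parcs L \<and> snd (edge (Suc i)) = v i"
      using i edge_in[of i] edge_in[of "Suc i"] by (auto simp: edge_def)
    then show "\<exists>e\<in>parcs L. snd e = v i" by blast
  qed
  show ?thesis unfolding unstable_def f s by auto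
qed

lemma comp_full_arcs:
  assumes "X \<subseteq> {1..<n}" "{Suc a..b} \<subseteq> X" "b < n"
  shows "edge ` {Suc a..b} = {e \<in> edge ` X. fst e \<in> v ` {a..b} \<and> snd e \<in> v ` {a..b}}"
proof -
  have "v (i - 1) \<in> v ` {a..b} \<and> v i \<in> v ` {a..b} \<longleftrightarrow> i \<in> {Suc a..b}" if "i \<in> X" for i
  proof -
    have i: "i \<in> {1..<n}" using that assms(1) by blast
    have mem: "v j \<in> v ` {a..b} \<longleftrightarrow> j \<in> {a..b}" if "j < n" for j
      using that assms(3) by (auto simp: v_eq)
    have "i - 1 < n" "i < n" using i by auto
    then show ?thesis using i by (auto simp: mem)
  qed
  then show ?thesis using assms(2) edge_end_verts[of _ "v ` {a..b}"] by blast
qed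

section \<open>Blocks as weak components\<close>

lemma block_exists:
  assumes X: "X \<subseteq> {1..<n}" and i: "i < n"
  obtains a b where "block X a b" "a \<le> i" "i \<le> b"
proof -
  define P where "P a \<longleftrightarrow> a \<le> i \<and> {Suc a..i} \<subseteq> X" for a
  define a where "a = (LEAST a. P a)"
  have "P i" by (simp add: P_def)
  then have Pa: "P a" unfolding a_def by (rule LeastI)
  have aX: "a \<notin> X"
  proof
    assume "a \<in> X"
    moreover from this have "a \<in> {1..<n}" using X by blast
    then have "0 < a" by simp
    moreover have "{Suc (a - 1)..i} \<subseteq> insert a {Suc a..i}" using \<open>0 < a\<close> by auto
    ultimately have "P (a - 1)" using Pa unfolding P_def by auto
    then have "a \<le> a - 1" unfolding a_def by (rule Least_le)
    with \<open>0 < a\<close> show False by simp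
  qed
  define Q where "Q b \<longleftrightarrow> i \<le> b \<and> b < n \<and> {Suc i..b} \<subseteq> X" for b
  define b where "b = (GREATEST b. Q b)"
  have Qi: "Q i" using i by (simp add: Q_def)
  have Qn: "\<And>y. Q y \<Longrightarrow> y \<le> n" by (simp add: Q_def)
  have Qb: "Q b" unfolding b_def by (rule GreatestI_nat[of Q i n, OF Qi Qn])
  have bX: "Suc b \<notin> X"
  proof
    assume *: "Suc b \<in> X"
    then have "Suc b \<in> {1..<n}" using X by blast
    then have "Suc b < n" by simp
    moreover have "{Suc i..Suc b} \<subseteq> insert (Suc b) {Suc i..b}" by auto
    ultimately have "Q (Suc b)" using Qb * unfolding Q_def by auto
    then have "Suc b \<le> Greatest Q" by (rule Greatest_le_nat[of Q "Suc b" n, OF _ Qn])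
    then show False by (simp add: b_def)
  qed
  have "{Suc a..b} \<subseteq> {Suc a..i} \<union> {Suc i..b}" by auto
  then have "block X a b" using Pa Qb aX bX unfolding block_def P_def Q_def by auto
  then show thesis using that Pa Qb by (auto simp: P_def Q_def)
qed

lemma induced_sub_iff:
  assumes X: "X \<subseteq> {1..<n}"
  shows "induced_subgraph C (with_proj (sub X)) \<longleftrightarrow> tail C = fst \<and> head C = snd \<and> verts C \<subseteq> pverts L \<and>
     arcs C = {e \<in> edge ` X. fst e \<in> verts C \<and> snd e \<in> verts C}"
  using wf_sub[OF X] by (auto simp: induced_subgraph_def subgraph_def compatible_def wf_digraph_def)

lemma connected_iff:
  "Digraph_Component.connected C \<longleftrightarrow> verts C \<noteq> {} \<and>
     (\<forall>x\<in>verts C. \<forall>y\<in>verts C. (x, y) \<in> rtrancl_on (verts C) (parcs (mk_symmetric C)))"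
  by (simp add: connected_def strongly_connected_def reachable_def)

lemma comp_induced:
  assumes X: "X \<subseteq> {1..<n}" and ab: "{Suc a..b} \<subseteq> X" "b < n"
  shows "induced_subgraph (with_proj (comp a b)) (with_proj (sub X))"
  using comp_full_arcs[OF X ab] ab(2) by (auto simp: induced_sub_iff[OF X] verts_L)

lemma comp_connected:
  assumes "a \<le> b"
  shows "Digraph_Component.connected (with_proj (comp a b))"
proof -
  let ?C = "with_proj (comp a b)"
  have reach: "v a \<rightarrow>\<^sup>*\<^bsub>mk_symmetric ?C\<^esub> v i" if "a \<le> i" "i \<le> b" for i
    using that
  proof (induction i rule: dec_induct)
    case base
    then show ?case using assms by (auto simp: reachable_def)
  next
    case (step i)
    then have "edge (Suc i) \<in> parcs (comp a b)" by auto
    then have "(v i, v (Suc i)) \<in> parcs (mk_symmetric ?C)"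
      unfolding parcs_mk_symmetric by (intro UN_I[of "edge (Suc i)"]) (auto simp: edge_def)
    then show ?case using step unfolding reachable_def
      by (auto intro: rtrancl_on_into_rtrancl_on)
  qed
  have "v i \<rightarrow>\<^sup>*\<^bsub>mk_symmetric ?C\<^esub> v j" if "i \<in> {a..b}" "j \<in> {a..b}" for i j
  proof -
    have "v i \<rightarrow>\<^sup>*\<^bsub>mk_symmetric ?C\<^esub> v a"
      by (rule symmetric_reachable[OF symmetric_mk_symmetric reach]) (use that in auto)
    then show ?thesis using reach[of j] that unfolding reachable_def by (auto intro: rtrancl_on_trans)
  qed
  then show ?thesis using assms by (auto simp: connected_def strongly_connected_def)
qed

text \<open>An undirected walk uses edges with index in X, and leaving \<open>{a..b}\<close> would
  take the edge \<open>a\<close> or the edge \<open>Suc b\<close>.\<close>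

lemma connected_in_block:
  assumes X: "X \<subseteq> {1..<n}" and C: "induced_subgraph C (with_proj (sub X))" "Digraph_Component.connected C"
    and ab: "block X a b" and i: "a \<le> i" "i \<le> b" "v i \<in> verts C"
  shows "verts C \<subseteq> v ` {a..b}"
proof
  fix y assume "y \<in> verts C"
  then have "(v i, y) \<in> rtrancl_on (verts C) (parcs (mk_symmetric C))"
    using C(2) i(3) by (simp add: connected_iff)
  then show "y \<in> v ` {a..b}"
  proof (induction rule: rtrancl_on_induct)
    case base
    then show ?case using i by auto
  next
    case (step y z)
    from C(1) have "tail C = fst" "head C = snd" "arcs C \<subseteq> edge ` X"
      by (auto simp: induced_sub_iff[OF X])
    then obtain j where j: "j \<in> X" "(y = v (j - 1) \<and> z = v j) \<or> (y = v j \<and> z = v (j - 1))"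
      using step(2) by (auto simp: parcs_mk_symmetric edge_def split: if_splits)
    from step obtain k where k: "k \<in> {a..b}" "y = v k" by blast
    have "j \<in> {1..<n}" using j(1) X by blast
    then have jn: "1 \<le> j" "j < n" "j - 1 < n" by auto
    have kn: "k < n" using k ab by (auto simp: block_def)
    from j(2) show ?case
    proof
      assume yz: "y = v (j - 1) \<and> z = v j"
      then have "k = j - 1" using k(2) v_eq kn jn by metis
      then have "j = Suc k" using jn by simp
      then have "k \<noteq> b" using j(1) ab by (auto simp: block_def)
      then show ?thesis using yz k(1) \<open>j = Suc k\<close> by auto
    next
      assume yz: "y = v j \<and> z = v (j - 1)"
      then have "k = j" using k(2) v_eq kn jn by metis
      then have "k \<noteq> a" using j(1) ab by (auto simp: block_def)
      then have "j - 1 \<in> {a..b}" using k(1) \<open>k = j\<close> by auto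
      then show ?thesis using yz by auto
    qed
  qed
qed

text \<open>A component is contained in any block that it meets, and the block is itself connected
  and induced; maximality then gives equal vertex sets, and hence equal arcs as both are
  induced.\<close>

lemma weak_components_sub:
  assumes X: "X \<subseteq> {1..<n}"
  shows "weak_components (with_proj (sub X)) = {with_proj (comp a b) | a b. block X a b}"
proof (intro equalityI subsetI)
  fix C assume C: "C \<in> {with_proj (comp a b) | a b. block X a b}"
  then obtain a b where ab: "block X a b" "C = with_proj (comp a b)" by blast
  then have ab': "a \<le> b" "b < n" "{Suc a..b} \<subseteq> X" by (auto simp: block_def)
  have False if D: "induced_subgraph D (with_proj (sub X))" "Digraph_Component.connected D" "verts C \<subset> verts D" for D
  proof -
    have "v a \<in> verts C" using ab' ab(2) by simp
    then have va: "v a \<in> verts D" using that(3) by blast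
    have "verts D \<subseteq> v ` {a..b}" by (rule connected_in_block[OF X D(1,2) ab(1), of a]) (use ab' va in auto)
    then show False using that(3) ab(2) by auto
  qed
  then show "C \<in> weak_components (with_proj (sub X))"
    using comp_induced[OF X ab'(3,2)] comp_connected[OF ab'(1)] ab(2) by (auto simp: weak_components_def)
next
  fix C assume "C \<in> weak_components (with_proj (sub X))"
  then have C: "induced_subgraph C (with_proj (sub X))" "Digraph_Component.connected C"
    and max: "\<And>D. induced_subgraph D (with_proj (sub X)) \<Longrightarrow> Digraph_Component.connected D \<Longrightarrow> \<not> verts C \<subset> verts D"
    by (auto simp: weak_components_def)
  obtain x where "x \<in> verts C" using C(2) by (auto simp: connected_iff)
  moreover have "verts C \<subseteq> v ` {..<n}" using C(1) by (simp add: induced_sub_iff[OF X] verts_L)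
  ultimately obtain i where i: "i < n" "v i \<in> verts C" by auto
  obtain a b where ab: "block X a b" "a \<le> i" "i \<le> b" using block_exists[OF X i(1)] .
  then have ab': "a \<le> b" "b < n" "{Suc a..b} \<subseteq> X" by (auto simp: block_def)
  have "verts C \<subseteq> v ` {a..b}" by (rule connected_in_block[OF X C ab i(2)])
  then have eq: "verts C = v ` {a..b}"
    using max[OF comp_induced[OF X ab'(3,2)] comp_connected[OF ab'(1)]] by auto
  have "arcs C = edge ` {Suc a..b}" using C(1) unfolding induced_sub_iff[OF X] eq comp_full_arcs[OF X ab'(3,2)] by blast
  moreover have "tail C = fst" "head C = snd" using C(1) by (auto simp: induced_sub_iff[OF X])
  ultimately have "C = with_proj (comp a b)" using eq with_proj_collapse[of C] by (simp add: comp_def)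
  then show "C \<in> {with_proj (comp a b) | a b. block X a b}" using ab(1) by blast
qed

end


section \<open>Directed paths, multipaths and the reduction\<close>


context oriented_line
begin

lemma set_up_path: "\<forall>i\<in>{Suc a..b}. up i \<Longrightarrow> set (up_path v a b) = edge ` {Suc a..b}"
proof -
  assume up: "\<forall>i\<in>{Suc a..b}. up i"
  have "set (up_path v a b) = (\<lambda>i. (v i, v (Suc i))) ` {a..<b}" by (simp add: up_path_def)
  also have "\<dots> = (\<lambda>i. edge (Suc i)) ` {a..<b}" using up by (intro image_cong) (auto simp: edge_def)
  also have "\<dots> = edge ` Suc ` {a..<b}" by (simp only: image_image)
  also have "Suc ` {a..<b} = {Suc a..b}" by (simp only: image_Suc_atLeastLessThan atLeastLessThanSuc_atLeastAtMost)
  finally show ?thesis .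
qed

lemma set_down_path: "\<forall>i\<in>{Suc a..b}. \<not> up i \<Longrightarrow> set (down_path v a b) = edge ` {Suc a..b}"
proof -
  assume up: "\<forall>i\<in>{Suc a..b}. \<not> up i"
  have "set (down_path v a b) = (\<lambda>i. (v (Suc i), v i)) ` {a..<b}" by (simp add: down_path_def)
  also have "\<dots> = (\<lambda>i. edge (Suc i)) ` {a..<b}" using up by (intro image_cong) (auto simp: edge_def)
  also have "\<dots> = edge ` Suc ` {a..<b}" by (simp only: image_image)
  also have "Suc ` {a..<b} = {Suc a..b}" by (simp only: image_Suc_atLeastLessThan atLeastLessThanSuc_atLeastAtMost)
  finally show ?thesis .
qed

section \<open>Directed paths as runs of equally oriented edges\<close>

lemma distinct_map_v: "b < n \<Longrightarrow> distinct (map v [a..<Suc b])"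
  unfolding distinct_map by (auto intro!: inj_onI simp: v_eq)

text \<open>x is the source and y the target, at whichever end of the interval they lie. For a = b
  both alternatives describe the empty path.\<close>

definition run :: "nat \<Rightarrow> nat \<Rightarrow> ('v \<times> 'v) list \<Rightarrow> 'v \<Rightarrow> 'v \<Rightarrow> bool" where
  "run a b p x y \<longleftrightarrow> a \<le> b \<and> b < n \<and>
     ((\<forall>i\<in>{Suc a..b}. up i) \<and> p = up_path v a b \<and> x = v a \<and> y = v b \<or>
      (\<forall>i\<in>{Suc a..b}. \<not> up i) \<and> p = down_path v a b \<and> x = v b \<and> y = v a)"

lemma run_exists:
  assumes "a \<le> b" "b < n" "\<forall>i\<in>{Suc a..b}. up i = c"
  shows "\<exists>p x y. run a b p x y \<and> {x, y} = {v a, v b}"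
  using assms unfolding run_def by (cases c) auto

lemma runD:
  assumes "run a b p x y"
  shows "pcas x p y" "set (pawalk_verts x p) = v ` {a..b}" "distinct (pawalk_verts x p)"
    "set p = edge ` {Suc a..b}" "length p = b - a" "x \<in> v ` {a..b}" "{x, y} = {v a, v b}"
proof -
  have ab: "a \<le> b" "b < n" using assms by (auto simp: run_def)
  have s: "set [a..<Suc b] = {a..b}" by auto
  show "pcas x p y" "set (pawalk_verts x p) = v ` {a..b}" "distinct (pawalk_verts x p)"
    "set p = edge ` {Suc a..b}" "length p = b - a" "x \<in> v ` {a..b}" "{x, y} = {v a, v b}"
    using assms up_path_walk[OF ab(1), of v] down_path_walk[OF ab(1), of v] distinct_map_v[OF ab(2), of a]
      set_up_path[of a b] set_down_path[of a b] ab(1) s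
    unfolding run_def
    by (auto simp del: upt_Suc simp: up_path_def down_path_def rev_map[symmetric])
qed

lemma run_apath:
  assumes "run a b p x y"
  shows "pre_digraph.apath (with_proj L) x p y"
proof -
  have "a \<le> b" "b < n" using assms by (auto simp: run_def)
  then have "{Suc a..b} \<subseteq> {1..<n}" "v ` {a..b} \<subseteq> pverts L" by (auto simp: verts_L)
  then show ?thesis using runD[OF assms] by (auto simp: apath_with_proj parcs_L)
qed

lemma arc_cases:
  assumes "(x, y) \<in> parcs L"
  obtains (up) i where "Suc i < n" "up (Suc i)" "x = v i" "y = v (Suc i)"
    | (down) i where "Suc i < n" "\<not> up (Suc i)" "x = v (Suc i)" "y = v i"
proof -
  obtain j where j: "j \<in> {1..<n}" "(x, y) = edge j" using assms unfolding parcs_L by blast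
  then obtain i where "j = Suc i" by (cases j) auto
  then show thesis using j that[of i] by (auto simp: edge_def split: if_splits)
qed

text \<open>An arc prepended to a run either prolongs it beyond its source or starts at a vertex of
  the run, which simplicity forbids; a one-vertex run takes the direction of the new arc.\<close>

lemma apath_run:
  assumes "pre_digraph.apath (with_proj L) x p y"
  shows "\<exists>a b. run a b p x y"
  using assms unfolding apath_with_proj
proof (induction p arbitrary: x)
  case Nil
  then obtain a where "a < n" "x = v a" "y = v a" by (auto simp: verts_L)
  then have "run a a [] x y" by (auto simp: run_def up_path_def)
  then show ?case by blast
next
  case (Cons e p)
  obtain z where e: "e = (x, z)" using Cons.prems by (cases e) auto
  then have xz: "(x, z) \<in> parcs L" using Cons.prems by auto
  then have "z \<in> pverts L" by (rule arc_cases) (auto simp: v_in)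
  then have "\<exists>a b. run a b p z y" using Cons.IH[of z] Cons.prems e by auto
  then obtain a b where r: "run a b p z y" by blast
  have x: "x \<notin> v ` {a..b}" using Cons.prems e runD(2)[OF r] by auto
  have ab: "a \<le> b" "b < n" using r by (auto simp: run_def)
  from xz show ?case
  proof (cases rule: arc_cases)
    case (up i)
    have "run i b (e # p) x y"
    proof (cases "a = b")
      case True
      then have "z = v a" "p = []" "y = v a" using r by (auto simp: run_def up_path_def down_path_def)
      then have "Suc i = a" using up ab v_eq[of "Suc i" a] by simp
      then show ?thesis using up e ab True \<open>p = []\<close> \<open>y = v a\<close>
        by (auto simp: run_def up_path_def le_Suc_eq)
    next
      case False
      from r show ?thesis unfolding run_def
      proof (elim conjE disjE)
        assume *: "\<forall>i\<in>{Suc a..b}. up i" "p = up_path v a b" "z = v a" "y = v b"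
        then have "Suc i = a" using up ab v_eq[of "Suc i" a] by simp
        moreover from this have "\<forall>j\<in>{Suc i..b}. up j" using *(1) up(2) by (metis Suc_leI atLeastAtMost_iff le_neq_implies_less)
        ultimately show "i \<le> b \<and> b < n \<and> ((\<forall>j\<in>{Suc i..b}. up j) \<and> e # p = up_path v i b \<and> x = v i \<and> y = v b \<or>
            (\<forall>j\<in>{Suc i..b}. \<not> up j) \<and> e # p = down_path v i b \<and> x = v b \<and> y = v i)"
          using * e ab up by (auto simp: up_path_Cons)
      next
        \<comment> \<open>The run descends from \<open>v b\<close>, so the upward arc into
          \<open>v b\<close> would start at \<open>v (b - 1)\<close>, which the run visits.\<close>
        assume *: "p = down_path v a b" "z = v b"
        then have "Suc i = b" using up ab v_eq[of "Suc i" b] by simp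
        then have "i \<in> {a..b}" using False ab by auto
        then show "i \<le> b \<and> b < n \<and> ((\<forall>j\<in>{Suc i..b}. up j) \<and> e # p = up_path v i b \<and> x = v i \<and> y = v b \<or>
            (\<forall>j\<in>{Suc i..b}. \<not> up j) \<and> e # p = down_path v i b \<and> x = v b \<and> y = v i)"
          using x up by blast
      qed
    qed
    then show ?thesis by blast
  next
    case (down i)
    have "run a (Suc i) (e # p) x y"
    proof (cases "a = b")
      case True
      then have "z = v a" "p = []" "y = v a" using r by (auto simp: run_def up_path_def down_path_def)
      then have "i = a" using down ab v_eq[of i a] by simp
      then show ?thesis using down e ab True \<open>p = []\<close> \<open>y = v a\<close>
        by (auto simp: run_def down_path_def le_Suc_eq)
    next
      case False
      from r show ?thesis unfolding run_def
      proof (elim conjE disjE)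
        assume *: "\<forall>i\<in>{Suc a..b}. \<not> up i" "p = down_path v a b" "z = v b" "y = v a"
        then have "i = b" using down ab v_eq[of i b] by simp
        moreover from this have "\<forall>j\<in>{Suc a..Suc i}. \<not> up j" using *(1) down(2) by (auto simp: le_Suc_eq)
        ultimately show "a \<le> Suc i \<and> Suc i < n \<and> ((\<forall>j\<in>{Suc a..Suc i}. up j) \<and> e # p = up_path v a (Suc i) \<and> x = v a \<and> y = v (Suc i) \<or>
            (\<forall>j\<in>{Suc a..Suc i}. \<not> up j) \<and> e # p = down_path v a (Suc i) \<and> x = v (Suc i) \<and> y = v a)"
          using * e ab down by (auto simp: down_path_Cons)
      next
        assume *: "p = up_path v a b" "z = v a"
        then have "i = a" using down ab v_eq[of i a] by simp
        then have "Suc i \<in> {a..b}" using False ab by auto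
        then show "a \<le> Suc i \<and> Suc i < n \<and> ((\<forall>j\<in>{Suc a..Suc i}. up j) \<and> e # p = up_path v a (Suc i) \<and> x = v a \<and> y = v (Suc i) \<or>
            (\<forall>j\<in>{Suc a..Suc i}. \<not> up j) \<and> e # p = down_path v a (Suc i) \<and> x = v (Suc i) \<and> y = v a)"
          using x down by blast
      qed
    qed
    then show ?thesis by blast
  qed
qed

text \<open>The definite description needs uniqueness: the end points determine the interval, and
  for a < b the orientation of an edge in it determines the direction.\<close>

lemma path_dist_run:
  assumes "run a b p x y"
  shows "path_dist L (v a) (v b) = Fin (b - a)"
proof -
  let ?P = "\<lambda>q. pre_digraph.apath (with_proj L) (v a) q (v b) \<or> pre_digraph.apath (with_proj L) (v b) q (v a)"
  have ab: "a \<le> b" "b < n" using assms by (auto simp: run_def)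
  have P: "?P p" using run_apath[OF assms] runD(7)[OF assms] by (auto simp: doubleton_eq_iff)
  have "q = p" if "?P q" for q
  proof -
    from that obtain x' y' where q: "pre_digraph.apath (with_proj L) x' q y'" "{x', y'} = {v a, v b}" by blast
    then obtain a' b' where r: "run a' b' q x' y'" using apath_run by blast
    then have ab': "a' \<le> b'" "b' < n" by (auto simp: run_def)
    have "{v a', v b'} = {v a, v b}" using q(2) runD(7)[OF r] by simp
    then have "a' = a \<and> b' = b" using ab ab' v_eq[of a' a] v_eq[of b' b] v_eq[of a' b] v_eq[of b' a]
      by (auto simp: doubleton_eq_iff)
    then have r: "run a b q x' y'" using r by simp
    show ?thesis
    proof (cases "a = b")
      case True
      then show ?thesis using r assms by (auto simp: run_def up_path_def down_path_def)
    next
      case False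
      then have "Suc a \<in> {Suc a..b}" using ab by auto
      then show ?thesis using r assms unfolding run_def by metis
    qed
  qed
  then have "(THE q. ?P q) = p" using P by blast
  then show ?thesis unfolding path_dist_def using P runD(5)[OF assms] by auto
qed

text \<open>The two equally oriented edges at an unstable vertex are prolonged as far as possible on
  both sides; at a and b the orientation changes or the line ends, so these vertices are
  stable.\<close>

lemma maximal_run_exists:
  assumes "0 < i" "Suc i < n" "unstable L (v i)"
  obtains a b where "a < i" "i < b" "b < n" "\<forall>j\<in>{Suc a..b}. up j = up i"
    "stable L (v a)" "stable L (v b)"
proof -
  define P where "P a \<longleftrightarrow> a < i \<and> (\<forall>j\<in>{Suc a..i}. up j = up i)" for a
  define a where "a = (LEAST a. P a)"
  have "\<forall>j\<in>{Suc (i - 1)..i}. j = i" using assms(1) by auto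
  then have "P (i - 1)" using assms(1) by (auto simp: P_def)
  then have Pa: "P a" unfolding a_def by (rule LeastI)
  have i: "up (Suc i) = up i" using assms unstable_iff[of i] by auto
  have "a < i" using Pa by (simp add: P_def)
  then have an: "a < n" using assms(2) by simp
  have na: "\<not> unstable L (v a)"
  proof
    assume "unstable L (v a)"
    then have *: "0 < a" "up a = up (Suc a)" using unstable_iff[OF an] by blast+
    moreover have "Suc a \<in> {Suc a..i}" using \<open>a < i\<close> by simp
    then have "up (Suc a) = up i" using Pa unfolding P_def by blast
    moreover have "{Suc (a - 1)..i} \<subseteq> insert a {Suc a..i}" using \<open>0 < a\<close> by auto
    ultimately have "\<forall>j\<in>{Suc (a - 1)..i}. up j = up i" using Pa unfolding P_def by blast
    moreover have "a - 1 < i" using \<open>a < i\<close> by simp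
    ultimately have "P (a - 1)" unfolding P_def by blast
    then have "a \<le> a - 1" unfolding a_def by (rule Least_le)
    with * show False by simp
  qed
  define Q where "Q b \<longleftrightarrow> i < b \<and> b < n \<and> (\<forall>j\<in>{Suc i..b}. up j = up i)" for b
  define b where "b = Greatest Q"
  have Qi: "Q (Suc i)" using assms i by (auto simp: Q_def le_Suc_eq)
  have Qn: "\<And>y. Q y \<Longrightarrow> y \<le> n" by (simp add: Q_def)
  have Qb: "Q b" unfolding b_def by (rule GreatestI_nat[of Q "Suc i" n, OF Qi Qn])
  have nb: "\<not> unstable L (v b)"
  proof
    assume "unstable L (v b)"
    moreover have b: "i < b" "b < n" using Qb by (simp_all add: Q_def)
    ultimately have *: "Suc b < n" "up b = up (Suc b)" using unstable_iff by blast+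
    have "b \<in> {Suc i..b}" using b by simp
    then have "up b = up i" using Qb unfolding Q_def by blast
    moreover have "{Suc i..Suc b} \<subseteq> insert (Suc b) {Suc i..b}" by auto
    ultimately have "\<forall>j\<in>{Suc i..Suc b}. up j = up i" using Qb * unfolding Q_def by blast
    moreover have "i < Suc b" using b by simp
    ultimately have "Q (Suc b)" using *(1) unfolding Q_def by blast
    then have "Suc b \<le> Greatest Q" by (rule Greatest_le_nat[of Q "Suc b" n, OF _ Qn])
    then show False by (simp add: b_def)
  qed
  have "\<forall>j\<in>{Suc a..b}. up j = up i"
  proof
    fix j assume "j \<in> {Suc a..b}"
    then have "j \<in> {Suc a..i} \<or> j \<in> {Suc i..b}" by auto
    then show "up j = up i" using Pa Qb unfolding P_def Q_def by blast
  qed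
  moreover have "i < b" "b < n" using Qb by (simp_all add: Q_def)
  ultimately show thesis using that[of a b] \<open>a < i\<close> na nb v_in[OF an] v_in[of b] unfolding stable_def by blast
qed

text \<open>The longest run through \<open>v i\<close> has stable ends, so both unstable vertices
  would be interior to it; it would have at least three edges, against D(2).\<close>

lemma no_adjacent_unstable:
  assumes "property_D 2 L" "Suc i < n" "unstable L (v i)"
  shows "\<not> unstable L (v (Suc i))"
proof
  assume u: "unstable L (v (Suc i))"
  have i: "0 < i" "Suc i < n" using assms(2,3) unstable_iff[of i] by auto
  obtain a b where ab: "a < i" "i < b" "b < n" "\<forall>j\<in>{Suc a..b}. up j = up i" "stable L (v a)" "stable L (v b)"
    using maximal_run_exists[OF i assms(3)] .
  have "b \<noteq> Suc i" using u ab(6) by (auto simp: stable_def)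
  moreover have "a \<le> b" using ab(1,2) by simp
  then obtain p x y where r: "run a b p x y" using run_exists[OF _ ab(3,4)] by blast
  have "Fin (b - a) \<le> (Fin 2 :: nat extended)"
    using assms(1) ab(5,6) path_dist_run[OF r] unfolding property_D_def by metis
  ultimately show False using ab by simp
qed

text \<open>At a stable vertex two edges share a head or a tail, which cannot happen in a directed
  path. Conversely, if all inner vertices of a block are unstable, its edges are equally oriented
  and form a run.\<close>

lemma multipath_sub_iff:
  assumes X: "X \<subseteq> {1..<n}"
  shows "multipath L (sub X) \<longleftrightarrow> (\<forall>i. i \<in> X \<and> Suc i \<in> X \<longrightarrow> unstable L (v i))"
proof
  assume mp: "multipath L (sub X)"
  show "\<forall>i. i \<in> X \<and> Suc i \<in> X \<longrightarrow> unstable L (v i)"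
  proof (intro allI impI, rule ccontr)
    fix i assume iX: "i \<in> X \<and> Suc i \<in> X" and st: "\<not> unstable L (v i)"
    have i: "i \<in> {1..<n}" "Suc i \<in> {1..<n}" using iX X by blast+
    then have in1: "i < n" by simp
    obtain a b where ab: "block X a b" "a \<le> i" "i \<le> b" using block_exists[OF X in1] .
    have "a \<noteq> i" "b \<noteq> i" using ab(1) iX by (auto simp: block_def)
    then have mem: "i \<in> {Suc a..b}" "Suc i \<in> {Suc a..b}" using ab by auto
    let ?C = "with_proj (comp a b)"
    have "?C \<in> weak_components (with_proj (sub X))" using ab(1) unfolding weak_components_sub[OF X] by blast
    then have "is_single_vertex ?C \<or> is_directed_path ?C" using mp unfolding multipath_def by blast
    moreover have "\<not> is_single_vertex ?C" using mem unfolding is_single_vertex_def by auto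
    ultimately obtain u p w where p: "pre_digraph.apath ?C u p w" "edge ` {Suc a..b} = set p"
      unfolding is_directed_path_def by auto
    then have d: "pcas u p w" "distinct (pawalk_verts u p)" by (auto simp: apath_with_proj)
    \<comment> \<open>The vertices of a simple path are the tails followed by the target, and also
      the source followed by the heads; so tails are distinct, and heads are distinct.\<close>
    have "distinct (map fst p)" using d(2) unfolding pawalk_verts_fst[OF d(1)] by simp
    moreover have "distinct (map snd p)" using d(2) unfolding pawalk_verts_snd[OF d(1)] by simp
    ultimately have inj: "inj_on fst (set p)" "inj_on snd (set p)" by (simp_all add: distinct_map)
    have e: "edge i \<in> set p" "edge (Suc i) \<in> set p" using mem unfolding p(2)[symmetric] by blast+
    have "up i \<noteq> up (Suc i)" using st i unstable_iff[OF in1] by auto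
    then have "fst (edge i) = fst (edge (Suc i)) \<or> snd (edge i) = snd (edge (Suc i))"
      by (auto simp: edge_def)
    then have "edge i = edge (Suc i)" using inj e unfolding inj_on_def by blast
    then show False using inj_on_edge i unfolding inj_on_def by fastforce
  qed
next
  assume u: "\<forall>i. i \<in> X \<and> Suc i \<in> X \<longrightarrow> unstable L (v i)"
  have "is_single_vertex (with_proj (comp a b)) \<or> is_directed_path (with_proj (comp a b))" if "block X a b" for a b
  proof (cases "a = b")
    case True
    then have "is_single_vertex (with_proj (comp a b))" by (simp add: is_single_vertex_def)
    then show ?thesis ..
  next
    case False
    then have ab: "a < b" "b < n" "{Suc a..b} \<subseteq> X" using that by (auto simp: block_def)
    \<comment> \<open>Instability of the inner vertices propagates the orientation along the
      block.\<close>
    have const: "up i = up (Suc a)" if "Suc a \<le> i" "i \<le> b" for i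
      using that
    proof (induction i rule: dec_induct)
      case base
      then show ?case by simp
    next
      case (step i)
      then have "i \<in> X" "Suc i \<in> X" using ab(3) by auto
      then have "unstable L (v i)" using u by blast
      moreover have "i < n" using step ab by simp
      ultimately have "up i = up (Suc i)" using unstable_iff by blast
      then show ?case using step by simp
    qed
    have "\<forall>i\<in>{Suc a..b}. up i = up (Suc a)"
      by (intro ballI const) simp_all
    then obtain p x y where r: "run a b p x y" using run_exists[OF less_imp_le[OF ab(1)] ab(2)] by blast
    have "set p \<noteq> {}" unfolding runD(4)[OF r] using ab by simp
    then have "p \<noteq> []" by auto
    then have "is_directed_path (with_proj (comp a b))"
      unfolding is_directed_path_def apath_with_proj awalk_verts_with_proj_eq
      using runD[OF r] by (intro exI[of _ x] exI[of _ p] exI[of _ y]) simp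
    then show ?thesis ..
  qed
  then show "multipath L (sub X)"
    unfolding multipath_def weak_components_sub[OF X] spanning_def subgraph_def
    using wf_sub[OF X] wf_sub[OF subset_refl, unfolded sub_full] X
    by (auto simp: compatible_def parcs_L)
qed

lemma multipath_iff:
  "multipath L H \<longleftrightarrow> (\<exists>X\<in>sparse_sets (\<lambda>i. unstable L (v i)) (n - 1). H = sub X)"
proof
  assume mp: "multipath L H"
  then have H: "pverts H = pverts L" "parcs H \<subseteq> edge ` {1..<n}"
    unfolding multipath_def spanning_def subgraph_def by (auto simp: parcs_L)
  then obtain X where X: "X \<subseteq> {1..<n}" "parcs H = edge ` X" by (metis subset_imageE)
  then have "H = sub X" using H(1) by (intro pair_pre_digraph.equality) auto
  moreover from this have "X \<in> sparse_sets (\<lambda>i. unstable L (v i)) (n - 1)"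
    using mp multipath_sub_iff[OF X(1)] X(1) unfolding sparse_sets_def by (auto simp: subset_iff)
  ultimately show "\<exists>X\<in>sparse_sets (\<lambda>i. unstable L (v i)) (n - 1). H = sub X" by blast
next
  assume "\<exists>X\<in>sparse_sets (\<lambda>i. unstable L (v i)) (n - 1). H = sub X"
  then obtain X where X: "X \<subseteq> {1..n - 1}" "H = sub X" "\<forall>i. i \<in> X \<and> Suc i \<in> X \<longrightarrow> unstable L (v i)"
    by (auto simp: sparse_sets_def)
  moreover from X(1) have "X \<subseteq> {1..<n}" by (cases n) auto
  ultimately show "multipath L H" using multipath_sub_iff by simp
qed

text \<open>By D(2) a run has at most two edges, since three would enclose adjacent unstable
  vertices. The runs with two edges are those centred at an unstable \<open>v i\<close>; they are
  maximal and lose their lower edge, which is the edge \<open>i\<close> itself. Shorter runs lose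
  nothing, as their only edge is the top one.\<close>

lemma reduction_eq:
  assumes D: "property_D 2 L"
  shows "reduction v n L = sub ({1..<n} - {i. i < n \<and> unstable L (v i)})"
proof -
  let ?U = "{i. i < n \<and> unstable L (v i)}"
  let ?del = "{e. \<exists>u p w j m. maximal_apath L u p w \<and> j + m < n \<and>
              set (pre_digraph.awalk_verts (with_proj L) u p) = v ` {j..j + m} \<and>
              e \<in> set p \<and> {fst e, snd e} \<noteq> {v (j + m - 1), v (j + m)}}"
  have uU: "i \<in> {1..<n}" "Suc i < n" if "i \<in> ?U" for i using that unstable_iff[of i] by auto
  have short: "b \<le> Suc (Suc a)" if "run a b p x y" for a b p x y
  proof (rule ccontr)
    assume "\<not> ?thesis"
    then have "Suc a \<in> {Suc a..b}" "Suc (Suc a) \<in> {Suc a..b}" "Suc (Suc (Suc a)) \<in> {Suc a..b}" "b < n"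
      using that by (auto simp: run_def)
    moreover from this have "up (Suc a) = up (Suc (Suc a))" "up (Suc (Suc a)) = up (Suc (Suc (Suc a)))"
      using that unfolding run_def by blast+
    ultimately have "unstable L (v (Suc a))" "unstable L (v (Suc (Suc a)))" "Suc (Suc a) < n"
      using unstable_iff[of "Suc a"] unstable_iff[of "Suc (Suc a)"] by auto
    then show False using no_adjacent_unstable[OF D] by blast
  qed
  have "?del = edge ` ?U"
  proof (intro equalityI subsetI)
    fix e assume "e \<in> ?del"
    then obtain u p w j m where "maximal_apath L u p w" and p: "j + m < n"
        "set (pre_digraph.awalk_verts (with_proj L) u p) = v ` {j..j + m}" "e \<in> set p"
        "{fst e, snd e} \<noteq> {v (j + m - 1), v (j + m)}"
      by blast
    then have "pre_digraph.apath (with_proj L) u p w" by (simp add: maximal_apath_def)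
    note p = this p[unfolded awalk_verts_with_proj_eq]
    obtain a b where r: "run a b p u w" using apath_run[OF p(1)] by blast
    then have ab: "a \<le> b" "b < n" by (auto simp: run_def)
    have inj: "inj_on v {..<n}" by (auto intro!: inj_onI simp: v_eq)
    have sub: "{a..b} \<subseteq> {..<n}" "{j..j + m} \<subseteq> {..<n}" using ab p(2) by auto
    have "v ` {a..b} = v ` {j..j + m}" using p(3) runD(2)[OF r] by simp
    then have "{a..b} = {j..j + m}" using inj_on_image_eq_iff[OF inj sub] by blast
    then have jm: "j = a" "j + m = b" using ab by (auto simp: Icc_eq_Icc)
    obtain i where i: "i \<in> {Suc a..b}" "e = edge i" using p(4) runD(4)[OF r] by blast
    \<comment> \<open>The edge \<open>b\<close> is the surviving one, so a deleted edge is the lower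
      of two.\<close>
    have "i \<noteq> b" using p(5) i(2) jm edge_verts by auto
    then have "i = Suc a" "b = Suc (Suc a)" using i(1) short[OF r] by auto
    moreover have "up i = up (Suc i)" using r calculation unfolding run_def by auto
    ultimately have "unstable L (v i)" using ab unstable_iff[of i] by auto
    then show "e \<in> edge ` ?U" using i ab by auto
  next
    fix e assume "e \<in> edge ` ?U"
    then obtain i where i: "i < n" "unstable L (v i)" "e = edge i" by blast
    then have i': "0 < i" "Suc i < n" "up i = up (Suc i)" using unstable_iff[of i] by auto
    let ?a = "i - 1" and ?b = "Suc i"
    have int: "{Suc ?a..?b} = {i, Suc i}" using i' by auto
    have "\<forall>j\<in>{Suc ?a..?b}. up j = up i" unfolding int using i'(3) by simp
    moreover have "?a \<le> ?b" by simp
    ultimately obtain p x y where r: "run ?a ?b p x y" using run_exists[OF _ i'(2)] by blast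
    have "maximal_apath L x p y"
      unfolding maximal_apath_def awalk_verts_with_proj_eq
    proof (intro conjI allI impI)
      show "pre_digraph.apath (with_proj L) x p y" by (rule run_apath[OF r])
      fix x' p' y' assume *: "pre_digraph.apath (with_proj L) x' p' y' \<and>
        set (pawalk_verts x p) \<subseteq> set (pawalk_verts x' p') \<and> set p \<subseteq> set p'"
      then obtain a b where r': "run a b p' x' y'" using apath_run by blast
      then have ab: "a \<le> b" "b < n" by (auto simp: run_def)
      have "edge ` {Suc ?a..?b} \<subseteq> edge ` {Suc a..b}" using * runD(4)[OF r] runD(4)[OF r'] by simp
      moreover have "{Suc a..b} \<subseteq> {1..<n}" "i \<in> {1..<n}" "Suc i \<in> {1..<n}" using ab i' by auto
      ultimately have "i \<in> {Suc a..b}" "Suc i \<in> {Suc a..b}"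
        using edge_in_image_iff[of "{Suc a..b}"] unfolding int by blast+
      \<comment> \<open>A run of at most two edges containing the edges \<open>i\<close> and
        \<open>Suc i\<close> consists of exactly these.\<close>
      then have "a = ?a" "b = ?b" using short[OF r'] by auto
      then show "set p' = set p" using runD(4)[OF r] runD(4)[OF r'] by simp
    qed
    moreover have "set (pawalk_verts x p) = v ` {?a..?a + 2}" using runD(2)[OF r] i' by simp
    moreover have "e \<in> set p" using runD(4)[OF r] int i(3) by simp
    moreover have "{fst e, snd e} \<noteq> {v (?a + 2 - 1), v (?a + 2)}"
    proof
      assume "{fst e, snd e} = {v (?a + 2 - 1), v (?a + 2)}"
      then have "{fst (edge i), snd (edge i)} = {fst (edge (Suc i)), snd (edge (Suc i))}"
        using i(3) i' edge_verts[of "Suc i"] by simp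
      then show False using edge_inj[of i "Suc i"] i' by simp
    qed
    moreover have "?a + 2 < n" using i' by simp
    ultimately show "e \<in> ?del" unfolding awalk_verts_with_proj_eq by blast
  qed
  moreover have "parcs L - edge ` ?U = edge ` ({1..<n} - ?U)"
    unfolding parcs_L using inj_on_edge uU(1) by (intro inj_on_image_set_diff[symmetric]) auto
  ultimately show ?thesis unfolding reduction_def by (intro pair_pre_digraph.equality) simp_all
qed

end


section \<open>Multipath cohomology of an oriented line\<close>


context oriented_line
begin

definition faces :: "nat set set" where
  "faces = sparse_sets (\<lambda>i. unstable L (v i)) (n - 1)"

definition index_set :: "'v pair_pre_digraph \<Rightarrow> nat set" where
  "index_set H = {i \<in> {1..<n}. edge i \<in> parcs H}"

definition face_signs :: "('v \<times> 'v) rel \<Rightarrow> nat set \<Rightarrow> nat \<Rightarrow> 'k::field" where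
  "face_signs r X i = (- 1) ^ edges_before r (sub X) (edge i)"

text \<open>\<open>pull\<close> and \<open>push\<close> are mutually inverse on cochains. Both are
  cut off to 0 outside their complex, in accordance with the differential, which reads and produces
  values at multipaths only.\<close>

definition pull :: "('v pair_pre_digraph \<Rightarrow> 'k::field) \<Rightarrow> nat set \<Rightarrow> 'k" where
  "pull c X = (if X \<in> faces then c (sub X) else 0)"

definition push :: "(nat set \<Rightarrow> 'k::field) \<Rightarrow> 'v pair_pre_digraph \<Rightarrow> 'k" where
  "push f H = (if multipath L H then f (index_set H) else 0)"

lemma multipath_faces: "multipath L H \<longleftrightarrow> (\<exists>X\<in>faces. H = sub X)"
  unfolding faces_def by (rule multipath_iff)

lemma simplicial_faces: "simplicial faces"
  unfolding faces_def by (rule simplicial_sparse_sets)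

lemma faces_subset: "X \<in> faces \<Longrightarrow> X \<subseteq> {1..<n}"
proof -
  assume "X \<in> faces"
  then have "X \<subseteq> {1..n - 1}" by (simp add: faces_def sparse_sets_def)
  also have "\<dots> \<subseteq> {1..<n}" by auto
  finally show ?thesis .
qed

lemma faces_down: "X \<in> faces \<Longrightarrow> Y \<subseteq> X \<Longrightarrow> Y \<in> faces"
  using simplicial_faces by (auto simp: simplicial_def)

lemma finite_faces: "finite faces"
  by (rule finite_subset[of _ "Pow {1..<n}"]) (use faces_subset in auto)

lemma index_set_sub: "X \<subseteq> {1..<n} \<Longrightarrow> index_set (sub X) = X"
  using edge_in_image_iff[of X] by (auto simp: index_set_def)

lemma sub_inj: "X \<subseteq> {1..<n} \<Longrightarrow> Y \<subseteq> {1..<n} \<Longrightarrow> sub X = sub Y \<longleftrightarrow> X = Y"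
  using index_set_sub by metis

lemma sub_index_set: "multipath L H \<Longrightarrow> index_set H \<in> faces \<and> sub (index_set H) = H"
  using faces_subset index_set_sub by (auto simp: multipath_faces)

lemma multipath_sub: "X \<in> faces \<Longrightarrow> multipath L (sub X)"
  by (auto simp: multipath_faces)

lemma multipath_sub': "X \<subseteq> {1..<n} \<Longrightarrow> multipath L (sub X) \<longleftrightarrow> X \<in> faces"
  using sub_inj faces_subset by (auto simp: multipath_faces)

lemma card_edge_image: "X \<in> faces \<Longrightarrow> card (edge ` X) = card X"
  by (rule card_image) (rule inj_on_subset[OF inj_on_edge faces_subset])

lemma pull_push: "f \<in> cochains faces m \<Longrightarrow> pull (push f) = f"
  using faces_subset multipath_sub
  by (auto simp: pull_def push_def index_set_sub cochains_iff fun_eq_iff)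

lemma cochain_space_iff:
  "c \<in> carrier (cochain_space L m) \<longleftrightarrow> (\<forall>H. \<not> (multipath L H \<and> int (card (parcs H)) = m) \<longrightarrow> c H = 0)"
proof -
  have "{H. multipath L H} = sub ` faces" by (auto simp: multipath_faces)
  then have fin: "finite {H. multipath L H}" using finite_faces by simp
  have "finite {H. c H \<noteq> 0}" if "\<forall>H. \<not> (multipath L H \<and> int (card (parcs H)) = m) \<longrightarrow> c H = 0"
    by (rule finite_subset[OF _ fin]) (use that in blast)
  then show ?thesis unfolding cochain_space_def carrier_free_space by blast
qed

lemma push_pull: "c \<in> carrier (cochain_space L m) \<Longrightarrow> push (pull c) = c"
  using sub_index_set by (fastforce simp: pull_def push_def cochain_space_iff fun_eq_iff)

lemma pull_cochains: "c \<in> carrier (cochain_space L m) \<Longrightarrow> pull c \<in> cochains faces m"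
  using multipath_sub by (auto simp: cochain_space_iff cochains_iff pull_def card_edge_image)

lemma push_cochain_space: "f \<in> cochains faces m \<Longrightarrow> push f \<in> carrier (cochain_space L m)"
proof -
  assume f: "f \<in> cochains faces m"
  have "push f H = 0" if "\<not> (multipath L H \<and> int (card (parcs H)) = m)" for H
  proof (cases "multipath L H")
    case True
    then have H: "index_set H \<in> faces" "sub (index_set H) = H" using sub_index_set by auto
    then have "card (parcs H) = card (index_set H)" using card_edge_image[OF H(1)] sub_simps(2)[of "index_set H"] by simp
    then show ?thesis using that f True by (simp add: push_def cochains_iff)
  qed (simp add: push_def)
  then show ?thesis by (simp add: cochain_space_iff)
qed

lemma insert_edge_sub: "insert_edge (edge i) (sub X) = sub (insert i X)"
  by (simp add: sub_def)

text \<open>The differential distributes each multipath over its extensions, whereas the coboundary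
  gathers at X the contributions of its facets. Both are the same sum over pairs of a face Y and an
  index i that can be added to it.\<close>

lemma differential_eq:
  "differential r L c = push (coboundary faces (face_signs r) (pull c))"
proof
  fix Z
  define I where "I Y = {i \<in> {1..<n}. i \<notin> Y \<and> insert i Y \<in> faces}" for Y
  have "{H. multipath L H} = sub ` faces" by (auto simp: multipath_faces)
  moreover have "inj_on sub faces" using sub_inj faces_subset by (auto intro!: inj_onI)
  ultimately have "differential r L c Z = (\<Sum>Y\<in>faces. c (sub Y) *
      (\<Sum>e | e \<in> parcs L \<and> e \<notin> edge ` Y \<and> multipath L (insert_edge e (sub Y)).
        (- 1) ^ edges_before r (sub Y) e * basis_elt (insert_edge e (sub Y)) Z))"
    unfolding differential_def by (simp add: sum.reindex)
  also have "\<dots> = (\<Sum>Y\<in>faces. \<Sum>i\<in>I Y. c (sub Y) * (face_signs r Y i * basis_elt (sub (insert i Y)) Z))"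
  proof (rule sum.cong[OF refl])
    fix Y assume Y: "Y \<in> faces"
    note Y' = faces_subset[OF Y]
    have "{e. e \<in> parcs L \<and> e \<notin> edge ` Y \<and> multipath L (insert_edge e (sub Y))} = edge ` I Y"
    proof -
      have *: "edge i \<notin> edge ` Y \<and> multipath L (insert_edge (edge i) (sub Y)) \<longleftrightarrow> i \<notin> Y \<and> insert i Y \<in> faces"
        if "i \<in> {1..<n}" for i
        using that Y' edge_in_image_iff[OF Y' that] multipath_sub'[of "insert i Y"] unfolding insert_edge_sub by simp
      have "{e. e \<in> edge ` {1..<n} \<and> P e} = edge ` {i \<in> {1..<n}. P (edge i)}" for P by blast
      then have "{e. e \<in> parcs L \<and> e \<notin> edge ` Y \<and> multipath L (insert_edge e (sub Y))}
          = edge ` {i \<in> {1..<n}. edge i \<notin> edge ` Y \<and> multipath L (insert_edge (edge i) (sub Y))}"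
        unfolding parcs_L .
      also have "{i \<in> {1..<n}. edge i \<notin> edge ` Y \<and> multipath L (insert_edge (edge i) (sub Y))} = I Y"
        unfolding I_def using * by (intro Collect_cong) blast
      finally show ?thesis .
    qed
    moreover have "inj_on edge (I Y)" by (rule inj_on_subset[OF inj_on_edge]) (auto simp: I_def)
    ultimately show "c (sub Y) * (\<Sum>e | e \<in> parcs L \<and> e \<notin> edge ` Y \<and> multipath L (insert_edge e (sub Y)).
        (- 1) ^ edges_before r (sub Y) e * basis_elt (insert_edge e (sub Y)) Z)
      = (\<Sum>i\<in>I Y. c (sub Y) * (face_signs r Y i * basis_elt (sub (insert i Y)) Z))"
      by (simp add: sum.reindex insert_edge_sub face_signs_def sum_distrib_left del: sub_simps)
  qed
  also have "\<dots> = (\<Sum>(Y, i)\<in>Sigma faces I. c (sub Y) * (face_signs r Y i * basis_elt (sub (insert i Y)) Z))"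
    by (rule sum.Sigma) (auto simp: finite_faces I_def)
  also have "\<dots> = push (coboundary faces (face_signs r) (pull c)) Z"
  proof (cases "multipath L Z")
    case False
    have "Z \<noteq> sub (insert i Y)" if "i \<in> I Y" for i Y
      using that False multipath_sub by (auto simp: I_def)
    then have "(\<Sum>(Y, i)\<in>Sigma faces I. c (sub Y) * (face_signs r Y i * basis_elt (sub (insert i Y)) Z)) = 0"
      by (intro sum.neutral) (auto simp: basis_elt_def)
    then show ?thesis using False by (simp add: push_def)
  next
    case True
    then obtain X where X: "X \<in> faces" "Z = sub X" by (auto simp: multipath_faces)
    note X' = faces_subset[OF X(1)]
    \<comment> \<open>Only the pairs that reassemble to X contribute to the coefficient at
      Z.\<close>
    let ?g = "\<lambda>i. (X - {i}, i)"
    have fin: "finite (Sigma faces I)" by (rule finite_SigmaI) (auto simp: finite_faces I_def)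
    have sub: "?g ` X \<subseteq> Sigma faces I"
      using X(1) X' faces_down[OF X(1)] by (auto simp: I_def insert_absorb)
    have zero: "c (sub Y) * (face_signs r Y i * basis_elt (sub (insert i Y)) Z) = 0"
      if "(Y, i) \<in> Sigma faces I - ?g ` X" for Y i
    proof -
      have "X \<noteq> insert i Y" using that by (auto simp: I_def image_iff)
      moreover have "insert i Y \<subseteq> {1..<n}" using that faces_subset[of "insert i Y"] by (auto simp: I_def)
      ultimately show ?thesis using sub_inj[OF X'] by (simp add: basis_elt_def X(2))
    qed
    have "(\<Sum>(Y, i)\<in>Sigma faces I. c (sub Y) * (face_signs r Y i * basis_elt (sub (insert i Y)) Z))
        = (\<Sum>(Y, i)\<in>?g ` X. c (sub Y) * (face_signs r Y i * basis_elt (sub (insert i Y)) Z))"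
      by (rule sum.mono_neutral_right[OF fin sub]) (use zero in auto)
    also have "\<dots> = (\<Sum>i\<in>X. c (sub (X - {i})) * (face_signs r (X - {i}) i * basis_elt (sub (insert i (X - {i}))) Z))"
      by (subst sum.reindex) (auto intro: inj_onI)
    also have "\<dots> = (\<Sum>i\<in>X. face_signs r (X - {i}) i * pull c (X - {i}))"
      using faces_down[OF X(1)] by (intro sum.cong) (auto simp: insert_absorb X(2) basis_elt_def pull_def)
    also have "\<dots> = push (coboundary faces (face_signs r) (pull c)) Z"
      using X X' multipath_sub by (simp add: push_def index_set_sub coboundary_def)
    finally show ?thesis .
  qed
  finally show "differential r L c Z = push (coboundary faces (face_signs r) (pull c)) Z" .
qed

lemma edges_before_insert:
  assumes "insert i (insert j X) \<in> faces" "i \<notin> X" "i \<noteq> j"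
  shows "edges_before r (sub (insert i X)) (edge j)
    = edges_before r (sub X) (edge j) + (if (edge i, edge j) \<in> r then 1 else 0)"
proof -
  have sub: "insert i (insert j X) \<subseteq> {1..<n}" using faces_subset[OF assms(1)] .
  then have X: "X \<subseteq> {1..<n}" and i: "i \<in> {1..<n}" and j: "j \<in> {1..<n}" by blast+
  have fin: "finite (edge ` X)" using X finite_subset by blast
  have ne: "edge i \<noteq> edge j" using inj_on_edge i j assms(3) by (auto simp: inj_on_def)
  have nX: "edge i \<notin> edge ` X" using edge_in_image_iff[OF X i] assms(2) by simp
  let ?S = "{f \<in> edge ` X. f \<noteq> edge j \<and> (f, edge j) \<in> r}"
  have "{f \<in> edge ` insert i X. f \<noteq> edge j \<and> (f, edge j) \<in> r}
      = (if (edge i, edge j) \<in> r then insert (edge i) ?S else ?S)"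
    using ne by auto
  moreover have "card (insert (edge i) ?S) = Suc (card ?S)"
    by (rule card_insert_disjoint) (use fin nX in auto)
  ultimately show ?thesis by (simp add: edges_before_def)
qed

lemma incidence_signs_faces:
  assumes r: "linear_order_on (parcs L) r"
  shows "incidence_signs faces (face_signs r :: nat set \<Rightarrow> nat \<Rightarrow> 'k::field)"
  unfolding incidence_signs_def
proof (intro conjI allI impI)
  fix X i
  show "face_signs r X i * face_signs r X i = (1 :: 'k)"
    by (simp add: face_signs_def power_mult_distrib[symmetric])
next
  fix X i j assume *: "i \<notin> X" "j \<notin> X" "i \<noteq> j" "insert i (insert j X) \<in> faces"
  then have "insert i (insert j X) \<subseteq> {1..<n}" using faces_subset by blast
  then have ij: "i \<in> {1..<n}" "j \<in> {1..<n}" by blast+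
  then have e: "edge i \<in> parcs L" "edge j \<in> parcs L" "edge i \<noteq> edge j"
    using inj_on_edge *(3) edge_in by (auto simp: inj_on_def)
  \<comment> \<open>Exactly one of the two edges precedes the other, so exactly one of the two
    products acquires an extra factor -1.\<close>
  have "(edge i, edge j) \<in> r \<longleftrightarrow> (edge j, edge i) \<notin> r"
    using r e unfolding linear_order_on_def partial_order_on_def total_on_def antisym_def by blast
  then show "face_signs r X i * face_signs r (insert i X) j
      = - (face_signs r X j * face_signs r (insert j X) i :: 'k)"
    using edges_before_insert[OF *(4) *(1) *(3), of r]
      edges_before_insert[of j i X r] * by (auto simp: face_signs_def power_add insert_commute)
qed

text \<open>Cocycles and coboundaries correspond under \<open>push\<close> and \<open>pull\<close>,
  so the spanning cocycle of \<open>sparse_sets_cohomology\<close> becomes a vector spanning the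
  quotient.\<close>

lemma zero_or_line_multipath_cohomology:
  fixes K :: "'k::field itself"
  assumes r: "linear_order_on (parcs L) r"
  shows "zero_or_line (map_option int (cohomology_degree (\<lambda>i. unstable L (v i)) (n - 1)) = Some m)
    (multipath_cohomology K r L m)"
    (is "zero_or_line ?d _")
proof -
  let ?s = "face_signs r :: nat set \<Rightarrow> nat \<Rightarrow> 'k"
  let ?C = "\<lambda>m. cochain_space L m :: ('k, 'v pair_pre_digraph \<Rightarrow> 'k) module"
  let ?d' = "differential r L :: ('v pair_pre_digraph \<Rightarrow> 'k) \<Rightarrow> 'v pair_pre_digraph \<Rightarrow> 'k"
  note D = simplicial_faces
  note s = incidence_signs_faces[OF r, where 'k = 'k]
  define Z where "Z = {c \<in> carrier (?C m). ?d' c = (\<lambda>_. 0)}"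
  define B where "B = ?d' ` carrier (?C (m - 1))"
  define V where "V = (?C m)\<lparr>carrier := Z\<rparr>"
  have C: "fun_module (?C k)" for k unfolding cochain_space_def by (rule fun_module_free_space)
  then have Cs: "fun_subspace (carrier (?C k))" for k by (simp add: fun_module_def)
  have pull_add: "pull (\<lambda>x. f x + g x) = (\<lambda>X. pull f X + pull g X)"
    and pull_scale: "pull (\<lambda>x. a * f x) = (\<lambda>X. a * pull f X)"
    and push_add: "push (\<lambda>x. f' x + g' x) = (\<lambda>X. push f' X + push g' X)"
    and push_scale: "push (\<lambda>x. a * f' x) = (\<lambda>X. a * push f' X)"
    for f g :: "'v pair_pre_digraph \<Rightarrow> 'k" and f' g' a
    by (auto simp: pull_def push_def fun_eq_iff)
  have push0: "push (\<lambda>_. 0) = (\<lambda>_. 0 :: 'k)" by (auto simp: push_def)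
  have d_add: "?d' (\<lambda>x. f x + g x) = (\<lambda>X. ?d' f X + ?d' g X)" for f g
    unfolding differential_eq pull_add coboundary_add push_add ..
  have d_scale: "?d' (\<lambda>x. a * f x) = (\<lambda>X. a * ?d' f X)" for f a
    unfolding differential_eq pull_scale coboundary_scale push_scale ..
  have d0: "?d' (\<lambda>_. 0) = (\<lambda>_. 0)" using d_scale[of 0 "\<lambda>_. 0"] by simp
  have d_push: "?d' (push f) = push (coboundary faces ?s f)" if "f \<in> cochains faces k" for f k
    unfolding differential_eq using pull_push[OF that] by simp
  have cob: "coboundary faces ?s f \<in> cochains faces k" if "f \<in> cochains faces (k - 1)" for f k
    using coboundary_in_cochains[OF D that] .
  have d_zero_iff: "?d' c = (\<lambda>_. 0) \<longleftrightarrow> coboundary faces ?s (pull c) = (\<lambda>_. 0)" if "c \<in> carrier (?C k)" for c k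
  proof
    assume "?d' c = (\<lambda>_. 0)"
    then have "pull (push (coboundary faces ?s (pull c))) = pull (\<lambda>_. 0)" by (simp add: differential_eq)
    moreover have "pull (\<lambda>_. 0) = (\<lambda>_. 0 :: 'k)" by (auto simp: pull_def)
    moreover have "pull (push (coboundary faces ?s (pull c))) = coboundary faces ?s (pull c)"
      by (rule pull_push[OF cob[of _ "k + 1"]]) (use pull_cochains[OF that] in simp)
    ultimately show "coboundary faces ?s (pull c) = (\<lambda>_. 0)" by simp
  qed (simp add: differential_eq push0)
  have B: "B = push ` coboundary faces ?s ` cochains faces (m - 1)"
  proof
    show "B \<subseteq> push ` coboundary faces ?s ` cochains faces (m - 1)"
      unfolding B_def differential_eq using pull_cochains by blast
    show "push ` coboundary faces ?s ` cochains faces (m - 1) \<subseteq> B"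
    proof
      fix c assume "c \<in> push ` coboundary faces ?s ` cochains faces (m - 1)"
      then obtain g where "g \<in> cochains faces (m - 1)" "c = push (coboundary faces ?s g)" by blast
      then show "c \<in> B" unfolding B_def using d_push push_cochain_space by (metis image_eqI)
    qed
  qed
  have BZ: "B \<subseteq> Z"
  proof
    fix c assume "c \<in> B"
    then obtain g where g: "g \<in> cochains faces (m - 1)" "c = push (coboundary faces ?s g)" unfolding B by blast
    have "?d' c = (\<lambda>_. 0)" unfolding g(2) d_push[OF cob[OF g(1)]] coboundary_coboundary[OF D s] by (rule push0)
    then show "c \<in> Z" unfolding Z_def using push_cochain_space[OF cob[OF g(1)]] g(2) by blast
  qed
  have V: "fun_module V"
    using fun_subspaceD[OF Cs[of m]] C[of m] d_add d_scale d0
    unfolding fun_module_def fun_subspace_def V_def Z_def by auto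
  have Bs: "fun_subspace B"
    unfolding fun_subspace_def
  proof (intro conjI ballI allI)
    note S = fun_subspaceD[OF Cs[of "m - 1"]]
    show "(\<lambda>_. 0) \<in> B" unfolding B_def using d0 S(1) by (metis image_eqI)
    fix f g assume "f \<in> B" "g \<in> B"
    then obtain f' g' where fg: "f' \<in> carrier (?C (m - 1))" "g' \<in> carrier (?C (m - 1))" "f = ?d' f'" "g = ?d' g'"
      unfolding B_def by blast
    show "(\<lambda>x. f x + g x) \<in> B"
      unfolding B_def fg(3,4) d_add[symmetric] by (rule imageI[OF S(2)[OF fg(1,2)]])
  next
    note S = fun_subspaceD[OF Cs[of "m - 1"]]
    fix a f assume "f \<in> B"
    then obtain f' where f: "f' \<in> carrier (?C (m - 1))" "f = ?d' f'"
      unfolding B_def by blast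
    show "(\<lambda>x. a * f x) \<in> B"
      unfolding B_def f(2) d_scale[symmetric] by (rule imageI[OF S(3)[OF f(1)]])
  qed
  from sparse_sets_cohomology[OF s[unfolded faces_def], of m, folded faces_def] obtain z where z: "z \<in> cochains faces m"
    "coboundary faces ?s z = (\<lambda>_. 0)" "z \<in> coboundary faces ?s ` cochains faces (m - 1) \<longleftrightarrow> \<not> ?d"
    "\<And>c. c \<in> cochains faces m \<Longrightarrow> coboundary faces ?s c = (\<lambda>_. 0) \<Longrightarrow>
       (\<exists>a. \<exists>g \<in> cochains faces (m - 1). c = (\<lambda>X. a * z X + coboundary faces ?s g X))"
    unfolding cohomology_dim_def by blast
  have "zero_or_line ?d (quotient_space V B)"
  proof (rule zero_or_line_quotient_spaceI[OF V Bs])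
    show "B \<subseteq> carrier V" using BZ by (simp add: V_def)
    show "push z \<in> carrier V"
      using push_cochain_space[OF z(1)] d_push[OF z(1)] by (simp add: V_def Z_def z(2) push0)
    show "push z \<in> B \<longleftrightarrow> \<not> ?d"
    proof -
      have "push z \<in> B \<longleftrightarrow> z \<in> coboundary faces ?s ` cochains faces (m - 1)"
      proof
        assume "push z \<in> B"
        then obtain g where g: "g \<in> cochains faces (m - 1)" "push z = push (coboundary faces ?s g)" unfolding B by blast
        then have "z = coboundary faces ?s g" using pull_push[OF z(1)] pull_push[OF cob[OF g(1)]] by metis
        then show "z \<in> coboundary faces ?s ` cochains faces (m - 1)" using g(1) by blast
      qed (auto simp: B)
      then show ?thesis using z(3) by simp
    qed
    fix c assume "c \<in> carrier V"
    then have c: "c \<in> carrier (?C m)" "?d' c = (\<lambda>_. 0)" by (auto simp: V_def Z_def)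
    then obtain a g where g: "g \<in> cochains faces (m - 1)" "pull c = (\<lambda>X. a * z X + coboundary faces ?s g X)"
      using z(4)[OF pull_cochains[OF c(1)]] d_zero_iff[OF c(1)] by blast
    have "c = push (pull c)" using push_pull[OF c(1)] by simp
    also have "\<dots> = (\<lambda>X. a * push z X + push (coboundary faces ?s g) X)"
      unfolding g(2) push_add push_scale ..
    finally have "(\<lambda>x. c x - a * push z x) = push (coboundary faces ?s g)" by simp
    then show "\<exists>a. (\<lambda>x. c x - a * push z x) \<in> B" using g(1) unfolding B by blast
  qed
  moreover have "\<zero>\<^bsub>?C (m + 1)\<^esub> = (\<lambda>_. 0)" using C[of "m + 1"] by (simp add: fun_module_def)
  ultimately show ?thesis unfolding multipath_cohomology_def Let_def V_def Z_def B_def by simp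
qed

end


section \<open>The blocks of the reduction\<close>


text \<open>By \<open>c = 0 \<or> t c\<close> a new path begins after the edge \<open>c\<close>; it
  consists of the next m edges. The recursion drops three of them and adds 1 to the degree until m
  is 0, 1 or 2: nothing, an isolated vertex (acyclic), or two conflicting vertices, which still
  contribute 1.\<close>

lemma cohomology_degree_add:
  assumes "c = 0 \<or> t c" "\<And>i. 0 < i \<Longrightarrow> i < m \<Longrightarrow> \<not> t (c + i)"
  shows "cohomology_degree t (c + m) =
    (if m mod 3 = 1 then None else map_option (\<lambda>x. x + (m + 1) div 3) (cohomology_degree t c))"
  using assms(2)
proof (induction m rule: less_induct)
  case (less m)
  consider "m = 0" | "m = 1" | "m = 2" | q where "m = q + 3"
    by (metis One_nat_def Suc_1 add.commute add_2_eq_Suc' le_Suc_ex less_2_cases less_Suc_eq not_less numeral_3_eq_3)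
  then show ?case
  proof cases
    case 1
    then show ?thesis by (simp add: option.map_id0[unfolded id_def])
  next
    case 2
    then show ?thesis using assms(1) by (cases c) auto
  next
    case 3
    \<comment> \<open>The link ends exactly at c: either \<open>t c\<close> holds, or c = 0 and
      truncated subtraction gives 0 again.\<close>
    then show ?thesis using assms(1) less.prems[of 1] by auto
  next
    case (4 q)
    \<comment> \<open>These two forbidden adjacencies make the recursion drop three edges at
      once.\<close>
    have 1: "\<not> t (Suc (c + q))" "\<not> t (Suc (Suc (c + q)))"
      using less.prems[of "Suc q"] less.prems[of "Suc (Suc q)"] 4 by auto
    have "c + m = Suc (Suc (Suc (c + q)))" using 4 by simp
    then have "cohomology_degree t (c + m) = map_option Suc (cohomology_degree t (c + q))"
      using 1 by (simp only: cohomology_degree.simps if_False diff_Suc_1)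
    also have "cohomology_degree t (c + q) =
        (if q mod 3 = 1 then None else map_option (\<lambda>x. x + (q + 1) div 3) (cohomology_degree t c))"
      using 4 less.prems by (intro less.IH) auto
    finally have eq: "cohomology_degree t (c + m) = map_option Suc
        (if q mod 3 = 1 then None else map_option (\<lambda>x. x + (q + 1) div 3) (cohomology_degree t c))" .
    have "m mod 3 = q mod 3" "(m + 1) div 3 = Suc ((q + 1) div 3)" using 4 by presburger+
    then show ?thesis unfolding eq by (cases "cohomology_degree t c") simp_all
  qed
qed

section \<open>Alternating graphs and graded tensor products\<close>

lemma alternating_graph_line: "oriented_line id (Suc k) (alternating_graph b k)"
proof
  have mem: "(x, y) \<in> parcs (alternating_graph b k) \<longleftrightarrow>
      (y = x + 1 \<and> x < k \<and> even x = b) \<or> (x = y + 1 \<and> y < k \<and> even y \<noteq> b)" for x y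
    by (auto simp: alternating_graph_def image_iff split: if_splits)
  show "oriented_linear_graph id (Suc k) (alternating_graph b k)"
    unfolding oriented_linear_graph_def
  proof (intro conjI ballI)
    show "pverts (alternating_graph b k) = id ` {..<Suc k}" by (auto simp: alternating_graph_def)
    show "parcs (alternating_graph b k) \<subseteq> (\<Union>i\<in>{1..<Suc k}. {(id i, id (i - 1)), (id (i - 1), id i)})"
    proof (rule subrelI)
      fix x y assume "(x, y) \<in> parcs (alternating_graph b k)"
      then show "(x, y) \<in> (\<Union>i\<in>{1..<Suc k}. {(id i, id (i - 1)), (id (i - 1), id i)})"
        unfolding mem by (elim disjE) (auto intro: bexI[of _ "max x y"])
    qed
    fix i assume "i \<in> {1..<Suc k}"
    then obtain j where "i = Suc j" "j < k" by (cases i) auto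
    then show "((id i, id (i - 1)) \<in> parcs (alternating_graph b k)) \<noteq> ((id (i - 1), id i) \<in> parcs (alternating_graph b k))"
      by (auto simp: mem)
  qed simp
qed

lemma alternating_graph_not_unstable: "\<not> unstable (alternating_graph b k) i"
  unfolding unstable_def alternating_graph_def by (auto split: if_splits)

text \<open>No vertex of an alternating graph is unstable, so its k edges form one uncut path and
  \<open>cohomology_degree_add\<close> applies with c = 0.\<close>

lemma zero_or_line_alternating_graph:
  fixes K :: "'k::field itself"
  assumes "linear_order_on (parcs (alternating_graph b k)) s"
  shows "zero_or_line ((if k mod 3 = 1 then None else Some (int ((k + 1) div 3))) = Some m)
    (multipath_cohomology K s (alternating_graph b k) m)"
proof -
  have "cohomology_degree (\<lambda>i. unstable (alternating_graph b k) (id i)) (Suc k - 1) =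
      (if k mod 3 = 1 then None else Some ((k + 1) div 3))"
    using cohomology_degree_add[of 0 _ k] by (simp add: alternating_graph_not_unstable)
  then show ?thesis
    using oriented_line.zero_or_line_multipath_cohomology[OF alternating_graph_line assms, where K = K and m = m]
    by (auto split: if_splits)
qed

text \<open>Used to read off k from a component: \<open>alternating_graph b k\<close> has k + 1
  vertices.\<close>

lemma digraph_iso_card_verts: "digraph_iso G H \<Longrightarrow> card (verts H) = card (verts G)"
  by (auto simp: digraph_iso_def pre_digraph.digraph_isomorphism_def card_image)

text \<open>\<open>e l\<close> is the degree in which the factor l is a line, or \<open>None\<close>
  if it is zero in all degrees. Only the tuple of these degrees can contribute, so at most one
  summand is non-zero.\<close>

lemma zero_or_line_graded_tensor:
  fixes Vs :: "(int \<Rightarrow> ('k::field, 'a) module) list"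
  assumes "\<And>l m. l < length Vs \<Longrightarrow> zero_or_line (e l = Some m) ((Vs ! l) m)"
  shows "zero_or_line (\<exists>ds. length ds = length Vs \<and> sum_list ds = i \<and> (\<forall>l<length Vs. e l = Some (ds ! l)))
    (graded_tensor Vs i)"
proof -
  let ?I = "{ds. length ds = length Vs \<and> sum_list ds = i}"
  have "zero_or_line (\<exists>ds\<in>?I. \<forall>l<length Vs. e l = Some (ds ! l)) (graded_tensor Vs i)"
    unfolding graded_tensor_def
  proof (rule zero_or_line_direct_sum_space)
    fix ds assume ds: "ds \<in> ?I"
    let ?W = "map2 (\<lambda>V d. V d) Vs ds"
    have "zero_or_line (\<forall>l<length ?W. e l = Some (ds ! l)) (tensor_space ?W)"
      by (rule zero_or_line_tensor_space) (use ds assms in auto)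
    then show "zero_or_line (\<forall>l<length Vs. e l = Some (ds ! l)) (tensor_space ?W)" using ds by simp
  next
    fix ds ds' assume "ds \<in> ?I" "ds' \<in> ?I"
      "\<forall>l<length Vs. e l = Some (ds ! l)" "\<forall>l<length Vs. e l = Some (ds' ! l)"
    then show "ds = ds'" by (intro nth_equalityI) auto
  qed
  then show ?thesis by (simp add: conj_assoc)
qed

section \<open>Consecutive blocks and the total degree\<close>

context oriented_line
begin

lemma min_index_comp: "a \<le> b \<Longrightarrow> b < n \<Longrightarrow> min_index v n (with_proj (comp a b)) = a"
proof -
  assume ab: "a \<le> b" "b < n"
  have "{i. i < n \<and> v i \<in> v ` {a..b}} = {a..b}" using ab(2) by (auto simp: v_eq)
  then have "min_index v n (with_proj (comp a b)) = Min {a..b}" by (simp add: min_index_def)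
  also have "\<dots> = a" using ab by (intro Min_eqI) auto
  finally show ?thesis .
qed

lemma card_verts_comp: "b < n \<Longrightarrow> card (v ` {a..b}) = Suc b - a"
  by (subst card_image) (auto intro!: inj_onI simp: v_eq)

text \<open>The starts of blocks are exactly the indices below n outside X, and
  \<open>Suc (b j)\<close> is such an index unless it equals n. In the order by start it must
  therefore be the start of the next block.\<close>

lemma blocks_enumerated:
  assumes X: "X \<subseteq> {1..<n}" and n: "0 < n"
    and Cs: "set Cs = {with_proj (comp a b) | a b. block X a b}"
      "sorted_wrt (\<lambda>C D. min_index v n C < min_index v n D) Cs"
  shows "\<exists>g a b. length Cs = Suc g \<and>
    (\<forall>j\<le>g. block X (a j) (b j) \<and> Cs ! j = with_proj (comp (a j) (b j))) \<and>
    a 0 = 0 \<and> (\<forall>j<g. a (Suc j) = Suc (b j)) \<and> Suc (b g) = n"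
proof -
  let ?h = "length Cs"
  have "\<exists>a b. j < ?h \<longrightarrow> block X a b \<and> Cs ! j = with_proj (comp a b)" for j
    using Cs(1) nth_mem[of j Cs] by blast
  then obtain a b where ab: "\<And>j. j < ?h \<Longrightarrow> block X (a j) (b j) \<and> Cs ! j = with_proj (comp (a j) (b j))"
    by metis
  have le: "a j \<le> b j" "b j < n" "{Suc (a j)..b j} \<subseteq> X" "a j \<notin> X" "Suc (b j) \<notin> X" if "j < ?h" for j
    using ab[OF that] by (auto simp: block_def)
  have min: "min_index v n (Cs ! j) = a j" if "j < ?h" for j
    using ab[OF that] le[OF that] min_index_comp by simp
  have mono: "a i < a j" if "i < j" "j < ?h" for i j
    using sorted_wrt_nth_less[OF Cs(2) that] min that by simp
  have surj: "\<exists>j<?h. a j = c" if c: "c < n" "c \<notin> X" for c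
  proof -
    obtain a' b' where B: "block X a' b'" "a' \<le> c" "c \<le> b'" using block_exists[OF X c(1)] .
    \<comment> \<open>Beyond its start the block around c contains only indices in X.\<close>
    then have "a' = c" using c(2) unfolding block_def
      by (metis Suc_leI atLeastAtMost_iff le_neq_implies_less subsetD)
    have "with_proj (comp a' b') \<in> set Cs" using B(1) Cs(1) by blast
    then obtain j where j: "j < ?h" "Cs ! j = with_proj (comp a' b')" by (metis in_set_conv_nth)
    then have "a j = a'" using min[OF j(1)] min_index_comp[of a' b'] B(1) by (simp add: block_def)
    then show ?thesis using j(1) \<open>a' = c\<close> by blast
  qed
  have "0 \<notin> X" using X by auto
  then obtain j0 where j0: "j0 < ?h" "a j0 = 0" using surj n by blast
  then have h: "0 < ?h" and a0: "a 0 = 0" using mono[of 0 j0] by (cases "j0 = 0"; auto)+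
  define g where "g = ?h - 1"
  have hg: "?h = Suc g" using h by (simp add: g_def)
  have next_gt: "b j < a l" if "j < l" "l < ?h" for j l
  proof (rule ccontr)
    assume "\<not> b j < a l"
    then have "a l \<in> {Suc (a j)..b j}" using mono[OF that] by simp
    then show False using le(3)[of j] le(4)[OF that(2)] that by auto
  qed
  have step: "a (Suc j) = Suc (b j)" if j: "j < g" for j
  proof -
    have "b j < a (Suc j)" by (rule next_gt) (use j hg in auto)
    moreover have "a (Suc j) < n" using le(1,2)[of "Suc j"] j hg by simp
    ultimately have "Suc (b j) < n" by simp
    \<comment> \<open>The block l starts right after block j; monotonicity puts it after j, and no
      other start fits in between.\<close>
    then obtain l where l: "l < ?h" "a l = Suc (b j)" using surj le(5)[of j] j hg by auto
    have "a j < a l" using l(2) le(1)[of j] j hg by simp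
    then have "j < l" using mono[of l j] j hg by (metis less_Suc_eq linorder_neqE_nat not_less_iff_gr_or_eq)
    then have "a (Suc j) \<le> a l" using mono[of "Suc j" l] l(1) by (cases "Suc j = l") auto
    then show ?thesis using \<open>b j < a (Suc j)\<close> l(2) by simp
  qed
  have last: "Suc (b g) = n"
  proof (rule ccontr)
    assume "Suc (b g) \<noteq> n"
    then have "Suc (b g) < n" using le(2)[of g] hg by simp
    then obtain l where l: "l < ?h" "a l = Suc (b g)" using surj le(5)[of g] hg by auto
    have "a g < a l" using l(2) le(1)[of g] hg by simp
    then have "g < l" using mono[of l g] hg by (metis lessI linorder_neqE_nat not_less_iff_gr_or_eq)
    then show False using l(1) hg by simp
  qed
  show ?thesis
    by (rule exI[of _ g], rule exI[of _ a], rule exI[of _ b]) (use hg ab a0 step last in auto)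
qed

text \<open>The path is cut at the unstable vertices, which are the block starts other than 0. Block
  j < g has \<open>b j - a j\<close> edges in X, and the deleted edge \<open>a (Suc j)\<close>
  leading to the next block also lies before the next cut, which makes one edge more; the last block
  has no such edge.\<close>

lemma cohomology_degree_blocks:
  assumes X: "X = {1..<n} - {i. i < n \<and> unstable L (v i)}"
    and bl: "\<And>j. j \<le> g \<Longrightarrow> block X (a j) (b j)" "a 0 = 0" "\<And>j. j < g \<Longrightarrow> a (Suc j) = Suc (b j)" "Suc (b g) = n"
  shows "cohomology_degree (\<lambda>i. unstable L (v i)) (n - 1) =
    (if (\<exists>j<g. (b j - a j) mod 3 = 0) \<or> (b g - a g) mod 3 = 1 then None
     else Some ((\<Sum>j<g. (b j - a j + 2) div 3) + (b g - a g + 1) div 3))"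
proof -
  let ?t = "\<lambda>i. unstable L (v i)"
  have ab: "a j \<le> b j" "b j < n" "{Suc (a j)..b j} \<subseteq> X" "a j \<notin> X" if "j \<le> g" for j
    using bl(1)[OF that] by (auto simp: block_def)
  have start: "a j = 0 \<or> ?t (a j)" if "j \<le> g" for j
    using ab[OF that] unfolding X by auto
  have inner: "\<not> ?t (a j + i)" if "j \<le> g" "0 < i" "a j + i \<le> b j" for i j
  proof -
    have "a j + i \<in> X" using ab(3)[OF that(1)] that(2,3) by auto
    then show ?thesis unfolding X by auto
  qed
  have "cohomology_degree ?t (a j) = (if \<exists>i<j. (b i - a i) mod 3 = 0 then None
     else Some (\<Sum>i<j. (b i - a i + 2) div 3))" if "j \<le> g" for j
    using that
  proof (induction j)
    case 0
    then show ?case using bl(2) by simp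
  next
    case (Suc j)
    define m where "m = Suc (b j - a j)"
    have j: "j \<le> g" "j < g" using Suc.prems by auto
    have "a (Suc j) = a j + m" using bl(3)[OF j(2)] ab(1)[OF j(1)] by (simp add: m_def)
    moreover have "\<not> ?t (a j + i)" if "0 < i" "i < m" for i
      by (rule inner) (use that j ab(1)[OF j(1)] in \<open>auto simp: m_def\<close>)
    ultimately have eq: "cohomology_degree ?t (a (Suc j)) =
      (if m mod 3 = 1 then None else map_option (\<lambda>x. x + (m + 1) div 3) (cohomology_degree ?t (a j)))"
      using cohomology_degree_add[where c = "a j" and t = ?t and m = m, OF start[OF j(1)]] by simp
    have "Suc x mod 3 = 1 \<longleftrightarrow> x mod 3 = 0" for x :: nat by presburger
    then have m1: "m mod 3 = 1 \<longleftrightarrow> (b j - a j) mod 3 = 0" unfolding m_def .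
    have m2: "m + 1 = b j - a j + 2" by (simp add: m_def)
    have ex: "(\<exists>i<Suc j. F i) \<longleftrightarrow> (\<exists>i<j. F i) \<or> F j" for F :: "nat \<Rightarrow> bool"
      by (metis less_Suc_eq)
    show ?case unfolding eq Suc.IH[OF j(1)] ex m1 m2 sum.lessThan_Suc by simp
  qed
  from this[of g] have g: "cohomology_degree ?t (a g) = (if \<exists>i<g. (b i - a i) mod 3 = 0 then None
     else Some (\<Sum>i<g. (b i - a i + 2) div 3))" by simp
  define m where "m = b g - a g"
  have "n - 1 = a g + m" using bl(4) ab(1)[of g] by (simp add: m_def)
  moreover have "\<not> ?t (a g + i)" if "0 < i" "i < m" for i
    by (rule inner) (use that in \<open>auto simp: m_def\<close>)
  ultimately have eq: "cohomology_degree ?t (n - 1) =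
      (if m mod 3 = 1 then None else map_option (\<lambda>x. x + (m + 1) div 3) (cohomology_degree ?t (a g)))"
    using cohomology_degree_add[where c = "a g" and t = ?t and m = m, OF start[OF order_refl]] by simp
  show ?thesis unfolding eq g m_def[symmetric] by auto
qed

end

theorem theorem5p11:
  fixes K :: "'k::field itself"
    and L :: "'v pair_pre_digraph" and v :: "nat \<Rightarrow> 'v" and n :: nat
    and r :: "('v \<times> 'v) rel"
    and Cs :: "('v, 'v \<times> 'v) pre_digraph list" and h :: nat and k :: "nat \<Rightarrow> nat"
    and b :: "nat \<Rightarrow> bool" and A :: "nat \<Rightarrow> nat pair_pre_digraph" and s :: "nat \<Rightarrow> (nat \<times> nat) rel"
  assumes L: "oriented_linear_graph v n L"
    and D: "property_D 2 L" "\<not> property_D 1 L"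
    and r: "linear_order_on (parcs L) r"
    and components: "set Cs = weak_components (reduction v n L)"
      "sorted_wrt (\<lambda>C D. min_index v n C < min_index v n D) Cs" "length Cs = h"
    and k: "\<And>j. j \<in> {1..h} \<Longrightarrow> \<exists>c. digraph_iso (Cs ! (j - 1)) (alternating_graph c (k j))"
    \<comment> \<open>the tensor factors, with an arbitrary alternating orientation and an arbitrary order
        of the edges of each of them\<close>
    and A: "\<And>j. j \<in> {1..<h} \<Longrightarrow> A j = alternating_graph (b j) (3 * (k j div 3))"
      "A h = alternating_graph (b h) (k h)"
    and s: "\<And>j. j \<in> {1..h} \<Longrightarrow> linear_order_on (parcs (A j)) (s j)"
  shows "((\<exists>j \<in> {1..<h}. k j mod 3 = 0) \<longrightarrow>
           (\<forall>i. carrier (multipath_cohomology K r L i) = {\<zero>\<^bsub>multipath_cohomology K r L i\<^esub>})) \<and>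
         (\<not> (\<exists>j \<in> {1..<h}. k j mod 3 = 0) \<longrightarrow>
           (\<forall>i. space_iso (multipath_cohomology K r L (i + int h - 1))
                  (graded_tensor (map (\<lambda>j. multipath_cohomology K (s j) (A j)) [1..<h + 1]) i)))"
proof -
  interpret oriented_line v n L by unfold_locales (rule L)
  define X where "X = {1..<n} - {i. i < n \<and> unstable L (v i)}"
  have X: "X \<subseteq> {1..<n}" by (auto simp: X_def)
  \<comment> \<open>A graph without vertices satisfies D(1) vacuously.\<close>
  have n: "0 < n" using D(2) verts_L by (cases n) (auto simp: property_D_def stable_def)
  have Cs: "set Cs = {with_proj (comp a b) | a b. block X a b}"
    unfolding components(1) reduction_eq[OF D(1)] X_def by (rule weak_components_sub) auto
  obtain g a e where g: "length Cs = Suc g"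
    and C: "\<And>j. j \<le> g \<Longrightarrow> block X (a j) (e j) \<and> Cs ! j = with_proj (comp (a j) (e j))"
    and ae: "a 0 = 0" "\<And>j. j < g \<Longrightarrow> a (Suc j) = Suc (e j)" "Suc (e g) = n"
    using blocks_enumerated[OF X n Cs components(2)] by blast
  have h: "h = Suc g" using g components(3) by simp
  \<comment> \<open>Both sides are one less than the number of vertices of the component; the
    components are counted from 1 in the theorem and from 0 in the list.\<close>
  have kj: "k (Suc j) = e j - a j" if j: "j \<le> g" for j
  proof -
    from k[of "Suc j"] j h obtain c where "digraph_iso (Cs ! j) (alternating_graph c (k (Suc j)))" by auto
    then have "card {0..k (Suc j)} = card (v ` {a j..e j})"
      using digraph_iso_card_verts C[OF j] by (fastforce simp: alternating_graph_def)
    moreover have "a j \<le> e j" "e j < n" using C[OF j] by (auto simp: block_def)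
    ultimately show ?thesis by (simp add: card_verts_comp)
  qed
  \<comment> \<open>The only degree in which L can have non-zero cohomology.\<close>
  define \<delta> where "\<delta> = cohomology_degree (\<lambda>i. unstable L (v i)) (n - 1)"
  have "\<delta> = (if (\<exists>j<g. (e j - a j) mod 3 = 0) \<or> (e g - a g) mod 3 = 1 then None
     else Some ((\<Sum>j<g. (e j - a j + 2) div 3) + (e g - a g + 1) div 3))"
    unfolding \<delta>_def by (rule cohomology_degree_blocks[OF X_def]) (use C ae in auto)
  moreover have "(\<exists>j<g. (e j - a j) mod 3 = 0) \<longleftrightarrow> (\<exists>j<g. k (Suc j) mod 3 = 0)" using kj by auto
  moreover have "(\<Sum>j<g. (e j - a j + 2) div 3) = (\<Sum>j<g. (k (Suc j) + 2) div 3)" using kj by simp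
  ultimately have \<delta>: "\<delta> = (if (\<exists>j<g. k (Suc j) mod 3 = 0) \<or> k h mod 3 = 1 then None
     else Some ((\<Sum>j<g. (k (Suc j) + 2) div 3) + (k h + 1) div 3))"
    using kj[of g] h by simp
  have ex: "(\<exists>j\<in>{1..<h}. k j mod 3 = 0) \<longleftrightarrow> (\<exists>j<g. k (Suc j) mod 3 = 0)"
  proof -
    have "j \<in> {1..<h} \<longleftrightarrow> (\<exists>i<g. j = Suc i)" for j by (cases j) (auto simp: h)
    then show ?thesis unfolding Bex_def by metis
  qed
  have H: "zero_or_line (map_option int \<delta> = Some m) (multipath_cohomology K r L m)" for m
    unfolding \<delta>_def by (rule zero_or_line_multipath_cohomology[OF r])
  show ?thesis unfolding ex
  proof (intro conjI impI allI)
    fix i assume "\<exists>j<g. k (Suc j) mod 3 = 0"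
    then have "\<delta> = None" by (simp add: \<delta>)
    then show "carrier (multipath_cohomology K r L i) = {\<zero>\<^bsub>multipath_cohomology K r L i\<^esub>}"
      using H[of i] zero_or_line_False by simp
  next
    fix i assume nz: "\<not> (\<exists>j<g. k (Suc j) mod 3 = 0)"
    define Vs where "Vs = map (\<lambda>j. multipath_cohomology K (s j) (A j)) [1..<h + 1]"
    \<comment> \<open>The degrees of the factors. A truncated factor has a multiple of 3 edges, so
      it is never acyclic and sits in degree k div 3; the last factor keeps its remainder and may be
      acyclic.\<close>
    define d where "d l = (if l < g then Some (int (k (Suc l) div 3))
      else if k h mod 3 = 1 then None else Some (int ((k h + 1) div 3)))" for l
    have len: "length Vs = h" by (simp add: Vs_def)
    have factor: "zero_or_line (d l = Some m) ((Vs ! l) m)" if l: "l < length Vs" for l m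
    proof -
      have Vl: "(Vs ! l) m = multipath_cohomology K (s (Suc l)) (A (Suc l)) m"
        using l by (simp add: Vs_def len del: upt_Suc)
      have ord: "linear_order_on (parcs (A (Suc l))) (s (Suc l))" using s l len by simp
      show ?thesis
      proof (cases "l < g")
        case True
        have "Suc (3 * x) div 3 = x" for x :: nat by presburger
        moreover from True have "A (Suc l) = alternating_graph (b (Suc l)) (3 * (k (Suc l) div 3))" using A(1) h by simp
        ultimately show ?thesis
          using zero_or_line_alternating_graph[where b = "b (Suc l)" and k = "3 * (k (Suc l) div 3)" and s = "s (Suc l)" and m = m and K = K] ord True Vl
          by (simp add: d_def)
      next
        case False
        then have "Suc l = h" using l len h by simp
        then show ?thesis
          using zero_or_line_alternating_graph[where b = "b h" and k = "k h" and s = "s h" and m = m and K = K] ord False Vl A(2)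
          by (simp add: d_def)
      qed
    qed
    have "(\<exists>ds. length ds = length Vs \<and> sum_list ds = i \<and> (\<forall>l<length Vs. d l = Some (ds ! l)))
        \<longleftrightarrow> map_option int \<delta> = Some (i + int h - 1)"
    proof (cases "k h mod 3 = 1")
      case True
      then have "d g = None" by (simp add: d_def)
      then show ?thesis using True \<delta> len h by auto
    next
      case False
      \<comment> \<open>Now every factor has a degree, so the tuple is forced and only its sum
        remains to be compared with i.\<close>
      define E where "E l = the (d l)" for l
      have dE: "d l = Some (E l)" for l using False by (simp add: E_def d_def)
      have "(\<exists>ds. length ds = h \<and> sum_list ds = i \<and> (\<forall>l<h. d l = Some (ds ! l))) \<longleftrightarrow> (\<Sum>l<h. E l) = i"
      proof
        assume "\<exists>ds. length ds = h \<and> sum_list ds = i \<and> (\<forall>l<h. d l = Some (ds ! l))"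
        then obtain ds where "length ds = h" "sum_list ds = i" "\<forall>l<h. E l = ds ! l" by (auto simp: dE)
        then show "(\<Sum>l<h. E l) = i" by (simp add: sum_list_sum_nth lessThan_atLeast0)
      next
        assume "(\<Sum>l<h. E l) = i"
        then show "\<exists>ds. length ds = h \<and> sum_list ds = i \<and> (\<forall>l<h. d l = Some (ds ! l))"
          by (intro exI[of _ "map E [0..<h]"])
             (simp add: dE sum_list_sum_nth lessThan_atLeast0 del: upt_Suc)
      qed
      moreover have "(\<Sum>l<h. E l) = (\<Sum>l<g. int (k (Suc l) div 3)) + int ((k h + 1) div 3)"
        unfolding h sum.lessThan_Suc using False by (simp add: E_def d_def h)
      \<comment> \<open>The deleted edge following each block before the last raises the degree by
        one; these g = h - 1 units are the shift.\<close>
      moreover have "(\<Sum>j<g. int ((k (Suc j) + 2) div 3)) = (\<Sum>j<g. int (k (Suc j) div 3)) + int g"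
      proof -
        have "(x + 2) div 3 = x div 3 + 1" if "x mod 3 \<noteq> 0" for x :: nat using that by presburger
        then have "(\<Sum>j<g. int ((k (Suc j) + 2) div 3)) = (\<Sum>j<g. int (k (Suc j) div 3) + 1)"
          using nz by (intro sum.cong) auto
        then show ?thesis by (simp add: sum.distrib)
      qed
      ultimately show ?thesis using False nz by (auto simp: \<delta> len h)
    qed
    then have "zero_or_line (map_option int \<delta> = Some (i + int h - 1)) (graded_tensor Vs i)"
      using zero_or_line_graded_tensor[of Vs d i] factor by simp
    then show "space_iso (multipath_cohomology K r L (i + int h - 1))
        (graded_tensor (map (\<lambda>j. multipath_cohomology K (s j) (A j)) [1..<h + 1]) i)"
      unfolding Vs_def[symmetric] by (rule space_iso_zero_or_line[OF H])
  qed
qed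

end
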